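(* Let $k$ be a finite field of order $q$, and let $K$ be a quadratic extension of the rational function field $k(x)$ (with $k$ the full constant field of $K$) in which the infinite place of $k(x)$ (the pole of $x$) ramifies. Let $h$ be the class number of $K$ and let $t$ be the number of places of $k(x)$ that ramify in $K$. Then the group of divisor classes of degree zero of $K$ has exponent two if and only if $h=2^{t-2}$ when $q\equiv 1 \pmod 2$, and $h=2^{t-1}$ when $q\equiv 0\pmod 2$.
   Context: The class number $h$ of $K$ is the order of the group of divisor classes of degree zero of $K/k$. When the infinite place of $k(x)$ ramifies in the quadratic extension $K$, this group coincides with the ideal class group of $K$ (the class group of the integral closure of $k[x]$ in $K$). *)

theory Defs
  imports
    "HOL-Computational_Algebra.Polynomial"
    "HOL-Computational_Algebra.Fraction_Field"
    "HOL-Algebra.Free_Abelian_Groups"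
    "HOL-Library.FuncSet"
    "HOL-Library.Cardinality"
begin

section \<open>The rational function field and its extensions\<close>

text \<open>The rational function field over \<open>'k\<close> is the type \<open>'k poly fract\<close>.  An extension field
  of it is a field type together with a field embedding.\<close>

definition ratfun_const :: "'k::field \<Rightarrow> 'k poly fract" where
  "ratfun_const c = Fract [:c:] 1"

definition ratfun_x :: "'k::field poly fract" where
  "ratfun_x = Fract [:0, 1:] 1"

definition field_embedding :: "('a::field \<Rightarrow> 'b::field) \<Rightarrow> bool" where
  "field_embedding \<iota> \<longleftrightarrow>
     \<iota> 1 = 1 \<and> (\<forall>a b. \<iota> (a + b) = \<iota> a + \<iota> b) \<and> (\<forall>a b. \<iota> (a * b) = \<iota> a * \<iota> b)"

text \<open>The library dimension is 0 for infinite-dimensional spaces, so the value is the true degree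
  whenever it is positive.\<close>

definition extension_degree :: "('a::field \<Rightarrow> 'b::field) \<Rightarrow> nat" where
  "extension_degree \<iota> = vector_space.dim (\<lambda>a z. \<iota> a * z) (UNIV :: 'b set)"

definition full_constant_field :: "('k::field \<Rightarrow> 'a::field) \<Rightarrow> bool" where
  "full_constant_field \<kappa> \<longleftrightarrow>
     (\<forall>z. (\<exists>p::'k poly. p \<noteq> 0 \<and> poly (map_poly \<kappa> p) z = 0) \<longrightarrow> z \<in> range \<kappa>)"


section \<open>Places\<close>

text \<open>In the following, \<open>\<kappa>\<close> embeds the field of constants into a function field.  A place
  is represented by its normalized discrete valuation, trivial on the constants.  Only the values at
  nonzero elements matter; the dummy value \<open>v 0 = 0\<close> (instead of infinity) makes the
  representation unique.\<close>

definition places :: "('k::field \<Rightarrow> 'a::field) \<Rightarrow> ('a \<Rightarrow> int) set" where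
  "places \<kappa> = {v. v 0 = 0 \<and>
     (\<forall>a b. a \<noteq> 0 \<longrightarrow> b \<noteq> 0 \<longrightarrow> v (a * b) = v a + v b) \<and>
     (\<forall>a b. a \<noteq> 0 \<longrightarrow> b \<noteq> 0 \<longrightarrow> a + b \<noteq> 0 \<longrightarrow> min (v a) (v b) \<le> v (a + b)) \<and>
     (\<exists>a. v a = 1) \<and>
     (\<forall>c. v (\<kappa> c) = 0)}"

definition place_ring :: "('a::field \<Rightarrow> int) \<Rightarrow> 'a set" where
  "place_ring v = {a. a = 0 \<or> 0 \<le> v a}"

definition place_ideal :: "('a::field \<Rightarrow> int) \<Rightarrow> 'a set" where
  "place_ideal v = {a. a = 0 \<or> 0 < v a}"

text \<open>The residue classes of the elements of \<open>B\<close> are pairwise distinct and form a basis of the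
  residue field \<open>place_ring v / place_ideal v\<close> over the constants.\<close>

definition residue_basis ::
    "('k::field \<Rightarrow> 'a::field) \<Rightarrow> ('a \<Rightarrow> int) \<Rightarrow> 'a set \<Rightarrow> bool" where
  "residue_basis \<kappa> v B \<longleftrightarrow> finite B \<and> B \<subseteq> place_ring v \<and>
     (\<forall>a\<in>place_ring v. \<exists>!c. c \<in> B \<rightarrow>\<^sub>E (UNIV :: 'k set) \<and>
        a - (\<Sum>b\<in>B. \<kappa> (c b) * b) \<in> place_ideal v)"

definition place_degree :: "('k::field \<Rightarrow> 'a::field) \<Rightarrow> ('a \<Rightarrow> int) \<Rightarrow> nat" where
  "place_degree \<kappa> v = (THE n. \<exists>B. residue_basis \<kappa> v B \<and> card B = n)"

definition lies_over :: "('a::field \<Rightarrow> 'b::field) \<Rightarrow> ('a \<Rightarrow> int) \<Rightarrow> nat \<Rightarrow> ('b \<Rightarrow> int) \<Rightarrow> bool" where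
  \<comment> \<open>\<open>w\<close> lies over \<open>v\<close> with ramification index \<open>e\<close>\<close>
  "lies_over \<iota> v e w \<longleftrightarrow> 1 \<le> e \<and> (\<forall>a. w (\<iota> a) = int e * v a)"

definition ramified :: "('a::field \<Rightarrow> 'b::field) \<Rightarrow> ('k::field \<Rightarrow> 'a) \<Rightarrow> ('a \<Rightarrow> int) \<Rightarrow> bool" where
  "ramified \<iota> \<kappa> v \<longleftrightarrow> (\<exists>w\<in>places (\<iota> \<circ> \<kappa>). \<exists>e>1. lies_over \<iota> v e w)"


section \<open>Divisor classes of degree zero\<close>

definition divisor_degree ::
    "('k::field \<Rightarrow> 'a::field) \<Rightarrow> (('a \<Rightarrow> int) \<Rightarrow>\<^sub>0 int) \<Rightarrow> int" where
  "divisor_degree \<kappa> D =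
     (\<Sum>v\<in>Poly_Mapping.keys D. Poly_Mapping.lookup D v * int (place_degree \<kappa> v))"

definition degree_zero_divisors ::
    "('k::field \<Rightarrow> 'a::field) \<Rightarrow> (('a \<Rightarrow> int) \<Rightarrow>\<^sub>0 int) monoid" where
  "degree_zero_divisors \<kappa> = (free_Abelian_group (places \<kappa>))
     \<lparr>carrier := {D \<in> carrier (free_Abelian_group (places \<kappa>)). divisor_degree \<kappa> D = 0}\<rparr>"

definition principal_divisors ::
    "('k::field \<Rightarrow> 'a::field) \<Rightarrow> (('a \<Rightarrow> int) \<Rightarrow>\<^sub>0 int) set" where
  "principal_divisors \<kappa> = {D \<in> carrier (free_Abelian_group (places \<kappa>)).
     \<exists>f. f \<noteq> 0 \<and> (\<forall>v\<in>places \<kappa>. Poly_Mapping.lookup D v = v f)}"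

definition degree_zero_class_group ::
    "('k::field \<Rightarrow> 'a::field) \<Rightarrow> (('a \<Rightarrow> int) \<Rightarrow>\<^sub>0 int) set monoid" where
  "degree_zero_class_group \<kappa> = degree_zero_divisors \<kappa> Mod principal_divisors \<kappa>"

text \<open>Exponent two is meant as \<open>2 C = 0\<close> for every class \<open>C\<close>, which admits the trivial group.\<close>

definition has_exponent_two :: "('a, 'b) monoid_scheme \<Rightarrow> bool" where
  "has_exponent_two G \<longleftrightarrow> (\<forall>g\<in>carrier G. g [^]\<^bsub>G\<^esub> (2::nat) = \<one>\<^bsub>G\<^esub>)"

end

theory Submission
  imports Defs
begin

text \<open>
  This is genus theory. Let \<open>\<sigma>\<close> be the conjugation of \<open>K\<close> over \<open>k(x)\<close> and assume that the extension is
  separable. Since divisors of degree zero on \<open>k(x)\<close> are principal, \<open>D + \<sigma> D\<close> is principal for every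
  \<open>D\<close> of degree zero, so the classes killed by 2 are exactly the classes fixed by \<open>\<sigma>\<close>. If
  \<open>\<sigma> D - D = (f)\<close>, then \<open>f\<close> can be scaled to have norm 1, because the residue field at the ramified
  infinite place is \<open>k\<close>; Hilbert 90 then replaces \<open>D\<close> by an equivalent \<open>\<sigma>\<close>-invariant divisor, that
  is, by a sum of finite ramified places, normalised at infinity, up to a divisor coming from \<open>k(x)\<close>.
  There are \<open>2 ^ (t - 1)\<close> such sums. A relation between two of them comes from an \<open>f\<close> with
  \<open>\<sigma> f = f\<close> or \<open>\<sigma> f = - f\<close>: the first kind is trivial, and the second one exists only in odd
  characteristic, where it identifies each set of places with its complement. Hence the
  2-torsion has order \<open>2 ^ (t - 1)\<close> for even \<open>q\<close> and \<open>2 ^ (t - 2)\<close> for odd \<open>q\<close>, and it is the whole group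
  if and only if \<open>h\<close> has this value.

  The inseparable extension \<open>k(\<surd>x)\<close> in characteristic 2 has class number 1, and all its
  infinitely many places ramify, so that \<open>t\<close>, being the \<open>card\<close> of an infinite set, is 0.
\<close>

section \<open>Discrete valuations\<close>

text \<open>Places of \<open>K\<close> are given only as abstract valuations, while the argument
  needs their full relation to the places of \<open>k(x)\<close>: one above each place, no others
  than its conjugates, and the degrees in the split, ramified and inert case. With this,
  \<open>D + \<sigma> D\<close> becomes place by place the divisor of a norm from
  \<open>k(x)\<close>. The infinite place carries the bookkeeping. The place above it is fixed by
  \<sigma> and has degree 1, so a divisor of degree zero is determined by its finite part, where
  \<open>k[x]\<close> is a principal ideal domain. An element of \<open>k(x)\<close> without finite
  zeros and poles is constant, so two elements with equal finite values agree at infinity; this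
  comparison replaces a product formula. A relation between ramified places is realised by an
  \<open>f\<close> for which \<open>\<sigma> f / f\<close> has no zeros or poles. That quotient is a
  constant, hence fixed by \<sigma>, and of norm 1, hence 1 or -1. The sign shows in the parity of
  the values of \<open>f\<close>: at each ramified place they are even for the sign 1, and odd for
  the sign -1 in odd characteristic.\<close>

text \<open>The dummy value \<open>v 0 = 0\<close> is replaced by infinity here: \<open>val_ge v 0 n\<close> holds for every \<open>n\<close>.\<close>

definition val_ge :: "('a::field \<Rightarrow> int) \<Rightarrow> 'a \<Rightarrow> int \<Rightarrow> bool" where
  "val_ge v a n \<longleftrightarrow> a = 0 \<or> n \<le> v a"

lemma val_ge_0 [simp]: "val_ge v 0 n"
  by (simp add: val_ge_def)

lemma val_ge_mono: "val_ge v a n \<Longrightarrow> m \<le> n \<Longrightarrow> val_ge v a m"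
  by (auto simp: val_ge_def)

lemma place_ring_iff: "a \<in> place_ring v \<longleftrightarrow> val_ge v a 0"
  by (simp add: place_ring_def val_ge_def)

lemma place_ideal_iff: "a \<in> place_ideal v \<longleftrightarrow> val_ge v a 1"
  by (auto simp: place_ideal_def val_ge_def)

locale valuation =
  fixes v :: "'a::field \<Rightarrow> int"
  assumes zero [simp]: "v 0 = 0"
    and mult: "a \<noteq> 0 \<Longrightarrow> b \<noteq> 0 \<Longrightarrow> v (a * b) = v a + v b"
    and add_ge: "a \<noteq> 0 \<Longrightarrow> b \<noteq> 0 \<Longrightarrow> a + b \<noteq> 0 \<Longrightarrow> min (v a) (v b) \<le> v (a + b)"
begin

lemma one [simp]: "v 1 = 0"
  using mult[of 1 1] by simp

lemma uminus [simp]: "v (- a) = v a"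
proof (cases "a = 0")
  case False
  have "v (- 1) = 0" using mult[of "-1" "-1"] by simp
  then show ?thesis using mult[of "-1" a] False by simp
qed simp

lemma inverse: "v (inverse a) = - v a"
proof (cases "a = 0")
  case False
  then show ?thesis using mult[of a "inverse a"] by simp
qed simp

lemma divide: "a \<noteq> 0 \<Longrightarrow> b \<noteq> 0 \<Longrightarrow> v (a / b) = v a - v b"
  using mult[of a "inverse b"] by (simp add: divide_inverse inverse)

lemma power: "v (a ^ n) = int n * v a"
proof (cases "a = 0")
  case False
  then show ?thesis by (induction n) (simp_all add: mult algebra_simps)
qed (cases n, simp_all)

lemma power_int: "v (a powi n) = n * v a"
  by (simp add: power_int_def power inverse)

lemma prod_power_int:
  assumes "finite S" "\<And>i. i \<in> S \<Longrightarrow> a i \<noteq> 0"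
  shows "v (\<Prod>i\<in>S. a i powi n i) = (\<Sum>i\<in>S. n i * v (a i))"
  using assms
proof (induction S rule: finite_induct)
  case (insert i S)
  have "(\<Prod>i\<in>S. a i powi n i) \<noteq> 0" "a i powi n i \<noteq> 0" using insert by auto
  with insert show ?case by (simp add: mult power_int)
qed simp

lemma ge_add: "val_ge v a n \<Longrightarrow> val_ge v b n \<Longrightarrow> val_ge v (a + b) n"
  using add_ge[of a b] by (fastforce simp: val_ge_def)

lemma ge_uminus: "val_ge v a n \<Longrightarrow> val_ge v (- a) n"
  by (simp add: val_ge_def)

lemma ge_diff: "val_ge v a n \<Longrightarrow> val_ge v b n \<Longrightarrow> val_ge v (a - b) n"
  using ge_add[of a n "- b"] ge_uminus by simp

lemma ge_mult: "val_ge v a m \<Longrightarrow> val_ge v b n \<Longrightarrow> val_ge v (a * b) (m + n)"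
  using mult[of a b] by (fastforce simp: val_ge_def)

lemma ge_mult0: "val_ge v a 0 \<Longrightarrow> val_ge v b n \<Longrightarrow> val_ge v (a * b) n"
  using ge_mult[of a 0 b n] by simp

lemma ge_sum: "(\<And>i. i \<in> S \<Longrightarrow> val_ge v (f i) n) \<Longrightarrow> val_ge v (sum f S) n"
  by (induction S rule: infinite_finite_induct) (auto intro: ge_add)

lemma ge_one: "val_ge v 1 0"
  by (simp add: val_ge_def)

lemma ge_power: "val_ge v a 0 \<Longrightarrow> val_ge v (a ^ n) 0"
  by (auto simp: val_ge_def power)

lemma add_dominant:
  assumes "a \<noteq> 0" "val_ge v b (v a + 1)"
  shows "a + b \<noteq> 0" "v (a + b) = v a"
proof -
  show nz: "a + b \<noteq> 0"
    using assms by (metis add_eq_0_iff uminus val_ge_def zle_add1_eq_le zero less_irrefl neg_equal_0_iff_equal)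
  have "v (a + b) \<ge> v a"
    using add_ge[of a b] nz assms by (cases "b = 0") (auto simp: val_ge_def)
  moreover have "v (a + b) \<le> v a"
  proof (rule ccontr)
    assume "\<not> v (a + b) \<le> v a"
    then have "val_ge v (a + b - b) (v a + 1)"
      using assms(2) by (intro ge_diff) (simp_all add: val_ge_def)
    then show False using assms(1) by (simp add: val_ge_def)
  qed
  ultimately show "v (a + b) = v a" by simp
qed

lemma add_distinct:
  assumes "a \<noteq> 0" "b \<noteq> 0" "v a \<noteq> v b"
  shows "a + b \<noteq> 0" "v (a + b) = min (v a) (v b)"
  using add_dominant[of a b] add_dominant[of b a] assms
  by (cases "v a < v b"; simp add: val_ge_def min_def add.commute)+

text \<open>Valuation rings are integrally closed; here in degree 2. If \<open>v a\<close> were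
  negative, the square would strictly dominate the other two terms and the sum could not
  vanish.\<close>

lemma unit_root_cases:
  assumes "a \<noteq> 0" "val_ge v b 0" "val_ge v c 0" "a\<^sup>2 + b * a + c = 0"
  shows "v a \<ge> 0"
proof (rule ccontr)
  assume neg: "\<not> v a \<ge> 0"
  have "val_ge v (b * a + c) (v (a\<^sup>2) + 1)"
    using assms neg ge_mult0[of b a "v a"]
    by (intro ge_add) (auto simp: power val_ge_def)
  then show False using add_dominant(1)[of "a\<^sup>2" "b * a + c"] assms by (simp add: add.assoc)
qed

end

lemma places_valuation: "v \<in> places \<kappa> \<Longrightarrow> valuation v"
  by (auto simp: places_def valuation_def)

lemma places_const: "v \<in> places \<kappa> \<Longrightarrow> v (\<kappa> c) = 0"
  by (auto simp: places_def)

lemma places_uniformizer: "v \<in> places \<kappa> \<Longrightarrow> \<exists>a. a \<noteq> 0 \<and> v a = 1"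
  by (auto simp: places_def) (metis zero_neq_one)

lemma placesI:
  assumes "valuation v" "v a = 1" "\<And>c. v (\<kappa> c) = 0"
  shows "v \<in> places \<kappa>"
  using assms by (auto simp: places_def valuation_def)

section \<open>Places of the rational function field\<close>

abbreviation poly_fract :: "'k::field poly \<Rightarrow> 'k poly fract" where
  "poly_fract g \<equiv> Fract g 1"

lemma poly_fract_eq_0_iff [simp]: "poly_fract g = 0 \<longleftrightarrow> g = 0"
  by (simp add: Zero_fract_def eq_fract)

lemma poly_fract_add: "poly_fract (a + b) = poly_fract a + poly_fract b"
  by simp

lemma poly_fract_mult: "poly_fract (a * b) = poly_fract a * poly_fract b"
  by simp

lemma poly_fract_0: "poly_fract 0 = 0" and poly_fract_1: "poly_fract 1 = 1"
  by (simp_all add: fract_collapse)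

lemma poly_fract_power: "poly_fract g ^ n = poly_fract (g ^ n)"
  by (induction n) (simp_all add: poly_fract_1)

lemma poly_fract_sum: "poly_fract (sum f S) = (\<Sum>i\<in>S. poly_fract (f i))"
  by (induction S rule: infinite_finite_induct) (simp_all add: poly_fract_0 poly_fract_add del: add_fract)

lemma Fract_eq_divide: "Fract a b = poly_fract a / poly_fract b"
  by simp

lemma poly_fract_pCons: "poly_fract (pCons c g) = ratfun_const c + ratfun_x * poly_fract g"
  by (simp add: ratfun_const_def ratfun_x_def)

lemma ratfun_const_eq_0_iff [simp]: "ratfun_const c = 0 \<longleftrightarrow> c = 0"
  by (simp add: ratfun_const_def)

lemma ratfun_const_0 [simp]: "ratfun_const 0 = 0"
  by simp

lemma ratfun_x_neq_0 [simp]: "ratfun_x \<noteq> 0"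
  by (simp add: ratfun_x_def)

lemma poly_fract_expansion:
  assumes "g = 0 \<or> degree g < d"
  shows "poly_fract g = (\<Sum>i<d. ratfun_const (coeff g i) * ratfun_x ^ i)"
proof -
  have "g = (\<Sum>i<d. monom (coeff g i) i)"
    using assms by (intro poly_eqI) (auto simp: coeff_sum coeff_eq_0)
  then have "poly_fract g = (\<Sum>i<d. poly_fract (monom (coeff g i) i))"
    by (subst poly_fract_sum [symmetric]) simp
  also have "\<dots> = (\<Sum>i<d. ratfun_const (coeff g i) * ratfun_x ^ i)"
    by (intro sum.cong)
      (simp_all add: ratfun_const_def ratfun_x_def poly_fract_power monom_altdef)
  finally show ?thesis .
qed

text \<open>Euclid's algorithm. The measure gives 0 to the zero polynomial only, so that it also
  drops from a nonzero constant to the remainder 0.\<close>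

lemma poly_bezout:
  fixes p g :: "'k::field poly"
  shows "\<exists>d s t. d dvd p \<and> d dvd g \<and> d = s * g + t * p"
proof (induction "if g = 0 then 0 else Suc (degree g)" arbitrary: p g rule: less_induct)
  case less
  show ?case
  proof (cases "g = 0")
    case True
    then have "p dvd p \<and> p dvd g \<and> p = 0 * g + 1 * p" by simp
    then show ?thesis by blast
  next
    case False
    have "(if p mod g = 0 then 0 else Suc (degree (p mod g))) < Suc (degree g)"
      using degree_mod_less[of g p] False by auto
    with less[of "p mod g" g] False
    obtain d s t where d: "d dvd g" "d dvd p mod g" "d = s * (p mod g) + t * g" by auto
    have "p = g * (p div g) + p mod g" by simp
    then have "d dvd p" using d(1,2) by (metis dvd_add dvd_mult2)
    moreover have "d = (t - s * (p div g)) * g + s * p"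
      using d(3) by (simp add: algebra_simps minus_mult_div_eq_mod [symmetric])
    ultimately show ?thesis using d(1) by blast
  qed
qed

text \<open>A nonconstant divisor of least degree has no proper factors, and Bezout turns this
  irreducibility into primality.\<close>

lemma poly_prime_divisor:
  fixes q :: "'k::field poly"
  assumes "degree q > 0"
  shows "\<exists>p. p dvd q \<and> degree p > 0 \<and> (\<forall>g h. p dvd g * h \<longrightarrow> p dvd g \<or> p dvd h)"
proof -
  define p where "p = arg_min degree (\<lambda>p. p dvd q \<and> degree p > 0)"
  have p: "p dvd q" "degree p > 0"
    and min: "\<And>d. d dvd q \<Longrightarrow> degree d > 0 \<Longrightarrow> degree p \<le> degree d"
    using arg_min_nat_lemma[of "\<lambda>p. p dvd q \<and> degree p > 0" q degree] assms
    unfolding p_def by auto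
  have "p dvd h" if gh: "p dvd g * h" and g: "\<not> p dvd g" for g h
  proof -
    obtain d s t where d: "d dvd p" "d dvd g" "d = s * g + t * p"
      using poly_bezout by blast
    have p0: "p \<noteq> 0" using p by auto
    have "degree d = 0"
    proof (rule ccontr)
      assume "degree d \<noteq> 0"
      then have "degree p \<le> degree d" using min d(1) p(1) dvd_trans by blast
      moreover obtain e where e: "p = d * e" using d(1) by blast
      ultimately have "degree e = 0" using p0 by (auto simp: degree_mult_eq)
      then have "is_unit e" using e p0 by (auto simp: is_unit_iff_degree)
      then have "p dvd d" using e by (simp add: mult_unit_dvd_iff)
      then show False using d(2) g dvd_trans by blast
    qed
    moreover have "d \<noteq> 0" using d(1) p0 by auto
    ultimately have "is_unit d" by (simp add: is_unit_iff_degree)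
    moreover have "d * h = s * (g * h) + p * (t * h)" using d(3) by (simp add: algebra_simps)
    then have "p dvd d * h" using gh by (simp add: dvd_mult)
    ultimately show ?thesis by (simp add: dvd_mult_unit_iff mult.commute[of d])
  qed
  then show ?thesis using p by blast
qed

lemma poly_extract_power:
  fixes p g :: "'k::field poly"
  assumes "degree p > 0" "g \<noteq> 0"
  shows "\<exists>n g'. g = p ^ n * g' \<and> \<not> p dvd g'"
  using assms(2)
proof (induction "degree g" arbitrary: g rule: less_induct)
  case less
  show ?case
  proof (cases "p dvd g")
    case True
    then obtain h where h: "g = p * h" by blast
    then have "degree h < degree g" "h \<noteq> 0"
      using assms less.prems by (auto simp: degree_mult_eq)
    with less.hyps obtain n g' where "h = p ^ n * g'" "\<not> p dvd g'" by blast
    then have "g = p ^ Suc n * g'" using h by (simp add: mult.assoc)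
    then show ?thesis using \<open>\<not> p dvd g'\<close> by blast
  next
    case False
    then have "g = p ^ 0 * g" by simp
    with False show ?thesis by blast
  qed
qed

section \<open>The valuation attached to a prime polynomial\<close>

context
  fixes p :: "'k::field poly"
  assumes deg: "degree p > 0" and prime: "\<And>g h. p dvd g * h \<Longrightarrow> p dvd g \<or> p dvd h"
begin

text \<open>Since \<open>p\<close> is prime, the exponent \<open>j\<close> in such a form is unique;
  it will be the value of \<open>z\<close>.\<close>

private definition adic_rep :: "'k poly fract \<Rightarrow> int \<Rightarrow> bool" where
  "adic_rep z j \<longleftrightarrow> (\<exists>a b. \<not> p dvd a \<and> \<not> p dvd b \<and> z = poly_fract p powi j * Fract a b)"

private lemma nz: "p \<noteq> 0"
  using deg by auto

private lemma adic_rep_ex: "z \<noteq> 0 \<Longrightarrow> \<exists>j. adic_rep z j"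
proof (cases z)
  case (Fract a b)
  assume "z \<noteq> 0"
  then have "a \<noteq> 0" using Fract by (auto simp: fract_collapse)
  obtain m a' where a: "a = p ^ m * a'" "\<not> p dvd a'"
    using poly_extract_power[OF deg \<open>a \<noteq> 0\<close>] by blast
  obtain n b' where b: "b = p ^ n * b'" "\<not> p dvd b'"
    using poly_extract_power[OF deg \<open>b \<noteq> 0\<close>] by blast
  have "z = poly_fract a / poly_fract b"
    using Fract by simp
  also have "\<dots> = (poly_fract p ^ m * poly_fract a') / (poly_fract p ^ n * poly_fract b')"
    by (simp add: a b poly_fract_power)
  also have "\<dots> = (poly_fract p ^ m / poly_fract p ^ n) * Fract a' b'"
    by (simp only: Fract_eq_divide[of a' b'] times_divide_times_eq)
  also have "poly_fract p ^ m / poly_fract p ^ n = poly_fract p powi (int m - int n)"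
    using nz by (simp add: power_int_diff del: divide_fract)
  finally have "adic_rep z (int m - int n)"
    unfolding adic_rep_def using a b by blast
  then show ?thesis by blast
qed

private lemma adic_rep_le:
  assumes "\<not> p dvd a" "\<not> p dvd b" "\<not> p dvd a'" "\<not> p dvd b'"
    "poly_fract p powi j * Fract a b = poly_fract p powi j' * Fract a' b'"
  shows "j' \<le> j"
proof (rule ccontr)
  assume less: "\<not> j' \<le> j"
  define n where "n = nat (j' - j)"
  have b: "b \<noteq> 0" "b' \<noteq> 0" using assms by auto
  have "poly_fract p powi j' = poly_fract p powi j * poly_fract p ^ n"
    using less nz by (simp add: n_def power_int_add [symmetric] flip: power_int_of_nat)
  then have "Fract a b = poly_fract p ^ n * Fract a' b'"
    using assms(5) nz by (simp add: mult.assoc)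
  then have "a * b' = p ^ n * a' * b"
    using b by (simp add: poly_fract_power eq_fract)
  moreover have "p dvd p ^ n" using less by (intro dvd_power) (simp add: n_def)
  ultimately have "p dvd a * b'" by simp
  then show False using prime assms by blast
qed

private lemma adic_rep_unique: "adic_rep z j \<Longrightarrow> adic_rep z j' \<Longrightarrow> j = j'"
  unfolding adic_rep_def using adic_rep_le by (metis order_antisym)

private definition adic_val :: "'k poly fract \<Rightarrow> int" where
  "adic_val z = (if z = 0 then 0 else (THE j. adic_rep z j))"

private lemma adic_rep_val:
  assumes "z \<noteq> 0"
  shows "adic_rep z (adic_val z)"
proof -
  obtain j where j: "adic_rep z j" using adic_rep_ex assms by blast
  then have "(THE j. adic_rep z j) = j" using adic_rep_unique by (intro the_equality)
  then show ?thesis using j assms by (simp add: adic_val_def)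
qed

private lemma adic_valI:
  assumes "adic_rep z j"
  shows "adic_val z = j"
proof -
  have "z \<noteq> 0"
  proof -
    obtain a b where ab: "\<not> p dvd a" "\<not> p dvd b" "z = poly_fract p powi j * Fract a b"
      using assms unfolding adic_rep_def by blast
    then have "a \<noteq> 0" "b \<noteq> 0" by auto
    then have "Fract a b \<noteq> 0" by (simp add: Zero_fract_def eq_fract)
    then show ?thesis using ab nz by simp
  qed
  then show ?thesis using assms adic_rep_val adic_rep_unique by blast
qed

private lemma adic_val_mult:
  assumes "z \<noteq> 0" "z' \<noteq> 0"
  shows "adic_val (z * z') = adic_val z + adic_val z'"
proof (rule adic_valI)
  obtain a b where ab: "\<not> p dvd a" "\<not> p dvd b" "z = poly_fract p powi adic_val z * Fract a b"
    using adic_rep_val[OF assms(1)] unfolding adic_rep_def by blast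
  obtain a' b' where ab': "\<not> p dvd a'" "\<not> p dvd b'" "z' = poly_fract p powi adic_val z' * Fract a' b'"
    using adic_rep_val[OF assms(2)] unfolding adic_rep_def by blast
  have "z * z' = poly_fract p powi (adic_val z + adic_val z') * Fract (a * a') (b * b')"
  proof -
    have "z * z' = (poly_fract p powi adic_val z * Fract a b) * (poly_fract p powi adic_val z' * Fract a' b')"
      by (rule arg_cong2[where f = times, OF ab(3) ab'(3)])
    also have "\<dots> = (poly_fract p powi adic_val z * poly_fract p powi adic_val z') * (Fract a b * Fract a' b')"
      by (simp only: mult_ac)
    finally show ?thesis using nz by (simp add: power_int_add)
  qed
  moreover have "\<not> p dvd a * a'" "\<not> p dvd b * b'" using ab ab' prime by blast+
  ultimately show "adic_rep (z * z') (adic_val z + adic_val z')"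
    unfolding adic_rep_def by blast
qed

private lemma adic_val_Fract:
  assumes "a \<noteq> 0" "\<not> p dvd b"
  shows "adic_val (Fract a b) \<ge> 0"
proof -
  obtain n a' where a: "a = p ^ n * a'" "\<not> p dvd a'"
    using poly_extract_power[OF deg assms(1)] by blast
  have "Fract a b = poly_fract p powi (int n) * Fract a' b"
    by (simp add: a poly_fract_power)
  then have "adic_rep (Fract a b) (int n)"
    unfolding adic_rep_def using a assms by blast
  then show ?thesis using adic_valI by simp
qed

private lemma adic_val_add:
  assumes "z \<noteq> 0" "z' \<noteq> 0" "z + z' \<noteq> 0" "adic_val z \<le> adic_val z'"
  shows "adic_val z \<le> adic_val (z + z')"
proof -
  obtain a b where ab: "\<not> p dvd a" "\<not> p dvd b" "z = poly_fract p powi adic_val z * Fract a b"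
    using adic_rep_val[OF assms(1)] unfolding adic_rep_def by blast
  obtain a' b' where ab': "\<not> p dvd a'" "\<not> p dvd b'" "z' = poly_fract p powi adic_val z' * Fract a' b'"
    using adic_rep_val[OF assms(2)] unfolding adic_rep_def by blast
  define n where "n = nat (adic_val z' - adic_val z)"
  have b: "b \<noteq> 0" "b' \<noteq> 0" using ab ab' by auto
  let ?P = "poly_fract p powi adic_val z"
  let ?w = "Fract (a * b' + p ^ n * a' * b) (b * b')"
  have "poly_fract p powi adic_val z' = ?P * poly_fract p ^ n"
    using assms(4) nz by (simp add: n_def power_int_add [symmetric] flip: power_int_of_nat)
  then have "z' = ?P * Fract (p ^ n * a') b'"
    using ab'(3) by (simp add: poly_fract_power mult.assoc)
  \<comment> \<open>Once the smaller power of \<open>p\<close> is taken out, the cofactor has a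
    denominator prime to \<open>p\<close>, so its value cannot be negative.\<close>
  then have eq: "z + z' = ?P * ?w"
    using ab(3) b by (metis add_fract distrib_left)
  then have "?w \<noteq> 0" using assms(3) by (metis mult_zero_right)
  then have "a * b' + p ^ n * a' * b \<noteq> 0"
    by (metis fract_collapse(1))
  moreover have "\<not> p dvd b * b'" using ab ab' prime by blast
  ultimately have "adic_val ?w \<ge> 0" by (rule adic_val_Fract)
  moreover have "adic_val ?P = adic_val z"
  proof (rule adic_valI)
    have "\<not> p dvd 1" using deg by (auto dest: dvd_imp_degree_le)
    moreover have "?P = ?P * Fract 1 1" by (simp add: fract_collapse)
    ultimately show "adic_rep ?P (adic_val z)" unfolding adic_rep_def by blast
  qed
  ultimately show ?thesis
    unfolding eq using adic_val_mult[of ?P ?w] \<open>?w \<noteq> 0\<close> nz by simp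
qed

text \<open>Supplies the finite places: through it every nonconstant polynomial vanishes
  somewhere.\<close>

lemma prime_poly_place:
  "\<exists>v\<in>places ratfun_const. 0 \<le> v ratfun_x \<and> v (poly_fract p) = 1"
proof
  have not1: "\<not> p dvd 1" using deg by (auto dest: dvd_imp_degree_le)
  have p1: "adic_val (poly_fract p) = 1"
  proof (rule adic_valI)
    have "poly_fract p = poly_fract p powi 1 * Fract 1 1" by (simp add: fract_collapse)
    then show "adic_rep (poly_fract p) 1" unfolding adic_rep_def using not1 by blast
  qed
  have c: "adic_val (ratfun_const c) = 0" for c
  proof (cases "c = 0")
    case False
    have "ratfun_const c = poly_fract p powi 0 * Fract [:c:] 1" by (simp add: ratfun_const_def)
    moreover have "\<not> p dvd [:c:]" using deg False by (auto dest: dvd_imp_degree_le)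
    ultimately have "adic_rep (ratfun_const c) 0" unfolding adic_rep_def using not1 by blast
    then show ?thesis by (rule adic_valI)
  qed (simp add: adic_val_def)
  have "valuation adic_val"
  proof
    fix a b :: "'k poly fract" assume ab: "a \<noteq> 0" "b \<noteq> 0"
    then show "adic_val (a * b) = adic_val a + adic_val b" by (rule adic_val_mult)
    assume "a + b \<noteq> 0"
    with ab show "min (adic_val a) (adic_val b) \<le> adic_val (a + b)"
      using adic_val_add[of a b] adic_val_add[of b a]
      by (cases "adic_val a \<le> adic_val b") (auto simp: add.commute)
  qed (simp add: adic_val_def)
  then show "adic_val \<in> places ratfun_const"
    using p1 c by (intro placesI)
  show "0 \<le> adic_val ratfun_x \<and> adic_val (poly_fract p) = 1"
    using p1 adic_val_Fract[of "[:0, 1:]" 1] not1 by (simp add: ratfun_x_def)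
qed

end

section \<open>Finite places and their prime polynomials\<close>

definition finite_places :: "('k::field poly fract \<Rightarrow> int) set" where
  "finite_places = {v \<in> places ratfun_const. 0 \<le> v ratfun_x}"

lemma finite_places_valuation: "v \<in> finite_places \<Longrightarrow> valuation v"
  by (auto simp: finite_places_def intro: places_valuation)

lemma finite_place_poly_nonneg:
  assumes "v \<in> finite_places"
  shows "val_ge v (poly_fract g) 0"
proof -
  interpret valuation v using assms by (rule finite_places_valuation)
  show ?thesis
  proof (induction g)
    case (pCons c g)
    have "val_ge v (ratfun_const c) 0" "val_ge v ratfun_x 0"
      using assms by (auto simp: finite_places_def val_ge_def places_const)
    then show ?case
      unfolding poly_fract_pCons using pCons.IH by (intro ge_add ge_mult0)
  qed (simp add: fract_collapse)
qed

text \<open>Take a polynomial \<open>p\<close> of least degree with positive value. Division with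
  remainder shows that nonmultiples of \<open>p\<close> have value 0, so every value is a multiple
  of that of \<open>p\<close>; as the value 1 occurs, \<open>p\<close> itself has value 1.\<close>

lemma finite_place_poly_ex:
  assumes "v \<in> finite_places"
  shows "\<exists>p. p \<noteq> 0 \<and> v (poly_fract p) = 1 \<and> (\<forall>g. g \<noteq> 0 \<longrightarrow> \<not> p dvd g \<longrightarrow> v (poly_fract g) = 0)"
proof -
  interpret valuation v using assms by (rule finite_places_valuation)
  have nonneg: "v (poly_fract g) \<ge> 0" for g
    using finite_place_poly_nonneg[OF assms, of g] by (cases "g = 0") (auto simp: val_ge_def fract_collapse)
  have v: "v \<in> places ratfun_const" using assms by (simp add: finite_places_def)
  obtain a where a: "a \<noteq> 0" "v a = 1" using places_uniformizer[OF v] by blast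
  obtain n d where nd: "a = Fract n d" "d \<noteq> 0" "n \<noteq> 0"
    using a by (cases a rule: Fract_cases_nonzero) auto
  then have va: "v a = v (poly_fract n) - v (poly_fract d)"
    using divide[of "poly_fract n" "poly_fract d"] by simp
  \<comment> \<open>A uniformizer written as a fraction: its denominator is integral, so the
    numerator is a polynomial of positive value.\<close>
  then have "v (poly_fract n) > 0" using a nonneg[of d] by simp
  define p where "p = arg_min degree (\<lambda>p. v (poly_fract p) > 0)"
  have p: "v (poly_fract p) > 0" and min: "\<And>g. v (poly_fract g) > 0 \<Longrightarrow> degree p \<le> degree g"
    using arg_min_nat_lemma[of "\<lambda>p. v (poly_fract p) > 0" n degree] \<open>v (poly_fract n) > 0\<close>
    unfolding p_def by auto
  have p0: "p \<noteq> 0" using p by (auto simp: fract_collapse)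
  have ndvd: "v (poly_fract g) = 0" if g: "g \<noteq> 0" "\<not> p dvd g" for g
  proof -
    have r: "g mod p \<noteq> 0" using g by (simp add: mod_eq_0_iff_dvd)
    then have "degree (g mod p) < degree p" using degree_mod_less[of p g] p0 by auto
    then have "v (poly_fract (g mod p)) = 0" using min nonneg by (metis less_le not_le)
    moreover have "val_ge v (poly_fract (g div p) * poly_fract p) 1"
      using p by (intro ge_mult0 finite_place_poly_nonneg[OF assms]) (simp add: val_ge_def)
    ultimately have "v (poly_fract (g mod p) + poly_fract (g div p) * poly_fract p) = 0"
      using add_dominant(2)[of "poly_fract (g mod p)" "poly_fract (g div p) * poly_fract p"] r by simp
    moreover have "poly_fract (g mod p) + poly_fract (g div p) * poly_fract p = poly_fract g"
      by simp
    ultimately show ?thesis by (simp only:)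
  qed
  have mult: "\<exists>k. v (poly_fract g) = int k * v (poly_fract p)" if "g \<noteq> 0" for g
  proof -
    have "degree p > 0"
    proof (rule ccontr)
      assume "\<not> degree p > 0"
      then obtain c where "p = [:c:]" by (metis degree_eq_zeroE gr0I)
      then show False using p places_const[OF v, of c] by (simp add: ratfun_const_def)
    qed
    from poly_extract_power[OF this that] obtain k g' where g': "g = p ^ k * g'" "\<not> p dvd g'"
      by blast
    then have "g' \<noteq> 0" by auto
    then have "v (poly_fract g) = int k * v (poly_fract p)"
      using ndvd[OF \<open>g' \<noteq> 0\<close> g'(2)] p0
      by (simp add: g'(1) poly_fract_mult power mult del: mult_fract flip: poly_fract_power)
    then show ?thesis by blast
  qed
  obtain k l where "v a = (int k - int l) * v (poly_fract p)"
    using mult[OF nd(3)] mult[OF nd(2)] va by (metis left_diff_distrib)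
  then have "v (poly_fract p) dvd 1" using a by (metis dvd_triv_right)
  then have "v (poly_fract p) = 1" using p by simp
  then show ?thesis using p0 ndvd by blast
qed

text \<open>A generator of the prime ideal of \<open>k[x]\<close> that belongs to the place. The
  choice is free up to a constant factor, which affects neither the degree nor any value.\<close>

definition place_poly :: "('k::field poly fract \<Rightarrow> int) \<Rightarrow> 'k poly" where
  "place_poly v = (SOME p. p \<noteq> 0 \<and> v (poly_fract p) = 1 \<and>
     (\<forall>g. g \<noteq> 0 \<longrightarrow> \<not> p dvd g \<longrightarrow> v (poly_fract g) = 0))"

lemma place_poly:
  assumes "v \<in> finite_places"
  shows "place_poly v \<noteq> 0" "v (poly_fract (place_poly v)) = 1"
    "\<And>g. g \<noteq> 0 \<Longrightarrow> \<not> place_poly v dvd g \<Longrightarrow> v (poly_fract g) = 0"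
  using someI_ex[OF finite_place_poly_ex[OF assms]] unfolding place_poly_def by blast+

lemma degree_place_poly:
  assumes "v \<in> finite_places"
  shows "degree (place_poly v) > 0"
proof (rule ccontr)
  assume "\<not> degree (place_poly v) > 0"
  then obtain c where "place_poly v = [:c:]" by (metis degree_eq_zeroE gr0I)
  then show False
    using place_poly(2)[OF assms] places_const[of v ratfun_const c] assms
    by (simp add: ratfun_const_def finite_places_def)
qed

lemma finite_place_decompose:
  assumes "v \<in> finite_places" "g \<noteq> 0"
  obtains n g' where "g = place_poly v ^ n * g'" "\<not> place_poly v dvd g'" "v (poly_fract g') = 0"
    "v (poly_fract g) = int n"
proof -
  interpret valuation v using assms(1) by (rule finite_places_valuation)
  obtain n g' where g': "g = place_poly v ^ n * g'" "\<not> place_poly v dvd g'"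
    using poly_extract_power[OF degree_place_poly[OF assms(1)] assms(2)] by blast
  from g' have "g' \<noteq> 0" by auto
  then have "v (poly_fract g') = 0" using place_poly(3)[OF assms(1)] g'(2) by blast
  moreover from this have "v (poly_fract g) = int n"
    using place_poly(1,2)[OF assms(1)] \<open>g' \<noteq> 0\<close>
    by (simp add: g'(1) poly_fract_mult power mult del: mult_fract flip: poly_fract_power)
  ultimately show thesis using g' that by blast
qed

lemma finite_place_dvd:
  assumes "v \<in> finite_places" "v (poly_fract g) > 0"
  shows "place_poly v dvd g"
  using place_poly(3)[OF assms(1), of g] assms(2) by fastforce

lemma poly_value_nonneg: "v \<in> finite_places \<Longrightarrow> v (poly_fract g) \<ge> 0"
  using finite_place_poly_nonneg[of v g] valuation.zero[OF finite_places_valuation, of v]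
  by (cases "g = 0") (auto simp: val_ge_def fract_collapse)

text \<open>The polynomial of \<open>v'\<close> divides that of \<open>v\<close>. The latter has
  value 1 at \<open>v\<close>, which leaves no room for a proper factorization; so the two are
  associated, and both valuations count the same multiplicity.\<close>

lemma finite_places_eqI:
  assumes v: "v \<in> finite_places" and v': "v' \<in> finite_places"
    and pos: "v' (poly_fract (place_poly v)) > 0"
  shows "v' = v"
proof -
  interpret v: valuation v using v by (rule finite_places_valuation)
  interpret v': valuation v' using v' by (rule finite_places_valuation)
  let ?p = "place_poly v" and ?p' = "place_poly v'"
  note p = place_poly[OF v] and p' = place_poly[OF v']
  obtain c where c: "?p = ?p' * c" using finite_place_dvd[OF v' pos] by blast
  have c0: "c \<noteq> 0" using c p(1) by auto
  have sum: "v (poly_fract ?p') + v (poly_fract c) = 1"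
    using p(2) p'(1) c0 v.mult[of "poly_fract ?p'" "poly_fract c"] c by simp
  have "v (poly_fract ?p') > 0"
  proof (rule ccontr)
    assume "\<not> v (poly_fract ?p') > 0"
    then have "v (poly_fract c) > 0" using sum by simp
    then obtain s where "c = ?p * s" using finite_place_dvd[OF v] by blast
    with c have "?p * 1 = ?p * (?p' * s)" by (metis mult.assoc mult.commute mult_1_right)
    then have one: "?p' * s = 1" using p(1) by (metis mult_left_cancel)
    then have "s \<noteq> 0" by auto
    then have "v' (poly_fract ?p') + v' (poly_fract s) = 0"
      using v'.mult[of "poly_fract ?p'" "poly_fract s"] p'(1) one by (simp add: fract_collapse)
    then show False using p'(2) poly_value_nonneg[OF v', of s] by simp
  qed
  then have dvd: "?p dvd ?p'" by (rule finite_place_dvd[OF v])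
  then obtain d where d: "?p' = ?p * d" by blast
  then have "d \<noteq> 0" using p'(1) by auto
  then have "v' (poly_fract ?p) + v' (poly_fract d) = 1"
    using p'(2) p(1) v'.mult[of "poly_fract ?p" "poly_fract d"] d by simp
  then have p1: "v' (poly_fract ?p) = 1"
    using pos poly_value_nonneg[OF v', of d] by simp
  have eq: "v' (poly_fract g) = v (poly_fract g)" if g: "g \<noteq> 0" for g
  proof -
    obtain n g' where g': "g = ?p ^ n * g'" "\<not> ?p dvd g'" "v (poly_fract g') = 0"
        "v (poly_fract g) = int n"
      by (rule finite_place_decompose[OF v g])
    have "\<not> ?p' dvd g'" using g'(2) dvd dvd_trans by blast
    moreover have "g' \<noteq> 0" using g'(2) by auto
    ultimately have "v' (poly_fract g) = int n"
      using p'(3)[of g'] p(1) p1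
      by (simp add: g'(1) poly_fract_mult v'.power v'.mult del: mult_fract flip: poly_fract_power)
    then show ?thesis using g'(4) by simp
  qed
  show ?thesis
  proof
    fix a show "v' a = v a"
    proof (cases a rule: Fract_cases_nonzero)
      case (Fract n d)
      then show ?thesis
        using eq v.divide[of "poly_fract n" "poly_fract d"] v'.divide[of "poly_fract n" "poly_fract d"]
        by simp
    qed simp
  qed
qed

lemma place_poly_value:
  assumes "v \<in> finite_places" "v' \<in> finite_places"
  shows "v' (poly_fract (place_poly v)) = of_bool (v' = v)"
  using finite_places_eqI[OF assms] place_poly(2)[OF assms(1)]
    poly_value_nonneg[OF assms(2), of "place_poly v"] by fastforce

lemma nonconstant_poly_place:
  fixes q :: "'k::field poly"
  assumes "degree q > 0"
  obtains v where "v \<in> finite_places" "v (poly_fract q) > 0"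
proof -
  obtain p where p: "p dvd q" "degree p > 0" "\<And>g h. p dvd g * h \<Longrightarrow> p dvd g \<or> p dvd h"
    using poly_prime_divisor[OF assms] by blast
  obtain v where v: "v \<in> finite_places" "v (poly_fract p) = 1"
    using prime_poly_place[OF p(2,3)] by (auto simp: finite_places_def)
  interpret v: valuation v using v(1) by (rule finite_places_valuation)
  obtain c where c: "q = p * c" using p(1) by blast
  then have "c \<noteq> 0" "p \<noteq> 0" using assms by auto
  then have "v (poly_fract q) = 1 + v (poly_fract c)"
    using v.mult[of "poly_fract p" "poly_fract c"] v(2) c by simp
  then show thesis using that[of v] v(1) poly_value_nonneg[OF v(1), of c] by simp
qed

text \<open>In a denominator of least degree, a zero at a finite place would be matched by a zero of
  the numerator and could be cancelled. So the denominator has no zeros and is constant.\<close>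

lemma integral_imp_poly:
  assumes "\<And>v. v \<in> finite_places \<Longrightarrow> val_ge v a 0"
  shows "\<exists>g. a = poly_fract g"
proof -
  define d where "d = arg_min degree (\<lambda>d. d \<noteq> 0 \<and> (\<exists>n. a = Fract n d))"
  obtain n0 d0 where "a = Fract n0 d0" "d0 \<noteq> 0" by (cases a) auto
  then have d: "d \<noteq> 0" "\<exists>n. a = Fract n d"
    using arg_min_nat_lemma[of "\<lambda>d. d \<noteq> 0 \<and> (\<exists>n. a = Fract n d)" d0 degree]
    unfolding d_def by auto
  have min: "degree d \<le> degree m" if "m \<noteq> 0" "a = Fract n m" for m n
    unfolding d_def using that by (intro arg_min_nat_le) blast
  obtain n where n: "a = Fract n d" using d by blast
  have "degree d = 0"
  proof (rule ccontr)
    assume "degree d \<noteq> 0"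
    then obtain v where v: "v \<in> finite_places" "v (poly_fract d) > 0"
      using nonconstant_poly_place[of d] by auto
    interpret v: valuation v using v(1) by (rule finite_places_valuation)
    have "place_poly v dvd n"
    proof (cases "n = 0")
      case False
      then have "v a = v (poly_fract n) - v (poly_fract d)" "a \<noteq> 0"
        using n d(1) v.divide[of "poly_fract n" "poly_fract d"] by (auto simp: Zero_fract_def eq_fract)
      then have "v (poly_fract n) > 0" using assms[OF v(1)] v(2) by (simp add: val_ge_def)
      then show ?thesis by (rule finite_place_dvd[OF v(1)])
    qed simp
    then obtain n' where n': "n = place_poly v * n'" by blast
    obtain d' where d': "d = place_poly v * d'" using finite_place_dvd[OF v] by blast
    then have "d' \<noteq> 0" using d(1) by auto
    then have "a = Fract n' d'" using n n' d' place_poly(1)[OF v(1)] by (simp add: mult_fract_cancel)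
    then have "degree d \<le> degree d'" using min \<open>d' \<noteq> 0\<close> by blast
    moreover have "degree d = degree (place_poly v) + degree d'"
      using d' \<open>d' \<noteq> 0\<close> place_poly(1)[OF v(1)] by (simp add: degree_mult_eq)
    ultimately show False using degree_place_poly[OF v(1)] by simp
  qed
  then obtain c where c: "d = [:c:]" by (metis degree_eq_zeroE)
  then have "a = poly_fract (smult (inverse c) n)"
    using n d(1) by (simp add: eq_fract)
  then show ?thesis by blast
qed

text \<open>Euclid's argument with one plus the product of all place polynomials. The additional
  factor \<open>[:0, 1:]\<close> keeps that polynomial nonconstant even if the product is
  empty.\<close>

lemma infinite_finite_places: "infinite (finite_places :: ('k::field poly fract \<Rightarrow> int) set)"
proof
  assume fin: "finite (finite_places :: ('k poly fract \<Rightarrow> int) set)"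
  define r :: "'k poly" where "r = [:0, 1:] * (\<Prod>v\<in>finite_places. place_poly v)"
  have r0: "(\<Prod>v\<in>finite_places. place_poly v) \<noteq> (0 :: 'k poly)"
    using fin place_poly(1) by auto
  then have "degree r > 0" unfolding r_def by (subst degree_mult_eq) auto
  then have "degree (1 + r) > 0" by (subst degree_add_eq_right) auto
  then obtain v where v: "v \<in> finite_places" "v (poly_fract (1 + r)) > 0"
    using nonconstant_poly_place by blast
  have "place_poly v dvd (1 + r)" using finite_place_dvd[OF v] .
  moreover have "place_poly v dvd r"
    unfolding r_def using v(1) fin by (intro dvd_mult dvd_prodI)
  ultimately have "place_poly v dvd 1" by (simp add: dvd_add_left_iff)
  then show False using degree_place_poly[OF v(1)] by (auto dest: dvd_imp_degree_le)
qed

text \<open>Each place at which a polynomial vanishes splits off a factor of positive degree, so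
  there are finitely many; a fraction is a unit away from the zeros of numerator and
  denominator.\<close>

lemma finite_place_support:
  fixes a :: "'k::field poly fract"
  shows "finite {v \<in> finite_places. v a \<noteq> 0}"
proof -
  have poly: "finite {v \<in> finite_places. v (poly_fract g) \<noteq> 0}" if "g \<noteq> 0" for g :: "'k poly"
    using that
  proof (induction "degree g" arbitrary: g rule: less_induct)
    case less
    show ?case
    proof (cases "\<exists>v\<in>finite_places. v (poly_fract g) \<noteq> 0")
      case True
      then obtain v where v: "v \<in> finite_places" "v (poly_fract g) \<noteq> 0" by blast
      then have v: "v \<in> finite_places" "v (poly_fract g) > 0"
        using poly_value_nonneg[of v g] by simp_all
      obtain h where h: "g = place_poly v * h" using finite_place_dvd[OF v] by blast
      then have h0: "h \<noteq> 0" using less.prems by auto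
      have "degree h < degree g"
        using h h0 place_poly(1)[OF v(1)] degree_place_poly[OF v(1)] by (simp add: degree_mult_eq)
      with less.hyps h0 have "finite {v \<in> finite_places. v (poly_fract h) \<noteq> 0}" by blast
      moreover have "{v \<in> finite_places. v (poly_fract g) \<noteq> 0} \<subseteq> insert v {v \<in> finite_places. v (poly_fract h) \<noteq> 0}"
      proof
        fix v' assume "v' \<in> {v \<in> finite_places. v (poly_fract g) \<noteq> 0}"
        then have v': "v' \<in> finite_places" "v' (poly_fract g) \<noteq> 0" by auto
        interpret v': valuation v' using v'(1) by (rule finite_places_valuation)
        have "v' (poly_fract g) = of_bool (v' = v) + v' (poly_fract h)"
          using v'.mult[of "poly_fract (place_poly v)" "poly_fract h"] h h0
            place_poly(1)[OF v(1)] place_poly_value[OF v(1) v'(1)] by simp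
        then show "v' \<in> insert v {v \<in> finite_places. v (poly_fract h) \<noteq> 0}"
          using v' by auto
      qed
      ultimately show ?thesis using finite_subset by blast
    next
      case False
      then have "{v \<in> finite_places. v (poly_fract g) \<noteq> 0} = {}" by blast
      then show ?thesis by (simp only: finite.emptyI)
    qed
  qed
  show ?thesis
  proof (cases a rule: Fract_cases_nonzero)
    case (Fract n d)
    have "{v \<in> finite_places. v a \<noteq> 0} \<subseteq>
      {v \<in> finite_places. v (poly_fract n) \<noteq> 0} \<union> {v \<in> finite_places. v (poly_fract d) \<noteq> 0}"
    proof
      fix v assume "v \<in> {v \<in> finite_places. v a \<noteq> 0}"
      then have v: "v \<in> finite_places" "v a \<noteq> 0" by auto
      then show "v \<in> {v \<in> finite_places. v (poly_fract n) \<noteq> 0} \<union> {v \<in> finite_places. v (poly_fract d) \<noteq> 0}"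
        using valuation.divide[OF finite_places_valuation[OF v(1)], of "poly_fract n" "poly_fract d"] Fract
        by auto
    qed
    then show ?thesis using poly Fract by (meson finite_UnI finite_subset)
  next
    case 0
    then have "{v \<in> finite_places. v a \<noteq> 0} = {}"
      using valuation.zero[OF finite_places_valuation] by blast
    then show ?thesis by (simp only: finite.emptyI)
  qed
qed

text \<open>An indexed form of \<open>residue_basis\<close> in which coefficient functions need not be extensional.\<close>

definition residue_family ::
    "('k::field \<Rightarrow> 'a::field) \<Rightarrow> ('a \<Rightarrow> int) \<Rightarrow> 'i set \<Rightarrow> ('i \<Rightarrow> 'a) \<Rightarrow> bool" where
  "residue_family \<kappa> v I g \<longleftrightarrow> finite I \<and> (\<forall>i\<in>I. val_ge v (g i) 0) \<and>
     (\<forall>a. val_ge v a 0 \<longrightarrow> (\<exists>c. val_ge v (a - (\<Sum>i\<in>I. \<kappa> (c i) * g i)) 1)) \<and>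
     (\<forall>c. val_ge v (\<Sum>i\<in>I. \<kappa> (c i) * g i) 1 \<longrightarrow> (\<forall>i\<in>I. c i = 0))"

text \<open>The residue field is \<open>k[x] / (p)\<close> for \<open>p = place_poly v\<close>, with
  the powers of \<open>x\<close> below \<open>degree p\<close> as a basis. The work lies in
  spanning: a fraction whose denominator is prime to \<open>p\<close> is replaced by a polynomial,
  by inverting the denominator modulo \<open>p\<close>.\<close>

lemma finite_place_residue_family:
  assumes v: "v \<in> finite_places"
  shows "residue_family ratfun_const v {..<degree (place_poly v)} (\<lambda>i. ratfun_x ^ i)"
proof -
  interpret valuation v using v by (rule finite_places_valuation)
  let ?p = "place_poly v"
  have x: "val_ge v (ratfun_x ^ i) 0" for i
    using v by (intro ge_power) (simp add: finite_places_def val_ge_def)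
  have span: "\<exists>c. val_ge v (a - (\<Sum>i<degree ?p. ratfun_const (c i) * ratfun_x ^ i)) 1"
    if a: "val_ge v a 0" for a
  proof (cases a rule: Fract_cases_nonzero)
    case (Fract n0 m0)
    obtain j m where m: "m0 = ?p ^ j * m" "\<not> ?p dvd m" "v (poly_fract m) = 0" "v (poly_fract m0) = int j"
      by (rule finite_place_decompose[OF v Fract(2)])
    obtain i n1 where n1: "n0 = ?p ^ i * n1" "v (poly_fract n0) = int i"
      by (rule finite_place_decompose[OF v Fract(3)])
    have nz: "?p \<noteq> 0" "m \<noteq> 0" using place_poly(1)[OF v] m(2) by auto
    have a0: "a \<noteq> 0" using Fract by (simp add: Zero_fract_def eq_fract)
    have "v a = int i - int j"
      using divide[of "poly_fract n0" "poly_fract m0"] Fract m(4) n1(2) by simp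
    then have "j \<le> i" using a a0 by (simp add: val_ge_def)
    define n where "n = ?p ^ (i - j) * n1"
    have "n0 = ?p ^ j * n" using \<open>j \<le> i\<close> n1(1) by (simp add: n_def flip: mult.assoc power_add)
    then have an: "a = Fract n m" using Fract(1) m(1) nz by (simp add: mult_fract_cancel)
    obtain d s t where d: "d dvd ?p" "d dvd m" "d = s * m + t * ?p" using poly_bezout by blast
    \<comment> \<open>A divisor of \<open>m\<close> has value 0, so the whole value 1 of
      \<open>?p\<close> sits in the cofactor \<open>e\<close>. Hence \<open>?p\<close> divides
      \<open>e\<close>, and \<open>d\<close> is a unit.\<close>
    have "is_unit d"
    proof -
      obtain m' where m': "m = d * m'" using d(2) by blast
      then have "d \<noteq> 0" "m' \<noteq> 0" using nz by auto
      then have "v (poly_fract d) + v (poly_fract m') = 0"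
        using mult[of "poly_fract d" "poly_fract m'"] m(3) m' by simp
      then have vd: "v (poly_fract d) = 0"
        using poly_value_nonneg[OF v, of d] poly_value_nonneg[OF v, of m'] by simp
      obtain e where e: "?p = d * e" using d(1) by blast
      then have "e \<noteq> 0" using nz by auto
      then have "v (poly_fract e) = 1"
        using mult[of "poly_fract d" "poly_fract e"] vd place_poly(2)[OF v] e \<open>d \<noteq> 0\<close> by simp
      then obtain u where "e = ?p * u" using finite_place_dvd[OF v, of e] by auto
      with e have "?p * 1 = ?p * (d * u)" by (metis mult.assoc mult.commute mult_1_right)
      then have "d * u = 1" using nz(1) by (metis mult_left_cancel)
      then show ?thesis by (metis dvd_triv_left)
    qed
    then obtain w where w: "1 = d * w" by blast
    define S T where "S = s * w" and "T = t * w"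
    have one: "1 = S * m + T * ?p" using w d(3) by (simp add: S_def T_def algebra_simps)
    define r where "r = (n * S) mod ?p"
    have r: "r = 0 \<or> degree r < degree ?p"
      using degree_mod_less[of ?p "n * S"] nz unfolding r_def by blast
    have pf: "val_ge v (poly_fract ?p) 1" using place_poly(2)[OF v] by (simp add: val_ge_def)
    have "a - poly_fract (n * S) = Fract (n * (1 - S * m)) m"
      using nz an by (simp add: algebra_simps)
    also have "1 - S * m = T * ?p" using one by (metis add_diff_cancel_left')
    also have "n * (T * ?p) = n * T * ?p" by (simp only: mult.assoc)
    also have "Fract (n * T * ?p) m = poly_fract (n * T) * inverse (poly_fract m) * poly_fract ?p"
      using nz by simp
    also have "val_ge v \<dots> 1"
      using m(3) inverse[of "poly_fract m"]
      by (intro ge_mult0 pf finite_place_poly_nonneg[OF v]) (simp add: val_ge_def)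
    finally have 1: "val_ge v (a - poly_fract (n * S)) 1" .
    have "n * S = (n * S div ?p) * ?p + r" by (simp add: r_def)
    then have "poly_fract (n * S) = poly_fract (n * S div ?p) * poly_fract ?p + poly_fract r"
      by (metis poly_fract_add poly_fract_mult)
    then have "poly_fract (n * S) - poly_fract r = poly_fract (n * S div ?p) * poly_fract ?p"
      by (simp only: add_diff_cancel_right')
    also have "val_ge v \<dots> 1" by (intro ge_mult0 pf finite_place_poly_nonneg[OF v])
    finally have 2: "val_ge v (poly_fract (n * S) - poly_fract r) 1" .
    have "(a - poly_fract (n * S)) + (poly_fract (n * S) - poly_fract r) = a - poly_fract r"
      by (simp only: algebra_simps add_diff_cancel_left')
    with ge_add[OF 1 2] have "val_ge v (a - poly_fract r) 1" by (simp only:)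
    then show ?thesis using poly_fract_expansion[OF r] by auto
  next
    case 0
    then have "val_ge v (a - (\<Sum>i<degree ?p. ratfun_const 0 * ratfun_x ^ i)) 1" by simp
    then show ?thesis by (intro exI[of _ "\<lambda>_. 0"])
  qed
  have indep: "c i = 0" if ge: "val_ge v (\<Sum>i<degree ?p. ratfun_const (c i) * ratfun_x ^ i) 1"
    and i: "i < degree ?p" for c i
  proof -
    define r where "r = (\<Sum>i<degree ?p. monom (c i) i)"
    have coeff: "coeff r i = (if i < degree ?p then c i else 0)" for i
      by (simp add: r_def coeff_sum)
    have r: "r = 0 \<or> degree r < degree ?p"
      using degree_place_poly[OF v] by (intro disjI2 degree_lessI) (auto simp: coeff)
    have "poly_fract r = (\<Sum>i<degree ?p. ratfun_const (c i) * ratfun_x ^ i)"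
      by (subst poly_fract_expansion[OF r]) (simp add: coeff)
    then have "val_ge v (poly_fract r) 1" using ge by simp
    then have "?p dvd r"
      using finite_place_dvd[OF v, of r] by (cases "r = 0") (auto simp: val_ge_def)
    then have "r = 0" using r dvd_imp_degree_le[of ?p r] by (meson leD)
    then show ?thesis using coeff[of i] i by simp
  qed
  show ?thesis unfolding residue_family_def using x span indep by auto
qed

text \<open>Since \<open>x\<close> has a pole, the leading term dominates and the value is
  \<open>degree g\<close> times \<open>v ratfun_x\<close>. All values are then multiples of
  \<open>v ratfun_x\<close>, and normalization leaves only -1 for it.\<close>

lemma infinite_place_value:
  assumes "v \<in> places ratfun_const" "v ratfun_x < 0" "g \<noteq> 0"
  shows "v (poly_fract g) = - int (degree g)"
proof -
  interpret valuation v using assms(1) by (rule places_valuation)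
  have val: "v (poly_fract g) = int (degree g) * v ratfun_x" if "g \<noteq> 0" for g
    using that
  proof (induction g)
    case (pCons c g)
    show ?case
    proof (cases "g = 0")
      case True
      then show ?thesis using places_const[OF assms(1), of c] by (simp add: ratfun_const_def)
    next
      case False
      then have xg: "ratfun_x * poly_fract g \<noteq> 0"
        "v (ratfun_x * poly_fract g) = int (Suc (degree g)) * v ratfun_x"
        using pCons.IH mult[of ratfun_x "poly_fract g"] by (simp_all add: algebra_simps)
      then have "v (ratfun_x * poly_fract g) < 0" using assms(2) by (simp add: mult_pos_neg)
      then have "val_ge v (ratfun_const c) (v (ratfun_x * poly_fract g) + 1)"
        using places_const[OF assms(1), of c] by (simp add: val_ge_def)
      then have "v (ratfun_x * poly_fract g + ratfun_const c) = int (Suc (degree g)) * v ratfun_x"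
        using add_dominant(2)[OF xg(1)] xg(2) by simp
      moreover have "degree (pCons c g) = Suc (degree g)" using False by simp
      ultimately show ?thesis by (metis poly_fract_pCons add.commute)
    qed
  qed simp
  obtain a where a: "a \<noteq> 0" "v a = 1" using places_uniformizer[OF assms(1)] by blast
  obtain n d where "a = Fract n d" "d \<noteq> 0" "n \<noteq> 0"
    using a by (cases a rule: Fract_cases_nonzero) auto
  then have "1 = (int (degree n) - int (degree d)) * v ratfun_x"
    using divide[of "poly_fract n" "poly_fract d"] val a by (simp add: left_diff_distrib)
  then have "v ratfun_x dvd 1" by (metis dvd_triv_right)
  then have "v ratfun_x = -1" using assms(2) zdvd1_eq by force
  then show ?thesis using val[OF assms(3)] by simp
qed

lemma infinite_place_unique:
  assumes "v \<in> places ratfun_const" "v ratfun_x < 0" "v' \<in> places ratfun_const" "v' ratfun_x < 0"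
  shows "v = v'"
proof
  interpret v: valuation v using assms(1) by (rule places_valuation)
  interpret v': valuation v' using assms(3) by (rule places_valuation)
  fix a show "v a = v' a"
  proof (cases a rule: Fract_cases_nonzero)
    case (Fract n d)
    then show ?thesis
      using infinite_place_value[OF assms(1,2)] infinite_place_value[OF assms(3,4)]
        v.divide[of "poly_fract n" "poly_fract d"] v'.divide[of "poly_fract n" "poly_fract d"]
      by simp
  qed simp
qed

lemma infinite_place_residue:
  assumes v: "v \<in> places ratfun_const" "v ratfun_x < 0" and a: "val_ge v a 0"
  shows "\<exists>c. val_ge v (a - ratfun_const c) 1"
proof (cases a rule: Fract_cases_nonzero)
  case (Fract n m)
  interpret valuation v using v(1) by (rule places_valuation)
  note val = infinite_place_value[OF v]
  have a0: "a \<noteq> 0" using Fract by (simp add: Zero_fract_def eq_fract)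
  have "v a = int (degree m) - int (degree n)"
    using divide[of "poly_fract n" "poly_fract m"] Fract val by simp
  then have deg: "degree n \<le> degree m" using a a0 by (simp add: val_ge_def)
  \<comment> \<open>The value of \<open>a\<close> at infinity: subtracting \<open>c\<close> cancels
    the coefficient at \<open>degree m\<close>, which is 0 in \<open>n\<close> if \<open>n\<close>
    has smaller degree.\<close>
  define c where "c = coeff n (degree m) / lead_coeff m"
  have "a - ratfun_const c = Fract (n - smult c m) m"
    using Fract by (simp add: ratfun_const_def)
  moreover have "val_ge v (Fract (n - smult c m) m) 1"
  proof (cases "n - smult c m = 0")
    case False
    have "degree (n - smult c m) \<noteq> degree m"
    proof
      assume "degree (n - smult c m) = degree m"
      then have "coeff (n - smult c m) (degree m) \<noteq> 0" using False by (metis leading_coeff_0_iff)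
      then show False using Fract(2) by (simp add: c_def)
    qed
    moreover have "degree (n - smult c m) \<le> degree m"
      using deg by (intro degree_diff_le) (auto intro: degree_smult_le)
    ultimately show ?thesis
      using divide[of "poly_fract (n - smult c m)" "poly_fract m"] Fract(2) val False
      by (simp add: val_ge_def)
  qed (simp add: fract_collapse)
  ultimately show ?thesis by metis
next
  case 0
  then show ?thesis by (intro exI[of _ 0]) simp
qed

section \<open>Places in a quadratic extension\<close>

locale embedded_field =
  fixes \<iota> :: "'a::field \<Rightarrow> 'b::field"
  assumes embedding: "field_embedding \<iota>"
begin

lemma emb_1 [simp]: "\<iota> 1 = 1"
  and emb_add [simp]: "\<iota> (a + b) = \<iota> a + \<iota> b"
  and emb_mult [simp]: "\<iota> (a * b) = \<iota> a * \<iota> b"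
  using embedding by (auto simp: field_embedding_def)

lemma emb_0 [simp]: "\<iota> 0 = 0"
proof -
  have "\<iota> 0 + \<iota> 0 = \<iota> 0" using emb_add[of 0 0] by (simp only: add_0_left)
  then show ?thesis by (metis add_cancel_left_left)
qed

lemma emb_uminus [simp]: "\<iota> (- a) = - \<iota> a"
  using emb_add[of a "- a"] by (simp add: eq_neg_iff_add_eq_0 add.commute)

lemma emb_diff [simp]: "\<iota> (a - b) = \<iota> a - \<iota> b"
  using emb_add[of a "- b"] by simp

lemma emb_eq_0_iff [simp]: "\<iota> a = 0 \<longleftrightarrow> a = 0"
proof
  assume "\<iota> a = 0"
  then show "a = 0" using emb_mult[of a "inverse a"] by (cases "a = 0") auto
qed simp

lemma emb_inverse [simp]: "\<iota> (inverse a) = inverse (\<iota> a)"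
proof (cases "a = 0")
  case False
  then show ?thesis using emb_mult[of a "inverse a"]
    by (metis emb_1 inverse_unique right_inverse)
qed simp

lemma emb_divide [simp]: "\<iota> (a / b) = \<iota> a / \<iota> b"
  by (simp add: divide_inverse)

lemma emb_2 [simp]: "\<iota> 2 = 2"
  by (metis emb_1 emb_add one_add_one)

lemma emb_eq_iff [simp]: "\<iota> a = \<iota> b \<longleftrightarrow> a = b"
  using emb_eq_0_iff[of "a - b"] by simp

lemma emb_power [simp]: "\<iota> (a ^ n) = \<iota> a ^ n"
  by (induction n) simp_all

lemma emb_power_int [simp]: "\<iota> (a powi n) = \<iota> a powi n"
  by (simp add: power_int_def)

lemma emb_sum [simp]: "\<iota> (sum f S) = (\<Sum>i\<in>S. \<iota> (f i))"
  by (induction S rule: infinite_finite_induct) simp_all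

text \<open>In a basis \<open>b1, b2\<close> write \<open>1 = r b1 + s b2\<close>. If
  \<open>r\<close> is nonzero, 1 can replace \<open>b1\<close> and \<open>b2\<close> is the
  generator; otherwise the two exchange roles.\<close>

lemma quadratic_generator:
  assumes "extension_degree \<iota> = 2"
  shows "\<exists>y. y \<notin> range \<iota> \<and> (\<forall>z. \<exists>a b. z = \<iota> a + \<iota> b * y)"
proof -
  interpret V: vector_space "\<lambda>a z. \<iota> a * z"
    by unfold_locales (simp_all add: algebra_simps)
  have "V.dim UNIV = 2" using assms by (simp add: extension_degree_def)
  then obtain B where B: "V.independent B" "UNIV \<subseteq> V.span B" "card B = 2"
    using V.basis_exists[of UNIV] by metis
  obtain b1 b2 where b: "B = {b1, b2}" "b1 \<noteq> b2" using B(3) by (auto simp: card_2_iff)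
  have span: "\<exists>a c. z = \<iota> a * b1 + \<iota> c * b2" for z
  proof -
    have "z \<in> V.span {b1, b2}" using B(2) b(1) by auto
    then obtain k where "z - \<iota> k * b1 \<in> V.span {b2}"
      unfolding V.span_insert[of b1] by auto
    then obtain l where "z - \<iota> k * b1 = \<iota> l * b2" by (auto simp: V.span_singleton)
    then show ?thesis by (intro exI[of _ k] exI[of _ l]) (simp add: algebra_simps)
  qed
  have indep: "a = 0 \<and> c = 0" if "\<iota> a * b1 + \<iota> c * b2 = 0" for a c
  proof -
    have "b1 \<notin> V.span {b2}" "b2 \<notin> V.span {b1}"
      using B(1) b by (auto simp: V.dependent_def insert_Diff_if split: if_splits)
    then have n: "\<And>k. b1 \<noteq> \<iota> k * b2" "\<And>k. b2 \<noteq> \<iota> k * b1" by (auto simp: V.span_singleton)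
    have "a = 0"
    proof (rule ccontr)
      assume "a \<noteq> 0"
      then have "b1 = \<iota> (- c / a) * b2" using that by (simp add: field_simps eq_neg_iff_add_eq_0)
      then show False using n by blast
    qed
    moreover have "c = 0"
    proof (rule ccontr)
      assume "c \<noteq> 0"
      then have "b2 = \<iota> (- a / c) * b1" using that by (simp add: field_simps eq_neg_iff_add_eq_0 add.commute)
      then show False using n by blast
    qed
    ultimately show ?thesis ..
  qed
  obtain r s where rs: "1 = \<iota> r * b1 + \<iota> s * b2" using span by blast
  have main: "\<exists>y. y \<notin> range \<iota> \<and> (\<forall>z. \<exists>a b. z = \<iota> a + \<iota> b * y)"
    if rs: "1 = \<iota> r * b1 + \<iota> s * b2" and r: "r \<noteq> 0"
      and span: "\<And>z. \<exists>a c. z = \<iota> a * b1 + \<iota> c * b2"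
      and indep: "\<And>a c. \<iota> a * b1 + \<iota> c * b2 = 0 \<Longrightarrow> a = 0 \<and> c = 0"
    for b1 b2 r s
  proof (intro exI[of _ b2] conjI allI notI)
    assume "b2 \<in> range \<iota>"
    then obtain k where k: "b2 = \<iota> k" by blast
    have "\<iota> (k * r) * b1 + \<iota> (k * s - 1) * b2 = \<iota> k * (\<iota> r * b1 + \<iota> s * b2) - b2"
      by (simp add: algebra_simps)
    also have "\<dots> = 0" using rs k by simp
    finally have "k * r = 0 \<and> k * s - 1 = 0" by (rule indep)
    then show False using r by auto
  next
    fix z
    obtain a c where z: "z = \<iota> a * b1 + \<iota> c * b2" using span by blast
    define k where "k = a / r"
    have "a = k * r" using r by (simp add: k_def)
    then have "z = \<iota> k * (\<iota> r * b1 + \<iota> s * b2) + \<iota> (c - k * s) * b2"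
      by (simp add: z algebra_simps)
    then have "z = \<iota> k + \<iota> (c - k * s) * b2" by (simp only: rs [symmetric] mult_1_right)
    then show "\<exists>a b. z = \<iota> a + \<iota> b * b2" by blast
  qed
  show ?thesis
  proof (cases "r = 0")
    case False
    then show ?thesis using main[OF rs _ span indep] by blast
  next
    case True
    then have "s \<noteq> 0" using rs by auto
    have rs': "1 = \<iota> s * b2 + \<iota> r * b1" using rs by (simp add: add.commute)
    have span': "\<exists>a c. z = \<iota> a * b2 + \<iota> c * b1" for z
      using span[of z] by (metis add.commute)
    have indep': "a = 0 \<and> c = 0" if "\<iota> a * b2 + \<iota> c * b1 = 0" for a c
      using indep[of c a] that by (simp add: add.commute)
    show ?thesis using main[OF rs' \<open>s \<noteq> 0\<close> span' indep'] by blast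
  qed
qed

text \<open>The generator \<open>y\<close> is a root of \<open>T^2 - A T - B\<close>, whose other
  root is \<open>A - y\<close>. Replacing \<open>y\<close> by \<open>A - y\<close> respects products
  because both satisfy the same equation. In the inseparable case the roots coincide and \<sigma> is
  the identity.\<close>

lemma conjugation_exists:
  assumes "extension_degree \<iota> = 2"
  shows "\<exists>\<sigma>. (\<forall>a b. \<sigma> (a + b) = \<sigma> a + \<sigma> b) \<and> (\<forall>a b. \<sigma> (a * b) = \<sigma> a * \<sigma> b) \<and>
    (\<forall>a. \<sigma> (\<iota> a) = \<iota> a) \<and> (\<forall>z. \<sigma> (\<sigma> z) = z) \<and> (\<forall>z. z + \<sigma> z \<in> range \<iota>) \<and> (\<forall>z. z * \<sigma> z \<in> range \<iota>)"
proof -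
  obtain y where y: "y \<notin> range \<iota>" and gen: "\<And>z. \<exists>a b. z = \<iota> a + \<iota> b * y"
    using quadratic_generator[OF assms] by blast
  obtain B A where y2: "y * y = \<iota> B + \<iota> A * y" using gen by blast
  have uniq: "a = a' \<and> b = b'" if "\<iota> a + \<iota> b * y = \<iota> a' + \<iota> b' * y" for a b a' b'
  proof -
    have "b = b'"
    proof (rule ccontr)
      assume "b \<noteq> b'"
      then have "y = \<iota> ((a' - a) / (b - b'))" using that by (simp add: field_simps)
      then show False using y by blast
    qed
    then show ?thesis using that by simp
  qed
  define \<sigma> where "\<sigma> z = (THE u. \<exists>a b. z = \<iota> a + \<iota> b * y \<and> u = \<iota> a + \<iota> b * (\<iota> A - y))" for z
  have \<sigma>: "\<sigma> (\<iota> a + \<iota> b * y) = \<iota> a + \<iota> b * (\<iota> A - y)" for a b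
    unfolding \<sigma>_def using uniq by (intro the_equality) blast+
  have add: "\<sigma> (z + z') = \<sigma> z + \<sigma> z'" for z z'
  proof -
    obtain a b where z: "z = \<iota> a + \<iota> b * y" using gen by blast
    obtain a' b' where z': "z' = \<iota> a' + \<iota> b' * y" using gen by blast
    have "z + z' = \<iota> (a + a') + \<iota> (b + b') * y" by (simp add: z z' algebra_simps)
    then have "\<sigma> (z + z') = \<iota> (a + a') + \<iota> (b + b') * (\<iota> A - y)" by (simp only: \<sigma>)
    also have "\<dots> = (\<iota> a + \<iota> b * (\<iota> A - y)) + (\<iota> a' + \<iota> b' * (\<iota> A - y))"
      by (simp add: algebra_simps)
    finally show ?thesis by (simp only: z z' \<sigma>)
  qed
  have mult: "\<sigma> (z * z') = \<sigma> z * \<sigma> z'" for z z'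
  proof -
    obtain a b where z: "z = \<iota> a + \<iota> b * y" using gen by blast
    obtain a' b' where z': "z' = \<iota> a' + \<iota> b' * y" using gen by blast
    have "z * z' = \<iota> a * \<iota> a' + \<iota> (a * b' + b * a') * y + \<iota> b * \<iota> b' * (y * y)"
      by (simp add: z z' algebra_simps)
    also have "\<dots> = \<iota> (a * a' + b * b' * B) + \<iota> (a * b' + b * a' + b * b' * A) * y"
      by (simp add: y2 algebra_simps)
    finally have "\<sigma> (z * z') = \<iota> (a * a' + b * b' * B) + \<iota> (a * b' + b * a' + b * b' * A) * (\<iota> A - y)"
      by (simp only: \<sigma>)
    moreover have "(\<iota> A - y) * (\<iota> A - y) = \<iota> A * \<iota> A - \<iota> A * y - \<iota> A * y + y * y"
      by (simp add: algebra_simps)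
    then have "(\<iota> A - y) * (\<iota> A - y) = \<iota> B + \<iota> A * (\<iota> A - y)"
      by (simp add: y2 algebra_simps)
    moreover have "\<sigma> z * \<sigma> z' = \<iota> a * \<iota> a' + \<iota> (a * b' + b * a') * (\<iota> A - y)
        + \<iota> b * \<iota> b' * ((\<iota> A - y) * (\<iota> A - y))"
      unfolding z z' \<sigma> by (simp add: algebra_simps)
    ultimately show ?thesis by (simp only: emb_add emb_mult distrib_left distrib_right add_ac mult_ac)
  qed
  have fix\<iota>: "\<sigma> (\<iota> a) = \<iota> a" for a using \<sigma>[of a 0] by simp
  have inv: "\<sigma> (\<sigma> z) = z" for z
  proof -
    obtain a b where z: "z = \<iota> a + \<iota> b * y" using gen by blast
    have "\<sigma> z = \<iota> (a + b * A) + \<iota> (- b) * y" unfolding z \<sigma> by (simp add: algebra_simps)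
    then have "\<sigma> (\<sigma> z) = \<iota> (a + b * A) + \<iota> (- b) * (\<iota> A - y)" by (simp only: \<sigma>)
    then show ?thesis by (simp add: z \<sigma> algebra_simps)
  qed
  have tr: "z + \<sigma> z \<in> range \<iota>" for z
  proof -
    obtain a b where z: "z = \<iota> a + \<iota> b * y" using gen by blast
    have "z + \<sigma> z = (\<iota> a + \<iota> b * y) + (\<iota> a + \<iota> b * (\<iota> A - y))" unfolding z \<sigma> ..
    also have "\<dots> = \<iota> (a + a + b * A)" by (simp add: algebra_simps)
    finally have "z + \<sigma> z = \<iota> (a + a + b * A)" .
    then show ?thesis by blast
  qed
  have norm: "z * \<sigma> z \<in> range \<iota>" for z
  proof -
    obtain a b where z: "z = \<iota> a + \<iota> b * y" using gen by blast
    have "z * \<sigma> z = \<iota> a * \<iota> a + \<iota> a * \<iota> b * \<iota> A + \<iota> b * \<iota> b * (\<iota> A * y - y * y)"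
      unfolding z \<sigma> by (simp add: algebra_simps)
    also have "\<dots> = \<iota> (a * a + a * b * A - b * b * B)" by (simp add: y2)
    finally show ?thesis by blast
  qed
  show ?thesis using add mult fix\<iota> inv tr norm by blast
qed

end

text \<open>Here \<sigma> may be the identity, so that the inseparable extension is an instance too;
  statements about a nontrivial conjugation assume an element moved by \<sigma>.\<close>

locale quadratic_extension = embedded_field \<iota>
  for \<iota> :: "'a::field \<Rightarrow> 'b::field" +
  fixes \<sigma> :: "'b \<Rightarrow> 'b"
  assumes generator: "\<exists>y. y \<notin> range \<iota> \<and> (\<forall>z. \<exists>a b. z = \<iota> a + \<iota> b * y)"
    and conj_add [simp]: "\<sigma> (y + z) = \<sigma> y + \<sigma> z"
    and conj_mult [simp]: "\<sigma> (y * z) = \<sigma> y * \<sigma> z"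
    and conj_emb [simp]: "\<sigma> (\<iota> a) = \<iota> a"
    and conj_conj [simp]: "\<sigma> (\<sigma> z) = z"
    and trace_in_base: "z + \<sigma> z \<in> range \<iota>"
    and norm_in_base: "z * \<sigma> z \<in> range \<iota>"
begin

lemma base_plus_multiple:
  assumes "y \<notin> range \<iota>"
  shows "\<exists>a b. z = \<iota> a + \<iota> b * y"
proof -
  obtain y0 where y0: "\<And>z. \<exists>a b. z = \<iota> a + \<iota> b * y0" using generator by blast
  obtain c d where cd: "y = \<iota> c + \<iota> d * y0" using y0 by blast
  then have "d \<noteq> 0" using assms by auto
  then have y0': "y0 = (y - \<iota> c) / \<iota> d" using cd by (simp add: field_simps)
  obtain a b where "z = \<iota> a + \<iota> b * y0" using y0 by blast
  also have "\<dots> = \<iota> (a - b * c / d) + \<iota> (b / d) * y"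
    unfolding y0' using \<open>d \<noteq> 0\<close> by (simp add: field_simps)
  finally show ?thesis by blast
qed

lemma conj_0 [simp]: "\<sigma> 0 = 0"
  and conj_1 [simp]: "\<sigma> 1 = 1"
  using conj_emb[of 0] conj_emb[of 1] by simp_all

lemma conj_uminus [simp]: "\<sigma> (- z) = - \<sigma> z"
  using conj_add[of z "- z"] by (simp add: eq_neg_iff_add_eq_0 add.commute)

lemma conj_diff [simp]: "\<sigma> (y - z) = \<sigma> y - \<sigma> z"
  using conj_add[of y "- z"] by simp

lemma conj_eq_0_iff [simp]: "\<sigma> z = 0 \<longleftrightarrow> z = 0"
  by (metis conj_0 conj_conj)

lemma conj_inverse [simp]: "\<sigma> (inverse z) = inverse (\<sigma> z)"
proof (cases "z = 0")
  case False
  then show ?thesis using conj_mult[of z "inverse z"]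
    by (metis conj_1 inverse_unique right_inverse)
qed simp

lemma conj_divide [simp]: "\<sigma> (y / z) = \<sigma> y / \<sigma> z"
  by (simp add: divide_inverse)

lemma conj_power [simp]: "\<sigma> (z ^ n) = \<sigma> z ^ n"
  by (induction n) simp_all

lemma conj_fixed:
  assumes "\<sigma> z = z" "\<exists>y. \<sigma> y \<noteq> y"
  shows "z \<in> range \<iota>"
proof (rule ccontr)
  assume "z \<notin> range \<iota>"
  obtain y where "\<sigma> y \<noteq> y" using assms(2) by blast
  moreover obtain a b where "y = \<iota> a + \<iota> b * z" using base_plus_multiple[OF \<open>z \<notin> range \<iota>\<close>] by blast
  ultimately show False using assms(1) by simp
qed

lemma quadratic_equation: "\<exists>t n. z\<^sup>2 = \<iota> t * z + \<iota> n"
proof -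
  obtain t n where "z + \<sigma> z = \<iota> t" "z * \<sigma> z = \<iota> n" using trace_in_base norm_in_base by blast
  then have "z\<^sup>2 = \<iota> t * z + \<iota> (- n)"
    by (auto simp: power2_eq_square algebra_simps simp flip: \<open>z + \<sigma> z = \<iota> t\<close> \<open>z * \<sigma> z = \<iota> n\<close>)
  then show ?thesis by blast
qed

section \<open>Conjugation and restriction of places\<close>

lemma valuation_conj: "valuation w \<Longrightarrow> valuation (w \<circ> \<sigma>)"
proof -
  assume "valuation w"
  then interpret valuation w .
  show ?thesis
  proof
    fix a b :: 'b assume "a \<noteq> 0" "b \<noteq> 0" "a + b \<noteq> 0"
    then show "min ((w \<circ> \<sigma>) a) ((w \<circ> \<sigma>) b) \<le> (w \<circ> \<sigma>) (a + b)"
      using add_ge[of "\<sigma> a" "\<sigma> b"] conj_eq_0_iff[of "a + b"] by simp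
  qed (simp_all add: mult)
qed

lemma places_conj: "w \<in> places (\<iota> \<circ> \<kappa>) \<Longrightarrow> w \<circ> \<sigma> \<in> places (\<iota> \<circ> \<kappa>)"
proof -
  assume w: "w \<in> places (\<iota> \<circ> \<kappa>)"
  obtain a where "w a = 1" using places_uniformizer[OF w] by blast
  then show ?thesis
    using valuation_conj[OF places_valuation[OF w]] places_const[OF w]
    by (intro placesI[where a = "\<sigma> a"]) auto
qed

text \<open>If \<open>w\<close> were trivial on the base field, every element of the extension would
  be integral over it, so \<open>z\<close> and \<open>inverse z\<close> would both have nonnegative
  values.\<close>

lemma restriction_nontrivial:
  assumes "valuation w" "z \<noteq> 0" "w z \<noteq> 0"
  shows "\<exists>a. a \<noteq> 0 \<and> w (\<iota> a) \<noteq> 0"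
proof (rule ccontr)
  assume "\<not> ?thesis"
  then have triv: "a \<noteq> 0 \<Longrightarrow> w (\<iota> a) = 0" for a by blast
  interpret valuation w by fact
  have pos: "w z \<ge> 0" if "z \<noteq> 0" for z
  proof -
    obtain t n where "z\<^sup>2 = \<iota> t * z + \<iota> n" using quadratic_equation by blast
    then have "z\<^sup>2 + \<iota> (- t) * z + \<iota> (- n) = 0" by simp
    moreover have "val_ge w (\<iota> a) 0" for a using triv[of a] by (cases "a = 0") (auto simp: val_ge_def)
    ultimately show ?thesis using unit_root_cases[OF that] by blast
  qed
  show False using pos[of z] pos[of "inverse z"] assms(2,3) inverse[of z] by simp
qed

text \<open>The values of \<open>w\<close> on the base field form a nonzero subgroup of the
  integers; division by its positive generator \<open>e\<close> normalizes the restriction.\<close>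

lemma restrict_place:
  assumes "w \<in> places (\<iota> \<circ> \<kappa>)"
  shows "\<exists>v\<in>places \<kappa>. \<exists>e. lies_over \<iota> v e w"
proof -
  interpret valuation w using assms by (rule places_valuation)
  have vi: "w (\<iota> (a powi n)) = n * w (\<iota> a)" for a n
    by (simp add: power_int)
  obtain z where "z \<noteq> 0" "w z = 1" using places_uniformizer[OF assms] by blast
  then obtain a1 where a1: "a1 \<noteq> 0" "w (\<iota> a1) \<noteq> 0"
    using restriction_nontrivial[OF valuation_axioms, of z] by auto
  define Q where "Q n \<longleftrightarrow> n > 0 \<and> (\<exists>a. a \<noteq> 0 \<and> w (\<iota> a) = int n)" for n
  have "Q (nat \<bar>w (\<iota> a1)\<bar>)"
    unfolding Q_def using a1 inverse[of "\<iota> a1"]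
    by (cases "w (\<iota> a1) > 0") (auto intro: exI[of _ a1] exI[of _ "inverse a1"])
  then have "Q (LEAST n. Q n)" by (rule LeastI)
  define e where "e = (LEAST n. Q n)"
  from \<open>Q (LEAST n. Q n)\<close> obtain a0 where e: "e > 0" "a0 \<noteq> 0" "w (\<iota> a0) = int e"
    unfolding Q_def e_def by blast
  have dvd: "int e dvd w (\<iota> a)" for a
  proof (cases "a = 0")
    case False
    define r where "r = w (\<iota> a) mod int e"
    have "w (\<iota> (a * a0 powi (- (w (\<iota> a) div int e)))) = w (\<iota> a) - (w (\<iota> a) div int e) * int e"
      unfolding emb_mult using False e mult[of "\<iota> a" "\<iota> (a0 powi (- (w (\<iota> a) div int e)))"]
      by (subst mult) (auto simp: power_int)
    also have "\<dots> = r" by (simp add: r_def minus_div_mult_eq_mod)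
    finally have r: "w (\<iota> (a * a0 powi (- (w (\<iota> a) div int e)))) = r" .
    have "0 \<le> r" "r < int e" using e by (auto simp: r_def)
    have "r = 0"
    proof (rule ccontr)
      assume "r \<noteq> 0"
      then have "Q (nat r)" unfolding Q_def using r \<open>0 \<le> r\<close> False e(2)
        by (intro conjI exI[of _ "a * a0 powi (- (w (\<iota> a) div int e))"]) auto
      then have "e \<le> nat r" unfolding e_def by (rule Least_le)
      then show False using \<open>r < int e\<close> \<open>0 \<le> r\<close> e(1) by linarith
    qed
    then show ?thesis by (simp add: r_def dvd_eq_mod_eq_0)
  qed simp
  define v where "v a = w (\<iota> a) div int e" for a
  have v: "w (\<iota> a) = int e * v a" for a using dvd by (simp add: v_def)
  have "valuation v"
  proof
    show "v 0 = 0" by (simp add: v_def)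
    fix a b :: 'a assume ab: "a \<noteq> 0" "b \<noteq> 0"
    have "int e * v (a * b) = int e * (v a + v b)"
      using mult[of "\<iota> a" "\<iota> b"] ab by (simp add: v[symmetric] algebra_simps)
    then show "v (a * b) = v a + v b" using e(1) by simp
    assume "a + b \<noteq> 0"
    then have "\<iota> a + \<iota> b \<noteq> 0" by (metis emb_add emb_eq_0_iff)
    then have "min (int e * v a) (int e * v b) \<le> int e * v (a + b)"
      using add_ge[of "\<iota> a" "\<iota> b"] ab by (simp flip: v)
    then show "min (v a) (v b) \<le> v (a + b)" using e(1) by (auto simp: min_def split: if_splits)
  qed
  moreover have "v a0 = 1" using v[of a0] e by simp
  moreover have "v (\<kappa> c) = 0" for c using places_const[OF assms, of c] by (simp add: v_def)
  ultimately have "v \<in> places \<kappa>" by (rule placesI)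
  moreover have "lies_over \<iota> v e w" using e(1) v by (simp add: lies_over_def)
  ultimately show ?thesis by blast
qed

text \<open>Trace and norm determine the values of \<open>z\<close> and \<open>\<sigma> z\<close> up to order, so \<open>w'\<close> agrees at every \<open>z\<close>
  with \<open>w\<close> or \<open>w \<circ> \<sigma>\<close>; a group is not the union of two proper subgroups.\<close>

lemma conjugate_places:
  assumes w: "valuation w" "w z1 = 1" and w': "valuation w'" "w' z1' = 1"
    and over: "lies_over \<iota> v e w" "lies_over \<iota> v e' w'"
  shows "w' = w \<or> w' = w \<circ> \<sigma>"
proof -
  interpret w: valuation w by fact
  interpret w': valuation w' by fact
  interpret s: valuation "w \<circ> \<sigma>" using w(1) by (rule valuation_conj)
  have e: "e \<ge> 1" "e' \<ge> 1" "\<And>a. w (\<iota> a) = int e * v a" "\<And>a. w' (\<iota> a) = int e' * v a"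
    using over by (auto simp: lies_over_def)
  \<comment> \<open>The ramification indices are not yet known to be equal. Scaling each valuation
    by the index of the other makes the two agree on the base field.\<close>
  define W W' where "W z = int e' * w z" and "W' z = int e * w' z" for z
  have base: "W (\<iota> a) = W' (\<iota> a)" for a using e by (simp add: W_def W'_def)
  have Wadd: "W (a + b) = min (W a) (W b)" if "a \<noteq> 0" "b \<noteq> 0" "W a \<noteq> W b" for a b
    using w.add_distinct(2)[OF that(1,2)] that(3) e(2)
    by (auto simp: W_def min_def split: if_splits)
  have W'add: "W' (a + b) = min (W' a) (W' b)" if "a \<noteq> 0" "b \<noteq> 0" "W' a \<noteq> W' b" for a b
    using w'.add_distinct(2)[OF that(1,2)] that(3) e(1)
    by (auto simp: W'_def min_def split: if_splits)
  have Wge: "min (W a) (W b) \<le> W (a + b)" if "a \<noteq> 0" "b \<noteq> 0" "a + b \<noteq> 0" for a b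
    using w.add_ge[OF that] e(2) by (auto simp: W_def min_def split: if_splits)
  have W'ge: "min (W' a) (W' b) \<le> W' (a + b)" if "a \<noteq> 0" "b \<noteq> 0" "a + b \<noteq> 0" for a b
    using w'.add_ge[OF that] e(1) by (auto simp: W'_def min_def split: if_splits)
  have alt: "W' z = W z \<or> W' z = W (\<sigma> z)" if "z \<noteq> 0" for z
  proof -
    obtain t where t: "z + \<sigma> z = \<iota> t" using trace_in_base by blast
    obtain n where n: "z * \<sigma> z = \<iota> n" using norm_in_base by blast
    have z: "z \<noteq> 0" "\<sigma> z \<noteq> 0" using that by auto
    have sum: "W z + W (\<sigma> z) = W' z + W' (\<sigma> z)"
      using base[of n] w.mult[OF z] w'.mult[OF z] by (simp add: W_def W'_def distrib_left flip: n)
    have neg: "W (- z) = W z" "W' (- z) = W' z" by (simp_all add: W_def W'_def)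
    show ?thesis
    proof (cases "t = 0")
      case True
      then have "\<sigma> z = - z" using t by (simp add: add_eq_0_iff)
      then show ?thesis using sum neg by simp
    next
      case False
      then have nz: "z + \<sigma> z \<noteq> 0" using t by simp
      have "W (z + \<sigma> z) = W' (z + \<sigma> z)" using t base by simp
      then show ?thesis
        using sum Wadd[OF z] W'add[OF z] Wge[OF z nz] W'ge[OF z nz] by linarith
    qed
  qed
  have Wm: "W (a * b) = W a + W b" "W (\<sigma> (a * b)) = W (\<sigma> a) + W (\<sigma> b)" "W' (a * b) = W' a + W' b"
    if "a \<noteq> 0" "b \<noteq> 0" for a b
    using that w.mult[of a b] w.mult[of "\<sigma> a" "\<sigma> b"] w'.mult[of a b]
    by (simp_all add: W_def W'_def distrib_left)
  have "(\<forall>z. z \<noteq> 0 \<longrightarrow> W' z = W z) \<or> (\<forall>z. z \<noteq> 0 \<longrightarrow> W' z = W (\<sigma> z))"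
  proof (rule ccontr)
    assume "\<not> ?thesis"
    then obtain a b where a: "a \<noteq> 0" "W' a \<noteq> W a" and b: "b \<noteq> 0" "W' b \<noteq> W (\<sigma> b)" by blast
    then have "W' a = W (\<sigma> a)" "W' b = W b" using alt by blast+
    moreover have "W' (a * b) = W (a * b) \<or> W' (a * b) = W (\<sigma> (a * b))" using a b by (intro alt) simp
    ultimately show False using a b Wm[OF a(1) b(1)] by linarith
  qed
  \<comment> \<open>Both valuations take the value 1, so each index divides the other and the scale
    factors cancel.\<close>
  moreover have "w' = u" if u: "valuation u" "u z2 = 1" and eq: "\<And>z. z \<noteq> 0 \<Longrightarrow> int e * w' z = int e' * u z" for u z2
  proof -
    have nz: "z1' \<noteq> 0" "z2 \<noteq> 0" using w'(2) u(2) w'.zero valuation.zero[OF u(1)] by auto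
    have "int e dvd int e'" using eq[OF nz(2)] u(2) by (metis dvd_triv_left mult.right_neutral)
    moreover have "int e' dvd int e" using eq[OF nz(1)] w'(2) by (metis dvd_triv_left mult.right_neutral)
    ultimately have "e = e'" by (simp add: dvd_antisym)
    then have "w' z = u z" for z
      using eq[of z] e(1) valuation.zero[OF u(1)] by (cases "z = 0") auto
    then show ?thesis by blast
  qed
  from this[of w z1] this[of "w \<circ> \<sigma>" "\<sigma> z1"] w have
    "(\<And>z. z \<noteq> 0 \<Longrightarrow> W' z = W z) \<Longrightarrow> w' = w" "(\<And>z. z \<noteq> 0 \<Longrightarrow> W' z = W (\<sigma> z)) \<Longrightarrow> w' = w \<circ> \<sigma>"
    using s.valuation_axioms unfolding W_def W'_def by auto
  ultimately show ?thesis by blast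
qed

section \<open>Ramified, split and inert places\<close>

context
  fixes w :: "'b \<Rightarrow> int" and v :: "'a \<Rightarrow> int" and e :: nat and \<pi> :: 'b
  assumes w: "valuation w" and unif: "w \<pi> = 1" and over: "lies_over \<iota> v e w"
begin

interpretation valuation w by (rule w)

private lemma unif_nz: "\<pi> \<noteq> 0"
  using unif by auto

private lemma w_emb: "w (\<iota> a) = int e * v a" and e_pos: "e \<ge> 1"
  using over by (auto simp: lies_over_def)

lemma val_ge_emb: "val_ge w (\<iota> a) 0 \<longleftrightarrow> val_ge v a 0"
  using e_pos by (auto simp: val_ge_def w_emb zero_le_mult_iff)

lemma val_ge_emb_1: "val_ge w (\<iota> a) 1 \<longleftrightarrow> val_ge v a 1"
proof -
  have "1 \<le> int e * v a \<longleftrightarrow> 1 \<le> v a"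
    using e_pos by (metis int_one_le_iff_zero_less of_nat_0_less_iff less_le_trans zero_less_mult_iff zero_less_one not_less of_nat_less_0_iff)
  then show ?thesis by (auto simp: val_ge_def w_emb)
qed

text \<open>Modulo \<open>e\<close>, the terms of the quadratic equation of the uniformizer have the
  values 2, 1 and 0, apart from terms that vanish. For \<open>e > 2\<close> these are distinct, so
  no cancellation is possible.\<close>

lemma ramification_le_2: "e \<le> 2"
proof (rule ccontr)
  assume e: "\<not> e \<le> 2"
  obtain t n where eq: "\<pi>\<^sup>2 = \<iota> t * \<pi> + \<iota> n" using quadratic_equation by blast
  define c where "c = \<pi>\<^sup>2 - \<iota> t * \<pi>"
  have not1: "\<not> int e dvd 1" using e by auto
  have not2: "\<not> int e dvd 2" using e by (auto dest: zdvd_imp_le)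
  have w2: "w (\<pi>\<^sup>2) = 2" using power[of \<pi> 2] unif by simp
  have "w c = 2 \<or> (\<exists>k. w c = int e * k + 1)"
  proof (cases "t = 0")
    case True
    then show ?thesis using w2 by (simp add: c_def)
  next
    case False
    then have wt: "w (- (\<iota> t * \<pi>)) = int e * v t + 1"
      using mult[of "\<iota> t" \<pi>] unif unif_nz by (simp add: w_emb)
    then have "w (\<pi>\<^sup>2) \<noteq> w (- (\<iota> t * \<pi>))"
      using w2 not1 by (metis add_diff_cancel_right' dvd_triv_left one_add_one)
    then have "w (\<pi>\<^sup>2 + - (\<iota> t * \<pi>)) = min 2 (int e * v t + 1)"
      using add_distinct(2)[of "\<pi>\<^sup>2" "- (\<iota> t * \<pi>)"] wt w2 False unif_nz by simp
    then show ?thesis by (auto simp: c_def min_def)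
  qed
  moreover have "w c = int e * v n" using eq by (simp add: c_def w_emb)
  ultimately show False using not1 not2 by (metis dvd_add_right_iff dvd_triv_left)
qed

text \<open>In \<open>u = \<iota> a + \<iota> b * \<pi>\<close> the first term has even and the
  second odd value, so the terms cannot cancel. If \<open>u\<close> is integral, the second term has
  an odd nonnegative value and vanishes modulo the place.\<close>

lemma residue_of_ramified:
  assumes "e = 2" "val_ge w u 0"
  shows "\<exists>a. val_ge w (u - \<iota> a) 1"
proof -
  have "\<pi> \<notin> range \<iota>" using unif w_emb assms(1) by (auto dest: arg_cong[of _ _ even])
  then obtain a b where u: "u = \<iota> a + \<iota> b * \<pi>" using base_plus_multiple by blast
  have "val_ge w (\<iota> b * \<pi>) 1"
  proof (cases "b = 0")
    case False
    have wb: "w (\<iota> b * \<pi>) = 2 * v b + 1"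
      using mult[of "\<iota> b" \<pi>] False unif unif_nz assms(1) by (simp add: w_emb)
    have "w (\<iota> b * \<pi>) \<ge> 0"
    proof (cases "a = 0")
      case True
      then show ?thesis using assms(2) u False unif_nz by (simp add: val_ge_def)
    next
      case a: False
      have "w (\<iota> a) \<noteq> w (\<iota> b * \<pi>)" using wb assms(1) w_emb[of a] by presburger
      then have "u \<noteq> 0" "w u = min (w (\<iota> a)) (w (\<iota> b * \<pi>))"
        using add_distinct[of "\<iota> a" "\<iota> b * \<pi>"] a False unif_nz u by auto
      then show ?thesis using assms(2) by (simp add: val_ge_def)
    qed
    then show ?thesis using wb by (simp add: val_ge_def)
  qed simp
  then show ?thesis using u by (intro exI[of _ a]) simp
qed

text \<open>If \<open>w z < w (\<sigma> z)\<close>, then \<open>s = z / (z + \<sigma> z)\<close> is congruent to 1 and \<open>\<sigma> s\<close> to 0, so the trace of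
  \<open>s ^ n * u\<close> approximates \<open>u\<close> by an element of the base field.\<close>

lemma split_place:
  assumes "w \<circ> \<sigma> \<noteq> w"
  shows "e = 1" "val_ge w u 0 \<Longrightarrow> \<exists>a. val_ge w (u - \<iota> a) 1"
proof -
  obtain z0 where "w (\<sigma> z0) \<noteq> w z0" using assms by (auto simp: fun_eq_iff)
  then obtain z where z: "w z < w (\<sigma> z)" by (metis conj_conj linorder_neq_iff)
  have z0: "z \<noteq> 0" using z by auto
  have nz: "z + \<sigma> z \<noteq> 0" and wt: "w (z + \<sigma> z) = w z"
    using add_distinct[of z "\<sigma> z"] z z0 by auto
  define s where "s = z / (z + \<sigma> z)"
  have sig: "\<sigma> s = \<sigma> z / (z + \<sigma> z)" by (simp add: s_def add.commute)
  have s0: "s \<noteq> 0" using z0 nz by (simp add: s_def)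
  have ws: "w s = 0" "w (\<sigma> s) \<ge> 1"
    unfolding sig unfolding s_def
    using divide[of z "z + \<sigma> z"] divide[of "\<sigma> z" "z + \<sigma> z"] z0 nz wt z by simp_all
  have "s + \<sigma> s = 1" using nz by (simp add: sig) (simp add: s_def flip: add_divide_distrib)
  then have s1: "1 - s = \<sigma> s" by (simp add: algebra_simps)
  have pow: "val_ge w (1 - s ^ n) 1" for n
  proof (induction n)
    case (Suc n)
    have "1 - s ^ Suc n = (1 - s ^ n) + s ^ n * (1 - s)" by (simp add: algebra_simps)
    moreover have "val_ge w (s ^ n * (1 - s)) 1"
      unfolding s1 using ws by (intro ge_mult0 ge_power) (simp_all add: val_ge_def)
    ultimately show ?case using ge_add[OF Suc.IH] by presburger
  qed simp
  have approx: "\<exists>a. val_ge w (u - \<iota> a) (w u + 1)" if u: "u \<noteq> 0" for u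
  proof -
    \<comment> \<open>Since \<open>w (\<sigma> s)\<close> is at least 1, this exponent lifts the
      conjugate term above \<open>w u\<close>, however negative \<open>w (\<sigma> u)\<close> may
      be.\<close>
    define n where "n = nat (w u + 1 - w (\<sigma> u))"
    obtain a where a: "s ^ n * u + \<sigma> (s ^ n * u) = \<iota> a" using trace_in_base by blast
    have "u - \<iota> a = (1 - s ^ n) * u - \<sigma> s ^ n * \<sigma> u" by (simp add: algebra_simps flip: a)
    moreover have "val_ge w ((1 - s ^ n) * u) (1 + w u)"
      by (intro ge_mult pow) (simp add: val_ge_def)
    moreover have "val_ge w (\<sigma> s ^ n * \<sigma> u) (w u + 1)"
    proof -
      have "w (\<sigma> s ^ n * \<sigma> u) = int n * w (\<sigma> s) + w (\<sigma> u)"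
        using mult[of "\<sigma> s ^ n" "\<sigma> u"] u s0 by (simp add: power)
      moreover have "int n * w (\<sigma> s) \<ge> int n * 1" using ws by (intro mult_left_mono) auto
      moreover have "int n \<ge> w u + 1 - w (\<sigma> u)" by (simp add: n_def)
      ultimately show ?thesis unfolding val_ge_def by linarith
    qed
    ultimately show ?thesis by (metis ge_diff add.commute)
  qed
  show "\<exists>a. val_ge w (u - \<iota> a) 1" if "val_ge w u 0"
  proof (cases "u = 0")
    case True
    then show ?thesis by (intro exI[of _ 0]) simp
  next
    case False
    then show ?thesis using approx[OF False] that by (metis val_ge_def val_ge_mono add.commute le_add_same_cancel1)
  qed
  \<comment> \<open>A sufficiently close approximation of the uniformizer has value 1 itself, so 1
    is a value on the base field and \<open>e\<close> divides it.\<close>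
  obtain a where "val_ge w (\<pi> - \<iota> a) (w \<pi> + 1)" using approx[OF unif_nz] by blast
  then have "val_ge w (\<iota> a - \<pi>) (w \<pi> + 1)" using ge_uminus by fastforce
  then have "w (\<pi> + (\<iota> a - \<pi>)) = w \<pi>" using add_dominant(2)[OF unif_nz] by blast
  moreover have "\<pi> + (\<iota> a - \<pi>) = \<iota> a" by simp
  ultimately have "int e * v a = 1" using unif w_emb[of a] by (simp only:)
  then have "int e dvd 1" by (metis dvd_triv_left)
  then show "e = 1" by simp
qed

text \<open>Otherwise every \<open>y\<close> would be a \<open>w\<close>-adic limit of elements of the base field, hence fixed by \<open>\<sigma>\<close>.\<close>

lemma inert_place:
  assumes inv: "w \<circ> \<sigma> = w" and sep: "\<exists>y. \<sigma> y \<noteq> y" and e: "e = 1" and c: "v c = 1"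
  shows "\<exists>u. val_ge w u 0 \<and> (\<forall>a. \<not> val_ge w (u - \<iota> a) 1)"
proof (rule ccontr)
  assume "\<not> ?thesis"
  then have f1: "\<exists>a. val_ge w (u - \<iota> a) 1" if "val_ge w u 0" for u using that by blast
  have inv': "w (\<sigma> z) = w z" for z using inv by (metis comp_apply)
  obtain y0 where y0: "\<sigma> y0 \<noteq> y0" using sep by blast
  \<comment> \<open>\<sigma> moves \<open>y0\<close> and its inverse alike, and one of the two is
    integral.\<close>
  define y where "y = (if w y0 \<ge> 0 then y0 else inverse y0)"
  have y: "\<sigma> y \<noteq> y" "val_ge w y 0"
    using y0 inverse[of y0] by (auto simp: y_def val_ge_def)
  have wc: "w (\<iota> c) = 1" using c e by (simp add: w_emb)
  then have c0: "\<iota> c \<noteq> 0" by auto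
  have approx: "\<exists>a. val_ge w (y - \<iota> a) (int n)" for n
  proof (induction n)
    case 0
    then show ?case using y(2) by (intro exI[of _ 0]) simp
  next
    case (Suc n)
    then obtain a where a: "val_ge w (y - \<iota> a) (int n)" by blast
    \<comment> \<open>The error is rescaled to an integral element, whose residue \<open>b\<close>
      is the next digit of an expansion in powers of \<open>c\<close>.\<close>
    define u where "u = (y - \<iota> a) * inverse (\<iota> c ^ n)"
    have "val_ge w u (int n + - int n)"
      unfolding u_def using a by (intro ge_mult) (simp_all add: val_ge_def inverse power wc)
    then obtain b where b: "val_ge w (u - \<iota> b) 1" using f1 by auto
    have "val_ge w (\<iota> c ^ n * (u - \<iota> b)) (int n + 1)"
      using b by (intro ge_mult) (simp_all add: val_ge_def power wc)
    moreover have "\<iota> c ^ n * (u - \<iota> b) = y - \<iota> (a + c ^ n * b)"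
      using c0 by (simp add: u_def algebra_simps)
    ultimately show ?case by (metis of_nat_Suc add.commute)
  qed
  have "val_ge w (y - \<sigma> y) (int n)" for n
  proof -
    obtain a where a: "val_ge w (y - \<iota> a) (int n)" using approx by blast
    then have "val_ge w (\<sigma> (y - \<iota> a)) (int n)" unfolding val_ge_def inv' conj_eq_0_iff .
    then have "val_ge w ((y - \<iota> a) - \<sigma> (y - \<iota> a)) (int n)" by (rule ge_diff[OF a])
    then show ?thesis by simp
  qed
  then have "val_ge w (y - \<sigma> y) (int (nat (w (y - \<sigma> y) + 1)))" .
  moreover have "y - \<sigma> y \<noteq> 0" using y(1) by simp
  ultimately show False unfolding val_ge_def by linarith
qed

text \<open>If \<open>b\<close> had too small a value, division by \<open>b\<close> would bring
  \<open>u\<close> close to the base element \<open>- a / b\<close>, against the choice of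
  \<open>u\<close>. So the residues of 1 and \<open>u\<close> are independent over the residue field
  below.\<close>

lemma integral_combination:
  assumes u: "val_ge w u 0" "\<And>a. \<not> val_ge w (u - \<iota> a) 1"
    and ge: "val_ge w (\<iota> a + \<iota> b * u) n"
  shows "val_ge w (\<iota> b) n" "val_ge w (\<iota> a) n"
proof -
  show b: "val_ge w (\<iota> b) n"
  proof (rule ccontr)
    assume nb: "\<not> val_ge w (\<iota> b) n"
    then have b0: "b \<noteq> 0" by auto
    have "val_ge w ((\<iota> a + \<iota> b * u) * inverse (\<iota> b)) (n + - w (\<iota> b))"
      using ge by (intro ge_mult) (simp_all add: val_ge_def inverse)
    moreover have "(\<iota> a + \<iota> b * u) * inverse (\<iota> b) = u - \<iota> (- (a / b))"
      using b0 by (simp add: field_simps)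
    ultimately have "val_ge w (u - \<iota> (- (a / b))) 1"
      using nb by (metis val_ge_mono val_ge_def not_le zle_diff1_eq diff_conv_add_uminus zle_diff1_eq
        add.commute le_diff_eq zless_imp_add1_zle)
    then show False using u(2) by blast
  qed
  have "val_ge w ((\<iota> a + \<iota> b * u) - u * \<iota> b) n"
    using ge b u(1) by (intro ge_diff ge_mult0)
  then show "val_ge w (\<iota> a) n" by (simp add: mult.commute)
qed

end

end

section \<open>Extending a place\<close>

context quadratic_extension
begin

context
  fixes v :: "'a \<Rightarrow> int" and p :: 'a
  assumes v: "valuation v" and vp: "v p = 1"
begin

interpretation v: valuation v by (rule v)

text \<open>A maximal overring of the valuation ring of \<open>v\<close> in which \<open>p\<close> is not invertible is a valuation ring.\<close>

private definition overring :: "'b set \<Rightarrow> bool" where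
  "overring R \<longleftrightarrow> (\<forall>a. val_ge v a 0 \<longrightarrow> \<iota> a \<in> R) \<and> (\<forall>a\<in>R. \<forall>b\<in>R. a + b \<in> R) \<and>
     (\<forall>a\<in>R. \<forall>b\<in>R. a * b \<in> R) \<and> inverse (\<iota> p) \<notin> R"

private lemma p_nz: "p \<noteq> 0"
  using vp by auto

private lemma maximal_overring: "\<exists>R. overring R \<and> (\<forall>S. overring S \<longrightarrow> R \<subseteq> S \<longrightarrow> S = R)"
proof -
  have "overring {\<iota> a |a. val_ge v a 0}"
    unfolding overring_def
  proof (intro conjI ballI allI impI)
    fix x y assume "x \<in> {\<iota> a |a. val_ge v a 0}" "y \<in> {\<iota> a |a. val_ge v a 0}"
    then obtain a b where ab: "x = \<iota> a" "val_ge v a 0" "y = \<iota> b" "val_ge v b 0" by blast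
    then have "x + y = \<iota> (a + b)" "x * y = \<iota> (a * b)" by simp_all
    then show "x + y \<in> {\<iota> a |a. val_ge v a 0}" "x * y \<in> {\<iota> a |a. val_ge v a 0}"
      using v.ge_add[OF ab(2,4)] v.ge_mult0[OF ab(2,4)] by blast+
  next
    show "inverse (\<iota> p) \<notin> {\<iota> a |a. val_ge v a 0}"
    proof
      assume "inverse (\<iota> p) \<in> {\<iota> a |a. val_ge v a 0}"
      then obtain a where "\<iota> (inverse p) = \<iota> a" "val_ge v a 0" by auto
      then show False using vp p_nz v.inverse[of p] by (auto simp: val_ge_def simp del: emb_inverse)
    qed
  qed blast
  then have "{R. overring R} \<noteq> {}" by blast
  moreover have "\<Union>C \<in> {R. overring R}" if C: "C \<noteq> {}" "subset.chain {R. overring R} C" for C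
  proof -
    have or: "overring R" if "R \<in> C" for R using C that by (auto simp: subset.chain_def)
    have two: "\<exists>R\<in>C. x \<in> R \<and> y \<in> R" if "x \<in> \<Union>C" "y \<in> \<Union>C" for x y
      using that C(2) unfolding subset_chain_def by blast
    have "x + y \<in> \<Union>C \<and> x * y \<in> \<Union>C" if xy: "x \<in> \<Union>C" "y \<in> \<Union>C" for x y
    proof -
      obtain R where "R \<in> C" "x \<in> R" "y \<in> R" using two[OF xy] by blast
      then show ?thesis using or[of R] unfolding overring_def by blast
    qed
    moreover have "\<iota> a \<in> \<Union>C" if "val_ge v a 0" for a
      using C(1) or that unfolding overring_def by blast
    moreover have "inverse (\<iota> p) \<notin> \<Union>C" using or unfolding overring_def by blast
    ultimately show ?thesis unfolding overring_def by blast
  qed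
  ultimately have "\<exists>M\<in>{R. overring R}. \<forall>X\<in>{R. overring R}. M \<subseteq> X \<longrightarrow> X = M"
    by (rule subset_Zorn_nonempty)
  then show ?thesis by blast
qed

section \<open>The maximal overring is a valuation ring\<close>

context
  fixes R :: "'b set"
  assumes overring: "overring R" and maximal: "\<And>S. overring S \<Longrightarrow> R \<subseteq> S \<Longrightarrow> S = R"
begin

private lemma R_emb: "val_ge v a 0 \<Longrightarrow> \<iota> a \<in> R"
  and R_add: "x \<in> R \<Longrightarrow> y \<in> R \<Longrightarrow> x + y \<in> R"
  and R_mult: "x \<in> R \<Longrightarrow> y \<in> R \<Longrightarrow> x * y \<in> R"
  and R_inv: "inverse (\<iota> p) \<notin> R"
  using overring by (auto simp: overring_def)

private lemma R_0: "0 \<in> R" and R_1: "1 \<in> R"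
  using R_emb[of 0] R_emb[of 1] v.ge_one by auto

private lemma R_uminus: "a \<in> R \<Longrightarrow> - a \<in> R"
  using R_mult[of "\<iota> (- 1)" a] R_emb[of "- 1"] by (simp add: val_ge_def)

private lemma R_diff: "a \<in> R \<Longrightarrow> b \<in> R \<Longrightarrow> a - b \<in> R"
  using R_add[of a "- b"] R_uminus by simp

private lemma R_power: "a \<in> R \<Longrightarrow> a ^ n \<in> R"
  by (induction n) (auto intro: R_1 R_mult)

private lemma R_p: "\<iota> p \<in> R"
  using vp by (intro R_emb) (simp add: val_ge_def)

text \<open>By maximality it suffices that \<open>R + R u\<close> does not contain
  \<open>1 / p\<close>. If it did, \<open>1 / p\<close> would satisfy a monic quadratic equation
  over \<open>R\<close>, and multiplying that equation by \<open>p\<close> would put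
  \<open>1 / p\<close> into \<open>R\<close>.\<close>

private lemma R_integral:
  assumes u: "u * u = s * u + t" and st: "s \<in> R" "t \<in> R"
  shows "u \<in> R"
proof -
  define S where "S = {a + b * u |a b. a \<in> R \<and> b \<in> R}"
  have SI: "a + b * u \<in> S" if "a \<in> R" "b \<in> R" for a b
    using that unfolding S_def by blast
  have "overring S"
    unfolding overring_def
  proof (intro conjI ballI allI impI)
    fix a assume "val_ge v a 0"
    then have "\<iota> a + 0 * u \<in> S" unfolding S_def using R_emb R_0 by blast
    then show "\<iota> a \<in> S" by simp
  next
    fix x y assume "x \<in> S" "y \<in> S"
    then obtain a b c d where x: "x = a + b * u" "y = c + d * u" and R: "a \<in> R" "b \<in> R" "c \<in> R" "d \<in> R"
      unfolding S_def by blast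
    have "x + y = (a + c) + (b + d) * u" using x by (simp add: algebra_simps)
    also have "\<dots> \<in> S" using R by (intro SI R_add)
    finally show "x + y \<in> S" .
    have "x * y = a * c + (a * d + b * c) * u + b * d * (u * u)" unfolding x by (simp add: algebra_simps)
    also have "\<dots> = (a * c + b * d * t) + (a * d + b * c + b * d * s) * u"
      by (subst u) (simp add: algebra_simps)
    also have "\<dots> \<in> S" using R st by (intro SI R_add R_mult)
    finally show "x * y \<in> S" .
  next
    show "inverse (\<iota> p) \<notin> S"
    proof
      assume "inverse (\<iota> p) \<in> S"
      then obtain a b where ab: "inverse (\<iota> p) = a + b * u" "a \<in> R" "b \<in> R" unfolding S_def by blast
      define r where "r = inverse (\<iota> p)"
      have ra: "r - a = b * u" using ab(1) by (simp add: r_def)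
      have "(r - a) * (r - a) = b * b * (u * u)" unfolding ra by (simp only: mult_ac)
      also have "\<dots> = b * s * (b * u) + b * b * t" by (subst u) (simp only: algebra_simps)
      finally have "(r - a) * (r - a) = b * s * (r - a) + b * b * t" by (simp only: ra)
      then have "r * r = (a + a + b * s) * r + (b * b * t - a * a - a * b * s)"
        by (simp only: algebra_simps)
      then have "\<iota> p * (r * r) = \<iota> p * ((a + a + b * s) * r + (b * b * t - a * a - a * b * s))"
        by (rule arg_cong)
      also have "\<dots> = (a + a + b * s) * (\<iota> p * r) + (b * b * t - a * a - a * b * s) * \<iota> p"
        by (simp only: algebra_simps)
      finally have "\<iota> p * (r * r) = (a + a + b * s) * (\<iota> p * r) + (b * b * t - a * a - a * b * s) * \<iota> p" .
      moreover have "\<iota> p * r = 1" using p_nz by (simp add: r_def)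
      ultimately have "r = (a + a + b * s) + (b * b * t - a * a - a * b * s) * \<iota> p"
        by (simp add: mult.assoc[symmetric])
      also have "\<dots> \<in> R" using ab st by (intro R_add R_diff R_mult R_p)
      finally show False using R_inv by (simp add: r_def)
    qed
  qed
  moreover have "R \<subseteq> S"
  proof
    fix a assume "a \<in> R"
    then have "a + 0 * u \<in> S" unfolding S_def using R_0 by blast
    then show "a \<in> S" by simp
  qed
  ultimately have "S = R" by (rule maximal)
  moreover have "0 + 1 * u \<in> S" unfolding S_def using R_0 R_1 by blast
  ultimately show ?thesis by simp
qed

private definition unit_R :: "'b \<Rightarrow> bool" where
  "unit_R a \<longleftrightarrow> a \<noteq> 0 \<and> a \<in> R \<and> inverse a \<in> R"

private lemma unit_mult: "unit_R a \<Longrightarrow> unit_R b \<Longrightarrow> unit_R (a * b)"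
  by (auto simp: unit_R_def intro: R_mult)

private lemma unit_inverse: "unit_R a \<Longrightarrow> unit_R (inverse a)"
  by (auto simp: unit_R_def)

text \<open>Inverting a nonzero nonunit \<open>r\<close> enlarges \<open>R\<close>, so by maximality
  \<open>1 / p\<close> appears in the larger ring as \<open>b / r ^ n\<close>.\<close>

private lemma nonunit_power:
  assumes r: "r \<in> R" "\<not> unit_R r"
  shows "\<exists>n. inverse (\<iota> p) * r ^ n \<in> R"
proof (cases "r = 0")
  case True
  then have "inverse (\<iota> p) * r ^ 1 \<in> R" using R_0 by simp
  then show ?thesis by blast
next
  case False
  then have ninv: "inverse r \<notin> R" using r by (simp add: unit_R_def)
  define S where "S = {b * inverse r ^ n |b n. b \<in> R}"
  have SI: "b * inverse r ^ n \<in> S" if "b \<in> R" for b n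
    using that unfolding S_def by blast
  have "R \<subseteq> S"
  proof
    fix a assume "a \<in> R"
    then have "a * inverse r ^ 0 \<in> S" unfolding S_def by blast
    then show "a \<in> S" by simp
  qed
  have "\<not> overring S"
  proof
    assume "overring S"
    then have "S = R" using \<open>R \<subseteq> S\<close> by (rule maximal)
    moreover have "1 * inverse r ^ 1 \<in> S" unfolding S_def using R_1 by blast
    ultimately show False using ninv by simp
  qed
  moreover have "x + y \<in> S" "x * y \<in> S" if "x \<in> S" "y \<in> S" for x y
  proof -
    obtain b m c n where x: "x = b * inverse r ^ m" "y = c * inverse r ^ n" and R: "b \<in> R" "c \<in> R"
      using \<open>x \<in> S\<close> \<open>y \<in> S\<close> unfolding S_def by blast
    have "inverse r ^ m * r ^ m = 1" "inverse r ^ n * r ^ n = 1"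
      using False by (simp_all flip: power_mult_distrib)
    then have "b * inverse r ^ m * (inverse r ^ n * r ^ n) + c * inverse r ^ n * (inverse r ^ m * r ^ m) = x + y"
      by (simp add: x)
    then have "x + y = (b * r ^ n + c * r ^ m) * inverse r ^ (m + n)"
      by (simp add: power_add algebra_simps)
    also have "\<dots> \<in> S" using R r(1) by (intro SI R_add R_mult R_power)
    finally show "x + y \<in> S" .
    have "x * y = (b * c) * inverse r ^ (m + n)" by (simp add: x power_add)
    also have "\<dots> \<in> S" using R by (intro SI R_mult)
    finally show "x * y \<in> S" .
  qed
  ultimately have "inverse (\<iota> p) \<in> S" using \<open>R \<subseteq> S\<close> R_emb unfolding overring_def by blast
  then obtain b n where "b \<in> R" "inverse (\<iota> p) = b * inverse r ^ n" unfolding S_def by blast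
  then have "inverse (\<iota> p) * r ^ n \<in> R" using False by (simp add: field_simps)
  then show ?thesis by blast
qed

text \<open>This makes \<open>R\<close> a local ring. For nonunits \<open>a\<close> and
  \<open>b\<close>, some \<open>a ^ n / p\<close> and \<open>b ^ m / p\<close> lie in
  \<open>R\<close>. Since \<open>a + b = 1\<close>, the powers \<open>a ^ n\<close> and
  \<open>b ^ m\<close> generate the unit ideal as well, and \<open>1 / p\<close> would be a
  combination of the two quotients.\<close>

private lemma sum_one_unit:
  assumes "a \<in> R" "b \<in> R" "a + b = 1"
  shows "unit_R a \<or> unit_R b"
proof (rule ccontr)
  let ?r = "inverse (\<iota> p)"
  assume "\<not> ?thesis"
  then obtain n m where nm: "?r * a ^ n \<in> R" "?r * b ^ m \<in> R" using nonunit_power assms by blast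
  have a: "a = 1 - b" using assms(3) by (simp add: algebra_simps)
  have "\<exists>c\<in>R. 1 - b ^ m = a * c"
  proof (induction m)
    case 0
    then show ?case using R_0 by (intro bexI[of _ 0]) simp_all
  next
    case (Suc m)
    then obtain c where c: "c \<in> R" "1 - b ^ m = a * c" by blast
    have "1 - b ^ Suc m = (1 - b ^ m) + b ^ m * a" by (simp add: a algebra_simps)
    also have "\<dots> = a * (c + b ^ m)" by (simp add: c(2) algebra_simps)
    finally show ?case using c(1) assms(2) R_add R_power by blast
  qed
  then obtain c where c: "c \<in> R" "1 - b ^ m = a * c" by blast
  have "\<exists>d\<in>R. (1 - b ^ m) ^ n = 1 - b ^ m * d"
  proof (induction n)
    case 0
    then show ?case using R_0 by (intro bexI[of _ 0]) simp_all
  next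
    case (Suc n)
    then obtain d where d: "d \<in> R" "(1 - b ^ m) ^ n = 1 - b ^ m * d" by blast
    have "(1 - b ^ m) ^ Suc n = 1 - b ^ m * (d + (1 - b ^ m * d))"
      by (simp add: d(2) algebra_simps)
    moreover have "d + (1 - b ^ m * d) \<in> R"
      using d(1) assms(2) by (intro R_add R_diff R_mult R_power R_1)
    ultimately show ?case by blast
  qed
  then obtain d where d: "d \<in> R" "(1 - b ^ m) ^ n = 1 - b ^ m * d" by blast
  have "?r = ?r * (1 - b ^ m * d) + ?r * b ^ m * d" by (simp add: algebra_simps)
  also have "1 - b ^ m * d = a ^ n * c ^ n" unfolding d(2)[symmetric] c(2) by (rule power_mult_distrib)
  also have "?r * (a ^ n * c ^ n) + ?r * b ^ m * d = (?r * a ^ n) * c ^ n + (?r * b ^ m) * d"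
    by (simp only: mult.assoc)
  also have "\<dots> \<in> R" by (rule R_add[OF R_mult[OF nm(1) R_power[OF c(1)]] R_mult[OF nm(2) d(1)]])
  finally show False using R_inv by simp
qed

private lemma val_ge_quotient: "a = 0 \<or> (b \<noteq> 0 \<and> v b \<le> v a) \<Longrightarrow> val_ge v (a / b) 0"
  using v.divide[of a b] by (cases "a = 0") (auto simp: val_ge_def)

text \<open>The coefficient of the quadratic equation with the most negative value decides. If both
  are integral, so is \<open>z\<close>; if \<open>n\<close> dominates, \<open>inverse z\<close> is
  integral; if \<open>t\<close> dominates, rescaling leads to two elements of \<open>R\<close> with
  sum 1, one of which is a unit.\<close>

private lemma R_valuation_ring:
  assumes "z \<noteq> 0"
  shows "z \<in> R \<or> inverse z \<in> R"
proof -
  obtain t n where "z\<^sup>2 = \<iota> t * z + \<iota> n" using quadratic_equation by blast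
  then have eq: "z * z = \<iota> t * z + \<iota> n" by (simp add: power2_eq_square)
  consider (int) "val_ge v t 0" "val_ge v n 0"
    | (n) "n \<noteq> 0" "v n < 0" "t = 0 \<or> v n \<le> v t"
    | (t) "t \<noteq> 0" "v t < 0" "n = 0 \<or> v t \<le> v n"
    by (auto simp: val_ge_def) linarith
  then show ?thesis
  proof cases
    case int
    then show ?thesis using R_integral[OF eq] R_emb by blast
  next
    case n
    have "inverse z * inverse z = \<iota> (- (t / n)) * inverse z + \<iota> (1 / n)"
    proof -
      have "z * z - \<iota> t * z = \<iota> n" unfolding eq by simp
      then have "inverse z * inverse z = 1 / \<iota> n * (z * z - \<iota> t * z) * (inverse z * inverse z)"
        using n(1) by simp
      also have "\<dots> = \<iota> (- (t / n)) * inverse z + \<iota> (1 / n)"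
        using assms n(1) by (simp add: field_simps)
      finally show ?thesis .
    qed
    moreover have "\<iota> (- (t / n)) \<in> R" "\<iota> (1 / n) \<in> R"
      using n val_ge_quotient[of t n] val_ge_quotient[of 1 n] v.ge_uminus
      by (auto intro!: R_emb simp del: emb_divide emb_uminus)
    ultimately show ?thesis using R_integral by blast
  next
    case t
    \<comment> \<open>Here \<open>x * x = x + n / t^2\<close>, that is,
      \<open>x * y = - n / t^2\<close>. A unit \<open>x\<close> gives \<open>inverse z\<close> as
      \<open>inverse x / t\<close>, and a unit \<open>y\<close> gives \<open>z\<close> as
      \<open>- (n / t) / y\<close>.\<close>
    define x where "x = z / \<iota> t"
    define y where "y = 1 - x"
    have "x * x = 1 * x + \<iota> (n / t * (1 / t))"
    proof -
      have "x * x = (z * z) / (\<iota> t * \<iota> t)" by (simp add: x_def)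
      also have "\<dots> = x + \<iota> n / (\<iota> t * \<iota> t)" unfolding eq using t(1) by (simp add: x_def field_simps)
      finally show ?thesis by simp
    qed
    moreover have "\<iota> (n / t * (1 / t)) \<in> R"
      using t val_ge_quotient[of n t] val_ge_quotient[of 1 t] by (intro R_emb v.ge_mult0) auto
    ultimately have x: "x \<in> R" using R_integral R_1 by blast
    then have "y \<in> R" using R_diff R_1 by (simp add: y_def)
    then have "unit_R x \<or> unit_R y" using sum_one_unit[of x y] x by (simp add: y_def)
    then show ?thesis
    proof
      assume "unit_R x"
      then have "inverse x * \<iota> (1 / t) \<in> R"
        using t val_ge_quotient[of 1 t] unfolding unit_R_def by (auto intro!: R_mult R_emb simp del: emb_divide)
      moreover have "inverse x * \<iota> (1 / t) = inverse z" using t(1) assms by (simp add: x_def inverse_eq_divide)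
      ultimately show ?thesis by simp
    next
      assume "unit_R y"
      then have "- (inverse y * \<iota> (n / t)) \<in> R"
        using t val_ge_quotient[of n t] unfolding unit_R_def
        by (auto intro!: R_mult R_emb R_uminus simp del: emb_divide)
      moreover have "\<iota> n = - (y * \<iota> t * z)"
        using eq t(1) by (simp add: y_def x_def algebra_simps)
      then have "- (inverse y * \<iota> (n / t)) = z" using t(1) \<open>unit_R y\<close> by (simp add: unit_R_def)
      ultimately show ?thesis by simp
    qed
  qed
qed

section \<open>The value group and the extended valuation\<close>

private lemma R_base: "\<iota> a \<in> R \<longleftrightarrow> val_ge v a 0"
proof
  assume a: "\<iota> a \<in> R"
  show "val_ge v a 0"
  proof (rule ccontr)
    assume "\<not> val_ge v a 0"
    then have na: "a \<noteq> 0" "v a < 0" by (auto simp: val_ge_def)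
    then have "val_ge v (1 / (a * p)) 0"
      using p_nz vp v.divide[of 1 "a * p"] v.mult[of a p] by (simp add: val_ge_def)
    then have "\<iota> a * \<iota> (1 / (a * p)) \<in> R" using a R_emb R_mult by blast
    moreover have "\<iota> a * \<iota> (1 / (a * p)) = inverse (\<iota> p)" using na(1) p_nz by (simp add: field_simps)
    ultimately show False using R_inv by simp
  qed
qed (rule R_emb)

text \<open>Equality of values for the valuation ring \<open>R\<close>, that is, equality in the
  multiplicative group modulo the units of \<open>R\<close>; the value group itself is never
  formed.\<close>

private definition assoc :: "'b \<Rightarrow> 'b \<Rightarrow> bool" where
  "assoc a b \<longleftrightarrow> a \<noteq> 0 \<and> b \<noteq> 0 \<and> unit_R (a / b)"

private lemma assoc_sym: "assoc a b \<Longrightarrow> assoc b a"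
  using unit_inverse[of "a / b"] by (simp add: assoc_def)

private lemma assoc_trans: "assoc a b \<Longrightarrow> assoc b c \<Longrightarrow> assoc a c"
  using unit_mult[of "a / b" "b / c"] by (simp add: assoc_def)

private lemma assoc_mult: "assoc a b \<Longrightarrow> assoc c d \<Longrightarrow> assoc (a * c) (b * d)"
  using unit_mult[of "a / b" "c / d"] by (simp add: assoc_def)

private lemma assoc_base:
  assumes "a \<noteq> 0"
  shows "assoc (\<iota> a) (\<iota> p powi v a)"
proof -
  have "v (a / p powi v a) = 0"
    using v.divide[of a "p powi v a"] assms p_nz vp by (simp add: v.power_int)
  then have "unit_R (\<iota> (a / p powi v a))"
    using assms p_nz v.inverse[of "a / p powi v a"] unfolding unit_R_def emb_inverse[symmetric] R_base
    by (auto simp: val_ge_def simp del: emb_divide)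
  then show ?thesis using assms p_nz by (simp add: assoc_def)
qed

private lemma assoc_power: "assoc (\<iota> p powi m) (\<iota> p powi n) \<longleftrightarrow> m = n"
proof
  assume a: "assoc (\<iota> p powi m) (\<iota> p powi n)"
  have "\<iota> p powi m / \<iota> p powi n = \<iota> (p powi (m - n))"
    using p_nz by (simp add: power_int_diff)
  then have "\<iota> (p powi (m - n)) \<in> R" "\<iota> (inverse (p powi (m - n))) \<in> R"
    using a by (auto simp: assoc_def unit_R_def)
  then show "m = n" unfolding R_base
    using p_nz vp v.inverse[of "p powi (m - n)"] by (auto simp: val_ge_def v.power_int)
next
  assume "m = n"
  then show "assoc (\<iota> p powi m) (\<iota> p powi n)"
    using p_nz R_1 by (simp add: assoc_def unit_R_def)
qed

text \<open>Two of the three terms of a vanishing sum have the same value, so the value of \<open>z\<^sup>2\<close> lies in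
  the value group of the base field.\<close>

private lemma assoc_three_terms:
  assumes "x + y = 1"
  shows "assoc x 1 \<or> assoc y 1 \<or> assoc x y"
proof (cases "x = 0 \<or> y = 0")
  case True
  then show ?thesis using assms R_1 by (auto simp: assoc_def unit_R_def)
next
  case False
  have swap: "assoc x y" if "x + y = 1" "x \<noteq> 0" "y \<noteq> 0" "x \<notin> R" for x y
  proof -
    have ix: "inverse x \<in> R" using R_valuation_ring that by blast
    have nu: "\<not> unit_R (inverse x)" using that by (simp add: unit_R_def)
    have eq: "- (y / x) = 1 - inverse x"
      using that by (simp add: field_simps)
    then have "- (y / x) \<in> R" using ix R_diff R_1 by metis
    then have "unit_R (- (y / x))" using sum_one_unit[of "inverse x" "- (y / x)"] ix nu eq by simp
    then have "unit_R (x / y)"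
      using unit_inverse[of "- (y / x)"] R_uminus[of "- (y / x)"] R_uminus[of "- (x / y)"] that
      by (auto simp: unit_R_def)
    then show ?thesis using that by (simp add: assoc_def)
  qed
  show ?thesis
  proof (cases "x \<in> R \<and> y \<in> R")
    case True
    then show ?thesis using sum_one_unit[of x y] assms False by (auto simp: assoc_def)
  next
    case nR: False
    then show ?thesis using swap[of x y] swap[of y x] assms False assoc_sym by (auto simp: add.commute)
  qed
qed

private lemma square_value:
  assumes "z \<noteq> 0"
  shows "\<exists>!m. assoc (z * z) (\<iota> p powi m)"
proof -
  obtain t n where "z\<^sup>2 = \<iota> t * z + \<iota> n" using quadratic_equation by blast
  then have eq: "z * z = \<iota> t * z + \<iota> n" by (simp add: power2_eq_square)
  have refl: "assoc a a" if "a \<noteq> 0" for a using that R_1 by (simp add: assoc_def unit_R_def)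
  have "\<exists>a. assoc (z * z) (\<iota> a)"
  proof -
    \<comment> \<open>The equation is divided by \<open>z * z\<close>. Equal values of the first
      term and 1 mean that \<open>z\<close> has the value of \<open>t\<close>; for the second term
      and 1, \<open>z * z\<close> has that of \<open>n\<close>; for the two terms, \<open>z\<close>
      has that of \<open>n / t\<close>.\<close>
    have "\<iota> t / z + \<iota> n / (z * z) = (\<iota> t * z + \<iota> n) / (z * z)" using assms by (simp add: field_simps)
    also have "\<dots> = 1" using assms by (simp flip: eq)
    finally consider (1) "assoc (\<iota> t / z) 1" | (2) "assoc (\<iota> n / (z * z)) 1" | (3) "assoc (\<iota> t / z) (\<iota> n / (z * z))"
      using assoc_three_terms by blast
    then show ?thesis
    proof cases
      case 1
      then have "assoc (\<iota> t / z * z) (1 * z)" using assms refl by (intro assoc_mult)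
      then have "assoc z (\<iota> t)" using assms assoc_sym by simp
      then have "assoc (z * z) (\<iota> (t * t))" using assoc_mult by fastforce
      then show ?thesis by blast
    next
      case 2
      then have "assoc (\<iota> n / (z * z) * (z * z)) (1 * (z * z))" using assms refl by (intro assoc_mult) auto
      then have "assoc (z * z) (\<iota> n)" using assms assoc_sym by simp
      then show ?thesis by blast
    next
      case 3
      then have tn: "t \<noteq> 0" "n \<noteq> 0" by (auto simp: assoc_def)
      have "assoc (\<iota> t / z * (z * z / \<iota> t)) (\<iota> n / (z * z) * (z * z / \<iota> t))"
        using 3 assms refl tn by (intro assoc_mult) auto
      then have "assoc z (\<iota> (n / t))" using assms tn by simp
      then have "assoc (z * z) (\<iota> (n / t * (n / t)))" using assoc_mult by fastforce
      then show ?thesis by blast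
    qed
  qed
  then obtain a where a: "assoc (z * z) (\<iota> a)" by blast
  then have "a \<noteq> 0" by (auto simp: assoc_def)
  then have "assoc (z * z) (\<iota> p powi v a)" using a assoc_base assoc_trans by blast
  then show ?thesis using assoc_power assoc_trans assoc_sym by blast
qed

text \<open>Twice the value of \<open>z\<close> on the scale where \<open>p\<close> has value 1.
  Doubling keeps it an integer if the extension ramifies.\<close>

private definition sq_val :: "'b \<Rightarrow> int" where
  "sq_val z = (if z = 0 then 0 else (THE m. assoc (z * z) (\<iota> p powi m)))"

private lemma assoc_sq_val: "z \<noteq> 0 \<Longrightarrow> assoc (z * z) (\<iota> p powi sq_val z)"
  unfolding sq_val_def using theI'[OF square_value] by simp

private lemma sq_valI: "assoc (z * z) (\<iota> p powi m) \<Longrightarrow> sq_val z = m"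
  using assoc_sq_val square_value by (metis assoc_def mult_zero_left)

private lemma sq_val_base: "a \<noteq> 0 \<Longrightarrow> sq_val (\<iota> a) = 2 * v a"
  using assoc_base[of "a * a"] v.mult[of a a] by (intro sq_valI) simp

private lemma sq_val_mult:
  assumes "a \<noteq> 0" "b \<noteq> 0"
  shows "sq_val (a * b) = sq_val a + sq_val b"
proof (rule sq_valI)
  have "assoc (a * a * (b * b)) (\<iota> p powi sq_val a * \<iota> p powi sq_val b)"
    using assms assoc_sq_val by (intro assoc_mult)
  then show "assoc (a * b * (a * b)) (\<iota> p powi (sq_val a + sq_val b))"
    using p_nz by (simp add: power_int_add mult_ac)
qed

private lemma sq_val_nonneg:
  assumes "z \<in> R" "z \<noteq> 0"
  shows "sq_val z \<ge> 0"
proof -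
  have "(\<iota> p powi sq_val z) / (z * z) \<in> R"
    using assoc_sym[OF assoc_sq_val[OF assms(2)]] by (simp add: assoc_def unit_R_def)
  then have "(\<iota> p powi sq_val z) / (z * z) * (z * z) \<in> R"
    using assms(1) by (intro R_mult)
  then have "\<iota> (p powi sq_val z) \<in> R" using assms(2) by simp
  then show ?thesis unfolding R_base using p_nz vp by (auto simp: val_ge_def v.power_int)
qed

private lemma sq_val_valuation: "valuation sq_val"
proof
  have *: "sq_val a \<le> sq_val (a + b) \<and> sq_val a \<le> sq_val b" if "a \<noteq> 0" "b \<noteq> 0" "a + b \<noteq> 0" "b / a \<in> R" for a b
  proof -
    have "(a + b) / a = 1 + b / a" using that by (simp add: field_simps)
    then have "(a + b) / a \<in> R" using that(4) R_add R_1 by metis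
    then have "sq_val ((a + b) / a) \<ge> 0" "sq_val (b / a) \<ge> 0"
      using that by (auto intro: sq_val_nonneg)
    then show ?thesis
      using sq_val_mult[of "(a + b) / a" a] sq_val_mult[of "b / a" a] that by simp
  qed
  fix a b :: 'b assume ab: "a \<noteq> 0" "b \<noteq> 0" "a + b \<noteq> 0"
  then have "b / a \<in> R \<or> a / b \<in> R" using R_valuation_ring[of "b / a"] by auto
  then show "min (sq_val a) (sq_val b) \<le> sq_val (a + b)"
    using *[of a b] *[of b a] ab by (auto simp: add.commute)
qed (simp_all add: sq_val_mult, simp add: sq_val_def)

text \<open>If an odd value occurs, \<open>sq_val\<close> is already normalized and the index is 2;
  otherwise it is halved and the index is 1.\<close>

lemma extension_of_maximal:
  "\<exists>w e. valuation w \<and> (\<exists>z. w z = 1) \<and> lies_over \<iota> v e w"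
proof -
  interpret q: valuation sq_val by (rule sq_val_valuation)
  have base: "sq_val (\<iota> a) = 2 * v a" for a
    using sq_val_base[of a] by (cases "a = 0") simp_all
  show ?thesis
  proof (cases "\<exists>z. odd (sq_val z)")
    case True
    then obtain z where z: "odd (sq_val z)" by blast
    then have z0: "z \<noteq> 0" by auto
    define k where "k = sq_val z div 2"
    have "sq_val (z * \<iota> (p powi (- k))) = sq_val z - 2 * k"
      using q.mult[of z "\<iota> (p powi (- k))"] z0 p_nz vp
      by (simp only: base v.power_int) (simp add: power_int_minus)
    also have "\<dots> = 1" using z by (auto simp: k_def elim: oddE)
    finally have "\<exists>z. sq_val z = 1" by blast
    moreover have "lies_over \<iota> v 2 sq_val" using base by (simp add: lies_over_def)
    ultimately show ?thesis using q.valuation_axioms by blast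
  next
    case False
    define w where "w z = sq_val z div 2" for z
    have w: "sq_val z = 2 * w z" for z using False by (simp add: w_def)
    have "valuation w"
    proof
      show "w 0 = 0" by (simp add: w_def)
      fix a b :: 'b assume ab: "a \<noteq> 0" "b \<noteq> 0"
      show "w (a * b) = w a + w b" using q.mult[OF ab] w by auto
      assume "a + b \<noteq> 0"
      then show "min (w a) (w b) \<le> w (a + b)" using q.add_ge[OF ab] w by (auto simp: min_def split: if_splits)
    qed
    have wv: "w (\<iota> a) = v a" for a using w[of "\<iota> a"] base by simp
    have "w (\<iota> p) = 1" using vp by (simp add: wv)
    moreover have "lies_over \<iota> v 1 w" by (simp add: lies_over_def wv)
    ultimately show ?thesis using \<open>valuation w\<close> by blast
  qed
qed

end

lemma valuation_extends: "\<exists>w e. valuation w \<and> (\<exists>z. w z = 1) \<and> lies_over \<iota> v e w"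
proof -
  obtain R where R: "overring R" "\<And>S. overring S \<Longrightarrow> R \<subseteq> S \<Longrightarrow> S = R"
    using maximal_overring by blast
  show ?thesis by (rule extension_of_maximal[OF R])
qed

end

lemma place_extends:
  assumes "v \<in> places \<kappa>"
  obtains w e where "w \<in> places (\<iota> \<circ> \<kappa>)" "lies_over \<iota> v e w"
proof -
  obtain p where "v p = 1" using places_uniformizer[OF assms] by blast
  then obtain w e z where w: "valuation w" "w z = 1" "lies_over \<iota> v e w"
    using valuation_extends[OF places_valuation[OF assms]] by metis
  then have "w \<in> places (\<iota> \<circ> \<kappa>)"
    using places_const[OF assms] by (intro placesI) (auto simp: lies_over_def)
  then show thesis using that w(3) by blast
qed

end

section \<open>Degrees of places\<close>

text \<open>Invariance of dimension by counting over the finite field: each combination of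
  \<open>B\<close> is congruent to exactly one of \<open>B'\<close>, which embeds the coefficient
  functions on \<open>B\<close> into those on \<open>B'\<close>.\<close>

lemma residue_basis_card_le:
  fixes \<kappa> :: "'k::{field,finite} \<Rightarrow> 'a::field"
  assumes w: "w \<in> places \<kappa>" and B: "residue_basis \<kappa> w B" and B': "residue_basis \<kappa> w B'"
  shows "card B \<le> card B'"
proof -
  interpret valuation w using w by (rule places_valuation)
  let ?\<Phi> = "\<lambda>B c. \<Sum>b\<in>B. \<kappa> (c b) * b"
  let ?E = "\<lambda>B. B \<rightarrow>\<^sub>E (UNIV :: 'k set)"
  have ring: "?\<Phi> B c \<in> place_ring w" for c
    using B unfolding residue_basis_def place_ring_iff
    by (intro ge_sum ge_mult0) (auto simp: val_ge_def places_const[OF w] place_ring_iff)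
  define \<Psi> where "\<Psi> c = (THE c'. c' \<in> ?E B' \<and> ?\<Phi> B c - ?\<Phi> B' c' \<in> place_ideal w)" for c
  have \<Psi>: "\<Psi> c \<in> ?E B'" "?\<Phi> B c - ?\<Phi> B' (\<Psi> c) \<in> place_ideal w" for c
  proof -
    have "\<exists>!c'. c' \<in> ?E B' \<and> ?\<Phi> B c - ?\<Phi> B' c' \<in> place_ideal w"
      using B' ring unfolding residue_basis_def by blast
    from theI'[OF this] show "\<Psi> c \<in> ?E B'" "?\<Phi> B c - ?\<Phi> B' (\<Psi> c) \<in> place_ideal w"
      unfolding \<Psi>_def by blast+
  qed
  have "inj_on \<Psi> (?E B)"
  proof (rule inj_onI)
    fix c d assume c: "c \<in> ?E B" and d: "d \<in> ?E B" and eq: "\<Psi> c = \<Psi> d"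
    have "(?\<Phi> B c - ?\<Phi> B' (\<Psi> c)) - (?\<Phi> B d - ?\<Phi> B' (\<Psi> d)) \<in> place_ideal w"
      using \<Psi>(2)[of c] \<Psi>(2)[of d] unfolding place_ideal_iff by (rule ge_diff)
    then have "?\<Phi> B c - ?\<Phi> B d \<in> place_ideal w" by (simp add: eq)
    moreover have "?\<Phi> B c - ?\<Phi> B c \<in> place_ideal w" by (simp add: place_ideal_iff)
    ultimately show "c = d" using B ring[of c] c d unfolding residue_basis_def by blast
  qed
  moreover have "\<Psi> ` ?E B \<subseteq> ?E B'" using \<Psi>(1) by blast
  moreover have fin: "finite B" "finite B'" using B B' by (auto simp: residue_basis_def)
  then have "finite (?E B')" by (intro finite_PiE) auto
  ultimately have "card (?E B) \<le> card (?E B')" by (rule card_inj_on_le)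
  then have "CARD('k) ^ card B \<le> CARD('k) ^ card B'" using fin by (simp add: card_PiE)
  moreover have "CARD('k) > 1"
    using card_mono[of UNIV "{0, 1 :: 'k}"] by simp
  ultimately show ?thesis by (simp add: power_increasing_iff)
qed

text \<open>Passes from an indexed family to a basis that is a set, as \<open>place_degree\<close>
  requires. The family has no repetitions, because equal members would satisfy a relation with
  coefficients 1 and -1.\<close>

lemma place_degree_eqI:
  fixes \<kappa> :: "'k::{field,finite} \<Rightarrow> 'a::field"
  assumes w: "w \<in> places \<kappa>" and fam: "residue_family \<kappa> w I g"
    and \<kappa>: "\<kappa> 1 = 1" "\<And>a b. \<kappa> (a - b) = \<kappa> a - \<kappa> b"
  shows "place_degree \<kappa> w = card I"
proof -
  interpret valuation w using w by (rule places_valuation)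
  have fin: "finite I" and int: "\<And>i. i \<in> I \<Longrightarrow> val_ge w (g i) 0"
    and span: "\<And>a. val_ge w a 0 \<Longrightarrow> \<exists>c. val_ge w (a - (\<Sum>i\<in>I. \<kappa> (c i) * g i)) 1"
    and indep: "\<And>c i. val_ge w (\<Sum>i\<in>I. \<kappa> (c i) * g i) 1 \<Longrightarrow> i \<in> I \<Longrightarrow> c i = 0"
    using fam unfolding residue_family_def by blast+
  have \<kappa>0: "\<kappa> 0 = 0" using \<kappa>(2)[of 0 0] by simp
  have inj: "inj_on g I"
  proof (rule inj_onI, rule ccontr)
    fix i j assume ij: "i \<in> I" "j \<in> I" "g i = g j" "i \<noteq> j"
    let ?c = "\<lambda>l. (if l = i then 1 else 0) - (if l = j then 1 else 0 :: 'k)"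
    have "(\<Sum>l\<in>I. \<kappa> (?c l) * g l) = (\<Sum>l\<in>I. (if l = i then g l else 0) - (if l = j then g l else 0))"
      by (intro sum.cong refl) (auto simp: \<kappa> \<kappa>0)
    also have "\<dots> = 0" using ij fin by (simp add: sum_subtractf)
    finally have "?c i = 0" using indep[of ?c i] ij by simp
    then show False using ij by simp
  qed
  have reindex: "(\<Sum>b\<in>g ` I. \<kappa> (c b) * b) = (\<Sum>i\<in>I. \<kappa> (c (g i)) * g i)" for c
    using inj by (simp add: sum.reindex)
  have basis: "residue_basis \<kappa> w (g ` I)"
    unfolding residue_basis_def
  proof (intro conjI ballI)
    show "finite (g ` I)" using fin by simp
    show "g ` I \<subseteq> place_ring w" using int by (auto simp: place_ring_iff)
    fix a assume "a \<in> place_ring w"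
    then obtain c where c: "val_ge w (a - (\<Sum>i\<in>I. \<kappa> (c i) * g i)) 1"
      using span by (auto simp: place_ring_iff)
    define c' where "c' = restrict (\<lambda>b. c (inv_into I g b)) (g ` I)"
    show "\<exists>!c. c \<in> g ` I \<rightarrow>\<^sub>E UNIV \<and> a - (\<Sum>b\<in>g ` I. \<kappa> (c b) * b) \<in> place_ideal w"
    proof (intro ex1I[of _ c'] conjI)
      show "c' \<in> g ` I \<rightarrow>\<^sub>E UNIV" by (simp add: c'_def)
      have "(\<Sum>i\<in>I. \<kappa> (c' (g i)) * g i) = (\<Sum>i\<in>I. \<kappa> (c i) * g i)"
        using inj by (intro sum.cong refl) (simp add: c'_def inv_into_f_f)
      then show "a - (\<Sum>b\<in>g ` I. \<kappa> (c' b) * b) \<in> place_ideal w"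
        unfolding reindex place_ideal_iff using c by simp
      then have c': "val_ge w (a - (\<Sum>i\<in>I. \<kappa> (c' (g i)) * g i)) 1"
        unfolding reindex place_ideal_iff .
      fix d assume d: "d \<in> g ` I \<rightarrow>\<^sub>E UNIV \<and> a - (\<Sum>b\<in>g ` I. \<kappa> (d b) * b) \<in> place_ideal w"
      then have "val_ge w (a - (\<Sum>i\<in>I. \<kappa> (d (g i)) * g i)) 1"
        unfolding reindex place_ideal_iff by blast
      from ge_diff[OF c' this]
      have "val_ge w (\<Sum>i\<in>I. \<kappa> (d (g i) - c' (g i)) * g i) 1"
        by (simp add: \<kappa> left_diff_distrib sum_subtractf)
      then have eq: "d (g i) = c' (g i)" if "i \<in> I" for i
        using indep[of "\<lambda>i. d (g i) - c' (g i)" i] that by simp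
      show "d = c'"
      proof
        fix b show "d b = c' b"
        proof (cases "b \<in> g ` I")
          case True
          then show ?thesis using eq by blast
        next
          case False
          then show ?thesis using d by (auto simp: c'_def PiE_def extensional_def)
        qed
      qed
    qed
  qed
  show ?thesis
    unfolding place_degree_def
  proof (rule the_equality)
    show "\<exists>B. residue_basis \<kappa> w B \<and> card B = card I"
      using basis card_image[OF inj] by blast
    fix n assume "\<exists>B. residue_basis \<kappa> w B \<and> card B = n"
    then show "n = card I"
      using residue_basis_card_le[OF w _ basis] residue_basis_card_le[OF w basis] card_image[OF inj]
      by (metis le_antisym)
  qed
qed

section \<open>Quadratic function fields with a ramified infinite place\<close>

locale quadratic_function_field = quadratic_extension \<iota> \<sigma>
  for \<iota> :: "'k::{field,finite} poly fract \<Rightarrow> 'K::field" and \<sigma> +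
  fixes v_inf :: "'k poly fract \<Rightarrow> int" and w_inf :: "'K \<Rightarrow> int"
  assumes v_inf: "v_inf \<in> places ratfun_const" "v_inf ratfun_x < 0"
    and w_inf: "w_inf \<in> places (\<iota> \<circ> ratfun_const)" "lies_over \<iota> v_inf 2 w_inf"
begin

definition \<kappa> :: "'k \<Rightarrow> 'K" where
  "\<kappa> = \<iota> \<circ> ratfun_const"

lemma \<kappa>_1 [simp]: "\<kappa> 1 = 1"
  and \<kappa>_diff: "\<kappa> (a - b) = \<kappa> a - \<kappa> b"
  and \<kappa>_mult: "\<kappa> (a * b) = \<kappa> a * \<kappa> b"
  and \<kappa>_eq_0_iff [simp]: "\<kappa> a = 0 \<longleftrightarrow> a = 0"
  and conj_\<kappa> [simp]: "\<sigma> (\<kappa> a) = \<kappa> a"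
proof -
  have "\<kappa> (a - b) = \<iota> (ratfun_const a - ratfun_const b)" by (simp add: \<kappa>_def ratfun_const_def)
  then show "\<kappa> (a - b) = \<kappa> a - \<kappa> b" by (simp add: \<kappa>_def)
  have "\<kappa> (a * b) = \<iota> (ratfun_const a * ratfun_const b)" by (simp add: \<kappa>_def ratfun_const_def mult.commute)
  then show "\<kappa> (a * b) = \<kappa> a * \<kappa> b" by (simp add: \<kappa>_def)
  have "ratfun_const (1 :: 'k) = 1" by (simp add: ratfun_const_def fract_collapse flip: one_pCons)
  then show "\<kappa> 1 = 1" by (simp add: \<kappa>_def)
qed (simp_all add: \<kappa>_def)

lemma \<kappa>_0 [simp]: "\<kappa> 0 = 0"
  by simp

lemma \<kappa>_uminus: "\<kappa> (- a) = - \<kappa> a"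
  using \<kappa>_diff[of 0 a] by simp

lemma \<kappa>_2: "\<kappa> 2 = 2"
  using \<kappa>_diff[of 1 "- 1"] by (simp add: \<kappa>_uminus)

abbreviation K_places :: "('K \<Rightarrow> int) set" where
  "K_places \<equiv> places \<kappa>"

lemma K_places_def: "K_places = places (\<iota> \<circ> ratfun_const)"
  by (simp add: \<kappa>_def)

lemma w_inf_place: "w_inf \<in> K_places"
  using w_inf by (simp add: K_places_def)

lemma lies_over_unique:
  assumes "lies_over \<iota> v e w" "lies_over \<iota> v' e' w" "v \<in> places \<kappa>'" "v' \<in> places \<kappa>''"
  shows "v = v'" "e = e'"
proof -
  have eq: "int e * v a = int e' * v' a" and pos: "e \<ge> 1" for a
    using assms by (auto simp: lies_over_def)
  obtain a b where "v a = 1" "v' b = 1"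
    using places_uniformizer[OF assms(3)] places_uniformizer[OF assms(4)] by blast
  then have "int e' dvd int e" "int e dvd int e'"
    using eq[of a] eq[of b] by (metis dvd_triv_left mult.right_neutral)+
  then show e: "e = e'" by (simp add: dvd_antisym)
  show "v = v'" using eq pos by (simp add: e fun_eq_iff)
qed

lemma place_below:
  assumes "w \<in> K_places"
  obtains v e where "v \<in> places ratfun_const" "lies_over \<iota> v e w" "e = 1 \<or> e = 2"
proof -
  obtain v e where v: "v \<in> places ratfun_const" "lies_over \<iota> v e w"
    using restrict_place assms unfolding K_places_def by blast
  obtain p where "w p = 1" using places_uniformizer[OF assms] by blast
  then have "e \<le> 2" using ramification_le_2[OF places_valuation[OF assms] _ v(2)] by blast
  moreover have "e \<ge> 1" using v(2) by (simp add: lies_over_def)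
  ultimately show thesis using that[OF v] by linarith
qed

lemma conj_place: "w \<in> K_places \<Longrightarrow> w \<circ> \<sigma> \<in> K_places"
  unfolding K_places_def by (rule places_conj)

lemma conj_place_lies_over: "lies_over \<iota> v e w \<Longrightarrow> lies_over \<iota> v e (w \<circ> \<sigma>)"
  by (simp add: lies_over_def)

lemma comp_conj_conj [simp]: "w \<circ> \<sigma> \<circ> \<sigma> = w"
  by (simp add: fun_eq_iff)

lemma places_over:
  assumes "w \<in> K_places" "w' \<in> K_places" "lies_over \<iota> v e w" "lies_over \<iota> v e' w'"
  shows "w' = w \<or> w' = w \<circ> \<sigma>"
proof -
  obtain p p' where "w p = 1" "w' p' = 1"
    using places_uniformizer[OF assms(1)] places_uniformizer[OF assms(2)] by blast
  then show ?thesis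
    using conjugate_places[OF places_valuation[OF assms(1)] _ places_valuation[OF assms(2)] _ assms(3,4)] by blast
qed

text \<open>A place moved by \<sigma> splits, and a split place has index 1.\<close>

lemma ramified_conj:
  assumes "w \<in> K_places" "lies_over \<iota> v 2 w"
  shows "w \<circ> \<sigma> = w"
proof (rule ccontr)
  assume n: "w \<circ> \<sigma> \<noteq> w"
  obtain p where "w p = 1" using places_uniformizer[OF assms(1)] by blast
  from split_place(1)[OF places_valuation[OF assms(1)] this assms(2) n] show False by simp
qed

lemma ramified_place_unique:
  "w \<in> K_places \<Longrightarrow> w' \<in> K_places \<Longrightarrow> lies_over \<iota> v 2 w \<Longrightarrow> lies_over \<iota> v e w' \<Longrightarrow> w' = w"
  using places_over ramified_conj by metis

lemma w_inf_conj [simp]: "w_inf (\<sigma> z) = w_inf z"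
  using ramified_conj[OF w_inf_place w_inf(2)] by (metis comp_apply)

lemma w_inf_conj' [simp]: "w_inf \<circ> \<sigma> = w_inf"
  by (simp add: fun_eq_iff)

lemma conj_eq_w_inf_iff [simp]: "w \<circ> \<sigma> = w_inf \<longleftrightarrow> w = w_inf"
  by (metis comp_conj_conj w_inf_conj')

text \<open>A ramified place has a single place above it, so removing \<open>w_inf\<close> leaves
  exactly the places above the finite ones.\<close>

definition fin_K_places :: "('K \<Rightarrow> int) set" where
  "fin_K_places = K_places - {w_inf}"

lemma conj_fin_place: "w \<in> fin_K_places \<Longrightarrow> w \<circ> \<sigma> \<in> fin_K_places"
  by (auto simp: fin_K_places_def intro: conj_place)

lemma fin_place_below:
  assumes "w \<in> fin_K_places"
  obtains v e where "v \<in> finite_places" "lies_over \<iota> v e w" "e = 1 \<or> e = 2"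
proof -
  have w: "w \<in> K_places" "w \<noteq> w_inf" using assms by (auto simp: fin_K_places_def)
  obtain v e where v: "v \<in> places ratfun_const" "lies_over \<iota> v e w" "e = 1 \<or> e = 2"
    using place_below[OF w(1)] by blast
  have "v \<noteq> v_inf" using v(2) w ramified_place_unique[OF w_inf_place w(1) w_inf(2)] by blast
  then have "v \<in> finite_places"
    using infinite_place_unique[OF v(1) _ v_inf] v(1) by (auto simp: finite_places_def not_less)
  then show thesis using that v by blast
qed

lemma v_inf_not_finite: "v_inf \<notin> finite_places"
  using v_inf by (simp add: finite_places_def)

lemma place_above:
  assumes "v \<in> finite_places"
  obtains w e where "w \<in> fin_K_places" "lies_over \<iota> v e w"
proof -
  have v: "v \<in> places ratfun_const" using assms by (simp add: finite_places_def)
  obtain w e where w: "w \<in> K_places" "lies_over \<iota> v e w"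
    using place_extends[OF v] unfolding K_places_def by blast
  have "w \<noteq> w_inf"
    using lies_over_unique(1)[OF w(2) _ v v_inf(1)] w_inf(2) assms v_inf_not_finite by blast
  then show thesis using that w by (auto simp: fin_K_places_def)
qed

lemma place_degree_1_residue:
  assumes w: "w \<in> K_places" and v: "v \<in> finite_places" "lies_over \<iota> v e w"
    and res: "\<And>u. val_ge w u 0 \<Longrightarrow> \<exists>a. val_ge w (u - \<iota> a) 1"
  shows "place_degree \<kappa> w = degree (place_poly v)"
proof -
  interpret valuation w using w by (rule places_valuation)
  obtain p where p: "w p = 1" using places_uniformizer[OF w] by blast
  note ge = val_ge_emb[OF valuation_axioms p v(2)] val_ge_emb_1[OF valuation_axioms p v(2)]
  let ?I = "{..<degree (place_poly v)}"
  have fam: "residue_family ratfun_const v ?I (\<lambda>i. ratfun_x ^ i)"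
    using finite_place_residue_family[OF v(1)] .
  have sum: "(\<Sum>i\<in>?I. \<kappa> (c i) * \<iota> (ratfun_x ^ i)) = \<iota> (\<Sum>i\<in>?I. ratfun_const (c i) * ratfun_x ^ i)" for c
    by (simp add: \<kappa>_def)
  have "residue_family \<kappa> w ?I (\<lambda>i. \<iota> (ratfun_x ^ i))"
    unfolding residue_family_def sum
  proof (intro conjI ballI allI impI)
    fix i assume "i \<in> ?I"
    then show "val_ge w (\<iota> (ratfun_x ^ i)) 0"
      using fam unfolding ge residue_family_def by blast
  next
    fix u assume u: "val_ge w u 0"
    obtain a where a: "val_ge w (u - \<iota> a) 1" using res[OF u] by blast
    have "val_ge w (u - (u - \<iota> a)) 0" by (rule ge_diff[OF u val_ge_mono[OF a]]) simp
    then have "val_ge v a 0" by (simp add: ge)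
    then obtain c where c: "val_ge v (a - (\<Sum>i\<in>?I. ratfun_const (c i) * ratfun_x ^ i)) 1"
      using fam unfolding residue_family_def by blast
    have "val_ge w ((u - \<iota> a) + \<iota> (a - (\<Sum>i\<in>?I. ratfun_const (c i) * ratfun_x ^ i))) 1"
      using a c ge by (intro ge_add) blast+
    then have "val_ge w (u - \<iota> (\<Sum>i\<in>?I. ratfun_const (c i) * ratfun_x ^ i)) 1" by simp
    then show "\<exists>c. val_ge w (u - \<iota> (\<Sum>i\<in>?I. ratfun_const (c i) * ratfun_x ^ i)) 1" by blast
  next
    fix c i assume "val_ge w (\<iota> (\<Sum>i\<in>?I. ratfun_const (c i) * ratfun_x ^ i)) 1" "i \<in> ?I"
    then show "c i = 0" using fam unfolding ge residue_family_def by blast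
  qed simp
  from place_degree_eqI[OF w this] show ?thesis by (simp add: \<kappa>_diff)
qed

text \<open>The residues of 1 and \<open>u\<close> form a basis over the residue field of
  \<open>v\<close>. Multiplied with the powers of \<open>x\<close> they give a basis over the
  constants, indexed by two copies of the old index set.\<close>

lemma place_degree_2_residue:
  assumes w: "w \<in> K_places" and v: "v \<in> finite_places" "lies_over \<iota> v e w"
    and u: "val_ge w u 0" "\<And>a. \<not> val_ge w (u - \<iota> a) 1"
  shows "place_degree \<kappa> w = 2 * degree (place_poly v)"
proof -
  interpret valuation w using w by (rule places_valuation)
  obtain p where p: "w p = 1" using places_uniformizer[OF w] by blast
  note ge = val_ge_emb[OF valuation_axioms p v(2)] val_ge_emb_1[OF valuation_axioms p v(2)]
  note comb = integral_combination[OF valuation_axioms p v(2) u]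
  let ?I = "{..<degree (place_poly v)}"
  let ?g = "case_sum (\<lambda>i. \<iota> (ratfun_x ^ i)) (\<lambda>i. \<iota> (ratfun_x ^ i) * u)"
  let ?s = "\<lambda>c. \<Sum>i\<in>?I. ratfun_const (c i) * ratfun_x ^ i"
  have fam: "residue_family ratfun_const v ?I (\<lambda>i. ratfun_x ^ i)"
    using finite_place_residue_family[OF v(1)] .
  have sum: "(\<Sum>i\<in>?I <+> ?I. \<kappa> (c i) * ?g i) = \<iota> (?s (c \<circ> Inl)) + \<iota> (?s (c \<circ> Inr)) * u" for c
    by (subst sum.Plus) (simp_all add: \<kappa>_def sum_distrib_right mult.assoc)
  have u_notin: "u \<notin> range \<iota>"
  proof
    assume "u \<in> range \<iota>"
    then obtain a where "u = \<iota> a" by blast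
    then show False using u(2)[of a] by simp
  qed
  have "residue_family \<kappa> w (?I <+> ?I) ?g"
    unfolding residue_family_def sum
  proof (intro conjI ballI allI impI)
    have x: "val_ge w (\<iota> (ratfun_x ^ i)) 0" if "i \<in> ?I" for i
      using that fam unfolding ge residue_family_def by blast
    fix i assume "i \<in> ?I <+> ?I"
    then show "val_ge w (?g i) 0" using x u(1) by (auto intro!: ge_mult0 simp del: emb_power)
  next
    fix z assume z: "val_ge w z 0"
    obtain a b where ab: "z = \<iota> a + \<iota> b * u" using base_plus_multiple[OF u_notin] by blast
    then have "val_ge v a 0" "val_ge v b 0" using comb[of a b 0] z ge by auto
    then obtain c d where cd: "val_ge v (a - ?s c) 1" "val_ge v (b - ?s d) 1"
      using fam unfolding residue_family_def by meson
    then have "val_ge w (\<iota> (a - ?s c) + u * \<iota> (b - ?s d)) 1"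
      using ge u(1) by (intro ge_add ge_mult0) blast+
    then have "val_ge w (z - (\<iota> (?s (case_sum c d \<circ> Inl)) + \<iota> (?s (case_sum c d \<circ> Inr)) * u)) 1"
      by (simp add: ab algebra_simps)
    then show "\<exists>c. val_ge w (z - (\<iota> (?s (c \<circ> Inl)) + \<iota> (?s (c \<circ> Inr)) * u)) 1" by blast
  next
    fix c i assume c: "val_ge w (\<iota> (?s (c \<circ> Inl)) + \<iota> (?s (c \<circ> Inr)) * u) 1" and i: "i \<in> ?I <+> ?I"
    have "val_ge v (?s (c \<circ> Inl)) 1" "val_ge v (?s (c \<circ> Inr)) 1"
      using comb[OF c] ge by blast+
    then have "(c \<circ> Inl) j = 0" "(c \<circ> Inr) j = 0" if "j \<in> ?I" for j
      using fam that unfolding residue_family_def by blast+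
    then show "c i = 0" using i by auto
  qed simp
  from place_degree_eqI[OF w this] show ?thesis by (simp add: \<kappa>_diff card_Plus)
qed

text \<open>Ramification leaves the residue field unchanged, and at the infinite place of
  \<open>k(x)\<close> it consists of the constants.\<close>

lemma w_inf_residue:
  assumes "val_ge w_inf u 0"
  shows "\<exists>c. val_ge w_inf (u - \<kappa> c) 1"
proof -
  interpret valuation w_inf using w_inf_place by (rule places_valuation)
  obtain p where p: "w_inf p = 1" using places_uniformizer[OF w_inf_place] by blast
  note ge = val_ge_emb[OF valuation_axioms p w_inf(2)] val_ge_emb_1[OF valuation_axioms p w_inf(2)]
  obtain a where a: "val_ge w_inf (u - \<iota> a) 1"
    using residue_of_ramified[OF valuation_axioms p w_inf(2) _ assms] by blast
  have "val_ge w_inf (u - (u - \<iota> a)) 0" by (rule ge_diff[OF assms val_ge_mono[OF a]]) simp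
  then have "val_ge v_inf a 0" by (simp add: ge)
  then obtain c where "val_ge v_inf (a - ratfun_const c) 1" using infinite_place_residue[OF v_inf] by blast
  then have "val_ge w_inf (\<iota> (a - ratfun_const c)) 1" by (simp only: ge)
  from ge_add[OF a this] show ?thesis by (intro exI[of _ c]) (simp add: \<kappa>_def)
qed

lemma place_degree_w_inf: "place_degree \<kappa> w_inf = 1"
proof -
  interpret valuation w_inf using w_inf_place by (rule places_valuation)
  have "residue_family \<kappa> w_inf {()} (\<lambda>_. 1)"
    unfolding residue_family_def
  proof (intro conjI ballI allI impI)
    fix a assume "val_ge w_inf a 0"
    then obtain c where "val_ge w_inf (a - \<kappa> c) 1" using w_inf_residue by blast
    then show "\<exists>c. val_ge w_inf (a - (\<Sum>i\<in>{()}. \<kappa> (c i) * 1)) 1"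
      by (intro exI[of _ "\<lambda>_. c"]) simp
  next
    fix c :: "unit \<Rightarrow> 'k" and i :: unit assume "val_ge w_inf (\<Sum>i\<in>{()}. \<kappa> (c i) * 1) 1"
    then show "c i = 0" using places_const[OF w_inf_place] by (auto simp: val_ge_def)
  qed (simp_all add: val_ge_def)
  from place_degree_eqI[OF w_inf_place this] show ?thesis by (simp add: \<kappa>_diff)
qed

lemma value_place_poly:
  assumes w: "w \<in> fin_K_places" and v: "v \<in> finite_places" "lies_over \<iota> v e w" and w': "w' \<in> fin_K_places"
  shows "w' (\<iota> (poly_fract (place_poly v))) = int e * of_bool (w' = w \<or> w' = w \<circ> \<sigma>)"
proof -
  obtain v' e' where v': "v' \<in> finite_places" "lies_over \<iota> v' e' w'"
    using fin_place_below[OF w'] by blast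
  have K: "w \<in> K_places" "w' \<in> K_places" using w w' by (auto simp: fin_K_places_def)
  have P: "v \<in> places ratfun_const" "v' \<in> places ratfun_const" using v v' by (auto simp: finite_places_def)
  have val: "w' (\<iota> (poly_fract (place_poly v))) = int e' * of_bool (v' = v)"
    using v'(2) place_poly_value[OF v(1) v'(1)] by (simp add: lies_over_def)
  show ?thesis
  proof (cases "w' = w \<or> w' = w \<circ> \<sigma>")
    case True
    then have "lies_over \<iota> v e w'" using v(2) conj_place_lies_over by blast
    then have "v = v'" "e = e'" using lies_over_unique[OF _ v'(2) P] by blast+
    then show ?thesis using True val by simp
  next
    case False
    then have "v' \<noteq> v" using places_over[OF K v(2)] v'(2) by blast
    then show ?thesis using False val by simp
  qed
qed

lemma w_inf_place_poly:
  assumes "g \<noteq> 0"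
  shows "w_inf (\<iota> (poly_fract g)) = - 2 * int (degree g)"
  using infinite_place_value[OF v_inf assms] w_inf(2) by (simp add: lies_over_def)

lemma ramified_place_degree:
  assumes "w \<in> fin_K_places" "v \<in> finite_places" "lies_over \<iota> v 2 w"
  shows "place_degree \<kappa> w = degree (place_poly v)"
proof -
  have w: "w \<in> K_places" using assms(1) by (simp add: fin_K_places_def)
  obtain p where "w p = 1" using places_uniformizer[OF w] by blast
  from residue_of_ramified[OF places_valuation[OF w] this assms(3)]
  show ?thesis by (intro place_degree_1_residue[OF w assms(2,3)]) simp
qed

text \<open>The element is the norm of the place \<open>w\<close>: the polynomial below
  \<open>w\<close>, raised to the residue degree. A split place contributes together with its
  conjugate and a ramified one with index 2; for an inert place the polynomial is squared, and the
  degree doubles with it.\<close>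

lemma norm_divisor:
  assumes sep: "\<exists>y. \<sigma> y \<noteq> y" and w: "w \<in> fin_K_places"
  shows "\<exists>a. a \<noteq> 0 \<and> w_inf (\<iota> a) = - 2 * int (place_degree \<kappa> w) \<and>
    (\<forall>w'\<in>fin_K_places. w' (\<iota> a) = of_bool (w' = w) + of_bool (w' = w \<circ> \<sigma>))"
proof -
  obtain v e where v: "v \<in> finite_places" "lies_over \<iota> v e w" "e = 1 \<or> e = 2"
    using fin_place_below[OF w] by blast
  have wK: "w \<in> K_places" using w by (simp add: fin_K_places_def)
  then interpret valuation w by (rule places_valuation)
  obtain p where p: "w p = 1" using places_uniformizer[OF wK] by blast
  let ?p = "poly_fract (place_poly v)"
  note val = value_place_poly[OF w v(1,2)]
  have p0: "?p \<noteq> 0" using place_poly(1)[OF v(1)] by simp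
  have inf: "w_inf (\<iota> ?p) = - 2 * int (degree (place_poly v))"
    using w_inf_place_poly[OF place_poly(1)[OF v(1)]] .
  consider (split) "w \<circ> \<sigma> \<noteq> w" | (ram) "w \<circ> \<sigma> = w" "e = 2" | (inert) "w \<circ> \<sigma> = w" "e = 1"
    using v(3) by blast
  then show ?thesis
  proof cases
    case split
    note s = split_place[OF valuation_axioms p v(2) split]
    have "place_degree \<kappa> w = degree (place_poly v)"
      using s(2) by (rule place_degree_1_residue[OF wK v(1,2)])
    moreover have "w' (\<iota> ?p) = of_bool (w' = w) + of_bool (w' = w \<circ> \<sigma>)" if "w' \<in> fin_K_places" for w'
      using val[OF that] s(1) split by (auto simp: of_bool_def)
    ultimately show ?thesis using inf p0 by (intro exI[of _ ?p]) auto
  next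
    case ram
    then have "place_degree \<kappa> w = degree (place_poly v)"
      using ramified_place_degree[OF w v(1)] v(2) by blast
    moreover have "w' (\<iota> ?p) = of_bool (w' = w) + of_bool (w' = w \<circ> \<sigma>)" if "w' \<in> fin_K_places" for w'
      using val[OF that] ram by (auto simp: of_bool_def)
    ultimately show ?thesis using inf p0 by (intro exI[of _ ?p]) auto
  next
    case inert
    obtain c where "v c = 1" using place_poly(2)[OF v(1)] by blast
    then obtain u where "val_ge w u 0" "\<And>a. \<not> val_ge w (u - \<iota> a) 1"
      using inert_place[OF valuation_axioms p v(2) inert(1) sep inert(2)] by blast
    then have d: "place_degree \<kappa> w = 2 * degree (place_poly v)"
      by (rule place_degree_2_residue[OF wK v(1,2)])
    have sq: "w' (\<iota> (?p * ?p)) = 2 * w' (\<iota> ?p)" if "w' \<in> K_places" for w'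
      unfolding emb_mult using valuation.mult[OF places_valuation[OF that], of "\<iota> ?p" "\<iota> ?p"] p0 by simp
    have "w' (\<iota> (?p * ?p)) = of_bool (w' = w) + of_bool (w' = w \<circ> \<sigma>)" if "w' \<in> fin_K_places" for w'
      using sq[of w'] val[OF that] inert that by (auto simp: of_bool_def fin_K_places_def)
    moreover have "w_inf (\<iota> (?p * ?p)) = - 2 * int (place_degree \<kappa> w)"
      using sq[OF w_inf_place] inf d by simp
    moreover have "?p * ?p \<noteq> 0" by (metis p0 mult_eq_0_iff)
    ultimately show ?thesis by blast
  qed
qed

end

section \<open>Two-torsion divisor classes\<close>

abbreviation lookup :: "('a \<Rightarrow>\<^sub>0 int) \<Rightarrow> 'a \<Rightarrow> int" where
  "lookup \<equiv> Poly_Mapping.lookup"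

abbreviation keys :: "('a \<Rightarrow>\<^sub>0 int) \<Rightarrow> 'a set" where
  "keys \<equiv> Poly_Mapping.keys"

section \<open>Degrees and principal divisors\<close>

lemma divisor_degree_superset:
  assumes "finite S" "keys D \<subseteq> S"
  shows "divisor_degree \<kappa> D = (\<Sum>v\<in>S. lookup D v * int (place_degree \<kappa> v))"
  unfolding divisor_degree_def using assms
  by (intro sum.mono_neutral_left) (auto simp: in_keys_iff)

lemma divisor_degree_add: "divisor_degree \<kappa> (D + E) = divisor_degree \<kappa> D + divisor_degree \<kappa> E"
proof -
  let ?S = "keys D \<union> keys E"
  have "keys (D + E) \<subseteq> ?S" by (rule Poly_Mapping.keys_add)
  then show ?thesis
    by (subst (1 2 3) divisor_degree_superset[of ?S])
      (auto simp: lookup_add distrib_right sum.distrib)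
qed

lemma divisor_degree_diff: "divisor_degree \<kappa> (D - E) = divisor_degree \<kappa> D - divisor_degree \<kappa> E"
  using divisor_degree_add[of \<kappa> "D - E" E] by simp

lemma divisor_degree_single: "divisor_degree \<kappa> (Poly_Mapping.single v n) = n * int (place_degree \<kappa> v)"
  by (simp add: divisor_degree_def)

lemma divisor_degree_sum: "divisor_degree \<kappa> (sum D S) = (\<Sum>i\<in>S. divisor_degree \<kappa> (D i))"
  by (induction S rule: infinite_finite_induct) (simp_all add: divisor_degree_add, simp_all add: divisor_degree_def)

lemma principal_divisors_iff:
  "D \<in> principal_divisors \<kappa> \<longleftrightarrow> keys D \<subseteq> places \<kappa> \<and>
     (\<exists>f. f \<noteq> 0 \<and> (\<forall>w\<in>places \<kappa>. lookup D w = w f))"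
  by (simp add: principal_divisors_def)

lemma principal_divisors_0: "0 \<in> principal_divisors \<kappa>"
  unfolding principal_divisors_iff
  using valuation.one[OF places_valuation] by (auto intro!: exI[of _ 1])

lemma principal_divisors_diff:
  assumes "D \<in> principal_divisors \<kappa>" "E \<in> principal_divisors \<kappa>"
  shows "D - E \<in> principal_divisors \<kappa>"
proof -
  obtain f g where f: "f \<noteq> 0" "\<And>w. w \<in> places \<kappa> \<Longrightarrow> lookup D w = w f"
    and g: "g \<noteq> 0" "\<And>w. w \<in> places \<kappa> \<Longrightarrow> lookup E w = w g"
    using assms unfolding principal_divisors_iff by blast
  have "lookup (D - E) w = w (f / g)" if "w \<in> places \<kappa>" for w
    using f g that valuation.divide[OF places_valuation[OF that], of f g] by (simp add: lookup_minus)
  moreover have "keys (D - E) \<subseteq> places \<kappa>"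
    using assms keys_diff[of D E] unfolding principal_divisors_iff by blast
  ultimately show ?thesis unfolding principal_divisors_iff using f(1) g(1) by (auto intro!: exI[of _ "f / g"])
qed

lemma principal_divisors_add:
  assumes "D \<in> principal_divisors \<kappa>" "E \<in> principal_divisors \<kappa>"
  shows "D + E \<in> principal_divisors \<kappa>"
  using principal_divisors_diff[OF assms(1) principal_divisors_diff[OF principal_divisors_0 assms(2)]]
  by simp

context quadratic_function_field
begin

section \<open>Supports, constants and divisors of ramified places\<close>

lemma valuation_comp_emb: "valuation w \<Longrightarrow> valuation (w \<circ> \<iota>)"
proof -
  assume "valuation w"
  then interpret valuation w .
  show ?thesis
  proof
    fix a b :: "'k poly fract" assume "a \<noteq> 0" "b \<noteq> 0" "a + b \<noteq> 0"
    then show "min ((w \<circ> \<iota>) a) ((w \<circ> \<iota>) b) \<le> (w \<circ> \<iota>) (a + b)"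
      using add_ge[of "\<iota> a" "\<iota> b"] emb_eq_0_iff[of "a + b"] by simp
  qed (simp_all add: mult)
qed

lemma finite_support_base:
  assumes "a \<noteq> 0"
  shows "finite {w \<in> K_places. w (\<iota> a) \<noteq> 0}"
proof -
  let ?A = "\<lambda>v. {w \<in> K_places. \<exists>e. lies_over \<iota> v e w}"
  have "finite (?A v)" for v
  proof (cases "?A v = {}")
    case False
    then obtain w where w: "w \<in> ?A v" by blast
    then have "?A v \<subseteq> {w, w \<circ> \<sigma>}" using places_over[of w] by blast
    then show ?thesis by (rule finite_subset) simp
  qed (simp only: finite.emptyI)
  then have "finite (insert w_inf (\<Union>v\<in>{v \<in> finite_places. v a \<noteq> 0}. ?A v))"
    using finite_place_support[of a] by (intro finite.insertI finite_UN_I) auto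
  moreover have "{w \<in> K_places. w (\<iota> a) \<noteq> 0} \<subseteq> insert w_inf (\<Union>v\<in>{v \<in> finite_places. v a \<noteq> 0}. ?A v)"
  proof
    fix w assume w: "w \<in> {w \<in> K_places. w (\<iota> a) \<noteq> 0}"
    show "w \<in> insert w_inf (\<Union>v\<in>{v \<in> finite_places. v a \<noteq> 0}. ?A v)"
    proof (cases "w = w_inf")
      case False
      then have "w \<in> fin_K_places" using w by (simp add: fin_K_places_def)
      then obtain v e where "v \<in> finite_places" "lies_over \<iota> v e w"
        by (rule fin_place_below)
      then show ?thesis using w by (auto simp: lies_over_def)
    qed simp
  qed
  ultimately show ?thesis by (rule rev_finite_subset)
qed

text \<open>Where both coefficients of the quadratic equation have value 0, \<open>f\<close> and
  \<open>f - \<iota> t\<close> are integral with product \<open>\<iota> n\<close>, so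
  \<open>f\<close> is a unit. If \<open>n = 0\<close>, then \<open>f\<close> is
  \<open>\<iota> t\<close> itself.\<close>

lemma finite_support: "finite {w \<in> K_places. w f \<noteq> 0}"
proof (cases "f = 0")
  case True
  then have "{w \<in> K_places. w f \<noteq> 0} = {}" using valuation.zero[OF places_valuation] by blast
  then show ?thesis by (simp only: finite.emptyI)
next
  case False
  obtain t n where eq: "f\<^sup>2 = \<iota> t * f + \<iota> n" using quadratic_equation by blast
  have base: "finite {w \<in> K_places. w (\<iota> a) \<noteq> 0}" for a
  proof (cases "a = 0")
    case True
    then have "{w \<in> K_places. w (\<iota> a) \<noteq> 0} = {}" using valuation.zero[OF places_valuation] by auto
    then show ?thesis by (simp only: finite.emptyI)
  qed (rule finite_support_base)
  have "w f = 0" if w: "w \<in> K_places" "w (\<iota> t) = 0" "w (\<iota> n) = 0" for w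
  proof -
    interpret valuation w using w(1) by (rule places_valuation)
    have ge: "val_ge w (\<iota> t) 0" "val_ge w (\<iota> n) 0" using w by (simp_all add: val_ge_def)
    have "f\<^sup>2 + (- \<iota> t) * f + (- \<iota> n) = 0" by (simp add: eq)
    then have wf: "w f \<ge> 0" using unit_root_cases[OF False] ge ge_uminus by blast
    have prod: "f * (f - \<iota> t) = \<iota> n" using eq by (simp add: power2_eq_square algebra_simps)
    show ?thesis
    proof (cases "n = 0")
      case True
      then show ?thesis using prod False w(2) by simp
    next
      case n: False
      then have nz: "f - \<iota> t \<noteq> 0" using prod by auto
      then have "w (f - \<iota> t) \<ge> 0"
        using ge_diff[of f 0 "\<iota> t"] wf ge by (simp add: val_ge_def)
      moreover have "w f + w (f - \<iota> t) = 0" using mult[OF False nz] prod w(3) by simp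
      ultimately show ?thesis using wf by simp
    qed
  qed
  then have "{w \<in> K_places. w f \<noteq> 0} \<subseteq> {w \<in> K_places. w (\<iota> t) \<noteq> 0} \<union> {w \<in> K_places. w (\<iota> n) \<noteq> 0}"
    by blast
  then show ?thesis using base by (meson finite_UnI finite_subset)
qed

definition pdiv :: "'K \<Rightarrow> ('K \<Rightarrow> int) \<Rightarrow>\<^sub>0 int" where
  "pdiv f = Abs_poly_mapping (\<lambda>w. if w \<in> K_places then w f else 0)"

lemma lookup_pdiv: "lookup (pdiv f) w = (if w \<in> K_places then w f else 0)"
proof -
  have "{w. (if w \<in> K_places then w f else 0) \<noteq> 0} = {w \<in> K_places. w f \<noteq> 0}" by auto
  then show ?thesis using finite_support[of f] by (simp add: pdiv_def)
qed

lemma keys_pdiv: "keys (pdiv f) \<subseteq> K_places"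
  by (auto simp: in_keys_iff lookup_pdiv split: if_splits)

lemma pdiv_principal: "f \<noteq> 0 \<Longrightarrow> pdiv f \<in> principal_divisors \<kappa>"
  unfolding principal_divisors_iff using keys_pdiv by (auto simp: lookup_pdiv intro!: exI[of _ f])

text \<open>Integrality at the finite places makes \<open>a\<close> a polynomial, and a polynomial
  of positive degree has a pole at \<open>w_inf\<close>.\<close>

lemma constant_of_integral:
  assumes "\<And>w. w \<in> K_places \<Longrightarrow> val_ge w (\<iota> a) 0"
  shows "\<exists>c. a = ratfun_const c"
proof -
  have "val_ge v a 0" if v: "v \<in> finite_places" for v
  proof -
    obtain w e where w: "w \<in> fin_K_places" "lies_over \<iota> v e w" using place_above[OF v] by blast
    then have wK: "w \<in> K_places" by (simp add: fin_K_places_def)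
    obtain p where "w p = 1" using places_uniformizer[OF wK] by blast
    then show ?thesis using val_ge_emb[OF places_valuation[OF wK] _ w(2)] assms[OF wK] by blast
  qed
  then obtain g where g: "a = poly_fract g" using integral_imp_poly by blast
  have "degree g = 0"
  proof (cases "g = 0")
    case False
    then show ?thesis
      using assms[OF w_inf_place] w_inf_place_poly[OF False] g by (simp add: val_ge_def)
  qed simp
  then obtain c where "g = [:c:]" by (metis degree_eq_zeroE)
  then show ?thesis using g by (auto simp: ratfun_const_def)
qed

text \<open>Both \<open>a\<close> and \<open>inverse a\<close> are polynomials, and their degrees
  add up to 0.\<close>

lemma constant_of_no_finite_zeros:
  assumes "a \<noteq> 0" "\<And>w. w \<in> fin_K_places \<Longrightarrow> w (\<iota> a) = 0"
  shows "\<exists>c. c \<noteq> 0 \<and> a = ratfun_const c"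
proof -
  have "v a = 0" if v: "v \<in> finite_places" for v
  proof -
    obtain w e where "w \<in> fin_K_places" "lies_over \<iota> v e w" using place_above[OF v] by blast
    then show ?thesis using assms(2)[of w] by (auto simp: lies_over_def)
  qed
  then have ge: "val_ge v a 0" "val_ge v (inverse a) 0" if v: "v \<in> finite_places" for v
    using v valuation.inverse[OF finite_places_valuation[OF v], of a] unfolding val_ge_def by fastforce+
  obtain g where g: "a = poly_fract g" using integral_imp_poly[of a] ge by blast
  obtain h where h: "inverse a = poly_fract h" using integral_imp_poly[of "inverse a"] ge by blast
  have "poly_fract (g * h) = poly_fract 1"
    unfolding poly_fract_mult g[symmetric] h[symmetric] using assms(1) by (simp add: fract_collapse)
  then have gh: "g * h = 1" by (simp add: eq_fract)
  then have "g \<noteq> 0" "h \<noteq> 0" by auto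
  then have "degree g + degree h = degree (1 :: 'k poly)" using gh degree_mult_eq by metis
  then obtain c where "g = [:c:]" by (metis degree_eq_zeroE degree_1 add_is_0)
  then show ?thesis using g \<open>g \<noteq> 0\<close> by (auto simp: ratfun_const_def)
qed

text \<open>Applied to quotients: elements of \<open>k(x)\<close> with equal finite values have the
  same value at infinity.\<close>

lemma w_inf_of_no_finite_zeros:
  assumes "a \<noteq> 0" "\<And>w. w \<in> fin_K_places \<Longrightarrow> w (\<iota> a) = 0"
  shows "w_inf (\<iota> a) = 0"
proof -
  obtain c where "a = ratfun_const c" using constant_of_no_finite_zeros assms by blast
  then show ?thesis using places_const[OF w_inf_place, of c] by (simp add: \<kappa>_def)
qed

text \<open>\<open>v\<close> ranges over all functions, but parity of the values forces the place
  below \<open>w\<close> to have index 2. \<open>w_inf\<close> is left out since it serves to adjust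
  degrees.\<close>

definition ram_places :: "('K \<Rightarrow> int) set" where
  "ram_places = {w \<in> fin_K_places. \<exists>v. lies_over \<iota> v 2 w}"

lemma ram_places_conj: "w \<in> ram_places \<Longrightarrow> w \<circ> \<sigma> = w"
  using ramified_conj by (auto simp: ram_places_def fin_K_places_def)

lemma ram_places_conj_iff: "w \<circ> \<sigma> \<in> ram_places \<longleftrightarrow> w \<in> ram_places"
  using ram_places_conj[of w] ram_places_conj[of "w \<circ> \<sigma>"] by auto

lemma ram_places_K: "w \<in> ram_places \<Longrightarrow> w \<in> K_places" and w_inf_not_ram: "w_inf \<notin> ram_places"
  by (auto simp: ram_places_def fin_K_places_def)

lemma ram_places_even: "w \<in> ram_places \<Longrightarrow> even (w (\<iota> a))"
  by (auto simp: ram_places_def lies_over_def)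

text \<open>Inertia acts trivially on residues: \<open>z\<close> is congruent to an element of the
  base field, and applying \<sigma>, which fixes \<open>w\<close>, shows the same for
  \<open>\<sigma> z\<close>.\<close>

lemma residue_conj_diff:
  assumes w: "w \<in> ram_places" and z: "val_ge w z 0"
  shows "val_ge w (z - \<sigma> z) 1"
proof -
  have wK: "w \<in> K_places" using w by (rule ram_places_K)
  then interpret valuation w by (rule places_valuation)
  obtain v where v: "lies_over \<iota> v 2 w" using w by (auto simp: ram_places_def)
  obtain p where p: "w p = 1" using places_uniformizer[OF wK] by blast
  obtain a where a: "val_ge w (z - \<iota> a) 1"
    using residue_of_ramified[OF valuation_axioms p v _ z] by blast
  have "w (\<sigma> (z - \<iota> a)) = w (z - \<iota> a)" using ram_places_conj[OF w] by (metis comp_apply)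
  then have "val_ge w (\<sigma> (z - \<iota> a)) 1" using a unfolding val_ge_def conj_eq_0_iff by simp
  from ge_diff[OF a this] show ?thesis by simp
qed

text \<open>\<open>w_inf\<close> has degree 1, so subtracting it with the total degree of
  \<open>S\<close> gives degree zero.\<close>

definition ram_divisor :: "('K \<Rightarrow> int) set \<Rightarrow> ('K \<Rightarrow> int) \<Rightarrow>\<^sub>0 int" where
  "ram_divisor S = (\<Sum>w\<in>S. Poly_Mapping.single w 1) -
     Poly_Mapping.single w_inf (\<Sum>w\<in>S. int (place_degree \<kappa> w))"

lemma lookup_ram_divisor:
  assumes "finite S" "w \<noteq> w_inf"
  shows "lookup (ram_divisor S) w = of_bool (w \<in> S)"
  using assms by (auto simp: ram_divisor_def lookup_minus lookup_sum lookup_single when_def)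

lemma keys_ram_divisor:
  assumes "S \<subseteq> K_places"
  shows "keys (ram_divisor S) \<subseteq> K_places"
proof
  fix w assume w: "w \<in> keys (ram_divisor S)"
  show "w \<in> K_places"
  proof (rule ccontr)
    assume "w \<notin> K_places"
    then have "w \<notin> S" "w \<noteq> w_inf" using assms w_inf_place by auto
    then have "lookup (ram_divisor S) w = 0"
      by (auto simp: ram_divisor_def lookup_minus lookup_sum lookup_single when_def intro!: sum.neutral)
    then show False using w by (simp add: in_keys_iff)
  qed
qed

lemma degree_ram_divisor: "divisor_degree \<kappa> (ram_divisor S) = 0"
  by (simp add: ram_divisor_def divisor_degree_diff divisor_degree_sum divisor_degree_single place_degree_w_inf)

end

section \<open>Two-torsion in the separable case\<close>

locale separable_quadratic = quadratic_function_field \<iota> \<sigma> v_inf w_inf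
  for \<iota> :: "'k::{field,finite} poly fract \<Rightarrow> 'K::field" and \<sigma> v_inf w_inf +
  assumes separable: "\<exists>y. \<sigma> y \<noteq> y"
begin

text \<open>The divisor \<open>D + \<sigma> D\<close> is principal up to a multiple of the infinite place; the multiple is
  governed by the degree of \<open>D\<close>.\<close>

lemma norm_form:
  assumes D: "keys D \<subseteq> K_places"
  shows "\<exists>g. g \<noteq> 0 \<and> w_inf (\<iota> g) = - 2 * (divisor_degree \<kappa> D - lookup D w_inf) \<and>
    (\<forall>w\<in>fin_K_places. w (\<iota> g) = lookup D w + lookup D (w \<circ> \<sigma>))"
proof -
  obtain a where a: "\<And>w. w \<in> fin_K_places \<Longrightarrow> a w \<noteq> 0 \<and> w_inf (\<iota> (a w)) = - 2 * int (place_degree \<kappa> w) \<and>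
    (\<forall>w'\<in>fin_K_places. w' (\<iota> (a w)) = of_bool (w' = w) + of_bool (w' = w \<circ> \<sigma>))"
    using norm_divisor[OF separable] by metis
  define S where "S = keys D - {w_inf}"
  have S: "finite S" "S \<subseteq> fin_K_places" using D by (auto simp: S_def fin_K_places_def)
  let ?D = "lookup D"
  \<comment> \<open>Each \<open>a w\<close> is the norm of the place \<open>w\<close>, so
    \<open>g\<close> is the norm of the finite part of \<open>D\<close>.\<close>
  define g where "g = (\<Prod>w\<in>S. a w powi ?D w)"
  have nz: "a w \<noteq> 0" if "w \<in> S" for w using a S(2) that by blast
  have val: "w (\<iota> g) = (\<Sum>P\<in>S. ?D P * w (\<iota> (a P)))" if "w \<in> K_places" for w
    using valuation.prod_power_int[OF valuation_comp_emb[OF places_valuation[OF that]] S(1) nz]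
    by (simp add: g_def)
  have "g \<noteq> 0" using nz S(1) by (simp add: g_def)
  moreover have "w_inf (\<iota> g) = - 2 * (divisor_degree \<kappa> D - ?D w_inf)"
  proof -
    have "divisor_degree \<kappa> D = (\<Sum>P\<in>insert w_inf S. ?D P * int (place_degree \<kappa> P))"
      using S(1) by (intro divisor_degree_superset) (auto simp: S_def)
    also have "\<dots> = ?D w_inf + (\<Sum>P\<in>S. ?D P * int (place_degree \<kappa> P))"
      using S by (subst sum.insert) (auto simp: fin_K_places_def place_degree_w_inf)
    finally have "divisor_degree \<kappa> D - ?D w_inf = (\<Sum>P\<in>S. ?D P * int (place_degree \<kappa> P))" by simp
    moreover have "w_inf (\<iota> g) = (\<Sum>P\<in>S. ?D P * (- 2 * int (place_degree \<kappa> P)))"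
      unfolding val[OF w_inf_place] using a S(2) by (intro sum.cong refl) auto
    ultimately show ?thesis by (simp add: sum_distrib_left sum_negf mult.left_commute)
  qed
  moreover have "w (\<iota> g) = ?D w + ?D (w \<circ> \<sigma>)" if w: "w \<in> fin_K_places" for w
  proof -
    have zero: "?D P = 0" if "P \<in> fin_K_places" "P \<notin> S" for P
      using that by (auto simp: S_def fin_K_places_def in_keys_iff)
    have sw: "w = P \<circ> \<sigma> \<longleftrightarrow> P = w \<circ> \<sigma>" for P by auto
    have wK: "w \<in> K_places" using w by (simp add: fin_K_places_def)
    have "w (\<iota> (a P)) = of_bool (w = P) + of_bool (w = P \<circ> \<sigma>)" if "P \<in> S" for P
      using a[of P] S(2) w that by blast
    then have "w (\<iota> g) = (\<Sum>P\<in>S. ?D P * (of_bool (w = P) + of_bool (w = P \<circ> \<sigma>)))"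
      unfolding val[OF wK] by (intro sum.cong refl) (simp only:)
    also have "\<dots> = (\<Sum>P\<in>S. if P = w then ?D P else 0) + (\<Sum>P\<in>S. if P = w \<circ> \<sigma> then ?D P else 0)"
      unfolding sum.distrib[symmetric] sw by (intro sum.cong refl) (auto simp: of_bool_def)
    also have "\<dots> = ?D w + ?D (w \<circ> \<sigma>)"
      using S(1) zero[OF w] zero[OF conj_fin_place[OF w]] by simp
    finally show ?thesis .
  qed
  ultimately show ?thesis by blast
qed

text \<open>The norm of \<open>f\<close> and the element attached to the finite part of its divisor
  have equal finite values. They then agree at infinity, and equating the two values there leaves
  degree 0.\<close>

lemma degree_principal:
  assumes "D \<in> principal_divisors \<kappa>"
  shows "divisor_degree \<kappa> D = 0"
proof -
  let ?D = "lookup D"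
  obtain f where keys: "keys D \<subseteq> K_places" and f: "f \<noteq> 0" "\<And>w. w \<in> K_places \<Longrightarrow> ?D w = w f"
    using assms unfolding principal_divisors_iff by blast
  obtain g where g: "g \<noteq> 0" "w_inf (\<iota> g) = - 2 * (divisor_degree \<kappa> D - ?D w_inf)"
    "\<And>w. w \<in> fin_K_places \<Longrightarrow> w (\<iota> g) = ?D w + ?D (w \<circ> \<sigma>)"
    using norm_form[OF keys] by blast
  obtain n where n: "f * \<sigma> f = \<iota> n" using norm_in_base by blast
  have n0: "n \<noteq> 0" using n f(1) by auto
  have wn: "w (\<iota> n) = ?D w + ?D (w \<circ> \<sigma>)" if "w \<in> K_places" for w
    using f(2)[OF that] f(2)[OF conj_place[OF that]] f(1)
      valuation.mult[OF places_valuation[OF that], of f "\<sigma> f"] by (simp flip: n)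
  have quot: "w (\<iota> (n / g)) = w (\<iota> n) - w (\<iota> g)" if "w \<in> K_places" for w
    using valuation.divide[OF places_valuation[OF that], of "\<iota> n" "\<iota> g"] n0 g(1) by simp
  have "w (\<iota> (n / g)) = 0" if "w \<in> fin_K_places" for w
    using quot[of w] wn[of w] g(3)[OF that] that by (simp add: fin_K_places_def)
  then have "w_inf (\<iota> (n / g)) = 0" using n0 g(1) by (intro w_inf_of_no_finite_zeros) auto
  then show ?thesis using quot[OF w_inf_place] wn[OF w_inf_place] g(2) by simp
qed

text \<open>On the finite places \<open>E\<close> is pulled back from \<open>k(x)\<close>: conjugate
  places carry equal coefficients, and evenness makes each coefficient divisible by the ramification
  index. The place polynomials with the quotients as exponents realise it.\<close>

lemma invariant_form:
  assumes E: "keys E \<subseteq> K_places"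
    and inv: "\<And>w. w \<in> fin_K_places \<Longrightarrow> lookup E (w \<circ> \<sigma>) = lookup E w"
    and even: "\<And>w. w \<in> ram_places \<Longrightarrow> even (lookup E w)"
  shows "\<exists>g. g \<noteq> 0 \<and> w_inf (\<iota> g) = lookup E w_inf - divisor_degree \<kappa> E \<and>
    (\<forall>w\<in>fin_K_places. w (\<iota> g) = lookup E w)"
proof -
  let ?E = "lookup E"
  have "\<exists>w e. w \<in> fin_K_places \<and> lies_over \<iota> v e w" if "v \<in> finite_places" for v
    using place_above[OF that] by metis
  then obtain W e where W: "\<And>v. v \<in> finite_places \<Longrightarrow> W v \<in> fin_K_places \<and> lies_over \<iota> v (e v) (W v)"
    by metis
  define V where "V = {v \<in> finite_places. ?E (W v) \<noteq> 0}"
  have "inj_on W V"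
  proof (rule inj_onI)
    fix v v' assume "v \<in> V" "v' \<in> V" "W v = W v'"
    then show "v = v'"
      using lies_over_unique(1)[of v "e v" "W v" v' "e v'" ratfun_const ratfun_const] W[of v] W[of v']
      by (auto simp: V_def finite_places_def)
  qed
  moreover have "W ` V \<subseteq> keys E" by (auto simp: V_def in_keys_iff)
  ultimately have "finite V" using inj_on_finite finite_keys by blast
  define n where "n v = ?E (W v) div int (e v)" for v
  define g where "g = (\<Prod>v\<in>V. poly_fract (place_poly v) powi n v)"
  have nz: "poly_fract (place_poly v) \<noteq> 0" if "v \<in> V" for v
    using place_poly(1) that by (auto simp: V_def)
  have g0: "g \<noteq> 0" using nz \<open>finite V\<close> by (simp add: g_def)
  have vg: "v (g) = n v" if v: "v \<in> finite_places" for v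
  proof -
    have "v g = (\<Sum>v'\<in>V. n v' * v (poly_fract (place_poly v')))"
      unfolding g_def
      by (rule valuation.prod_power_int[OF finite_places_valuation[OF v] \<open>finite V\<close> nz])
    also have "\<dots> = (\<Sum>v'\<in>V. if v' = v then n v' else 0)"
      by (intro sum.cong refl) (use place_poly_value[OF _ v] in \<open>force simp: V_def\<close>)
    also have "\<dots> = n v" using \<open>finite V\<close> v by (auto simp: V_def n_def)
    finally show ?thesis .
  qed
  have fin: "w (\<iota> g) = ?E w" if w: "w \<in> fin_K_places" for w
  proof -
    obtain v d where v: "v \<in> finite_places" "lies_over \<iota> v d w" "d = 1 \<or> d = 2"
      using fin_place_below[OF w] by blast
    have K: "W v \<in> K_places" "w \<in> K_places" using W[OF v(1)] w by (auto simp: fin_K_places_def)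
    have "w = W v \<or> w = W v \<circ> \<sigma>" using places_over[OF K] W[OF v(1)] v(2) by blast
    then have eq: "?E w = ?E (W v)" using inv W[OF v(1)] by auto
    have "lies_over \<iota> v (e v) w"
      using \<open>w = W v \<or> w = W v \<circ> \<sigma>\<close> W[OF v(1)] conj_place_lies_over by blast
    then have "d = e v"
      using lies_over_unique(2)[OF v(2)] v(1) by (auto simp: finite_places_def)
    have "w (\<iota> g) = int d * (?E w div int d)"
      using v(2) vg[OF v(1)] by (simp add: lies_over_def n_def eq \<open>d = e v\<close>)
    also have "\<dots> = ?E w"
    proof (cases "d = 2")
      case True
      then have "w \<in> ram_places" using v(2) w by (auto simp: ram_places_def)
      then show ?thesis using even[of w] True by simp
    qed (use v(3) in simp)
    finally show ?thesis .
  qed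
  \<comment> \<open>As \<open>E\<close> is invariant, \<open>h\<close> has the finite values of
    \<open>g * g\<close>. The two agree at infinity as well, so \<open>w_inf (\<iota> g)\<close> is
    half of \<open>w_inf (\<iota> h)\<close>.\<close>
  obtain h where h: "h \<noteq> 0" "w_inf (\<iota> h) = - 2 * (divisor_degree \<kappa> E - ?E w_inf)"
    "\<And>w. w \<in> fin_K_places \<Longrightarrow> w (\<iota> h) = ?E w + ?E (w \<circ> \<sigma>)"
    using norm_form[OF E] by blast
  have quot: "w (\<iota> (h / (g * g))) = w (\<iota> h) - 2 * w (\<iota> g)" if "w \<in> K_places" for w
    using valuation.divide[OF places_valuation[OF that], of "\<iota> h" "\<iota> g * \<iota> g"]
      valuation.mult[OF places_valuation[OF that], of "\<iota> g" "\<iota> g"] h(1) g0 by simp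
  have "w (\<iota> (h / (g * g))) = 0" if "w \<in> fin_K_places" for w
    using quot[of w] fin[OF that] h(3)[OF that] inv[OF that] that by (simp add: fin_K_places_def)
  then have "w_inf (\<iota> (h / (g * g))) = 0" using h(1) g0 by (intro w_inf_of_no_finite_zeros) auto
  then have "w_inf (\<iota> g) = ?E w_inf - divisor_degree \<kappa> E"
    using quot[OF w_inf_place] h(2) by simp
  then show ?thesis using g0 fin by blast
qed

lemma invariant_principal:
  assumes E: "keys E \<subseteq> K_places" "divisor_degree \<kappa> E = 0"
    and inv: "\<And>w. w \<in> fin_K_places \<Longrightarrow> lookup E (w \<circ> \<sigma>) = lookup E w"
    and even: "\<And>w. w \<in> ram_places \<Longrightarrow> even (lookup E w)"
  shows "E \<in> principal_divisors \<kappa>"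
proof -
  obtain g where g: "g \<noteq> 0" "w_inf (\<iota> g) = lookup E w_inf"
    "\<And>w. w \<in> fin_K_places \<Longrightarrow> w (\<iota> g) = lookup E w"
    using invariant_form[OF E(1) inv even] E(2) by auto
  then have "lookup E w = w (\<iota> g)" if "w \<in> K_places" for w
    using that by (cases "w = w_inf") (auto simp: fin_K_places_def)
  then show ?thesis unfolding principal_divisors_iff using E(1) g(1) by (auto intro!: exI[of _ "\<iota> g"])
qed

text \<open>The resolvent \<open>z + f * \<sigma> z\<close> at \<open>z = 1\<close>. It vanishes
  only for \<open>f = - 1\<close>, where \<open>y - \<sigma> y\<close> serves instead.\<close>

lemma hilbert_90:
  assumes "f * \<sigma> f = 1"
  shows "\<exists>g. g \<noteq> 0 \<and> g = f * \<sigma> g"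
proof (cases "f = - 1")
  case True
  obtain y where "\<sigma> y \<noteq> y" using separable by blast
  then show ?thesis using True by (intro exI[of _ "y - \<sigma> y"]) auto
next
  case False
  have "f * \<sigma> (1 + f) = 1 + f" using assms by (simp add: algebra_simps)
  moreover have "1 + f \<noteq> 0" using False by (simp add: add_eq_0_iff)
  ultimately show ?thesis by metis
qed

text \<open>Hilbert 90 is applied to a multiple of a function with divisor
  \<open>\<sigma> D - D\<close>. The equation obtained says that \<open>D\<close> plus the divisor
  of \<open>g\<close> is invariant under \<sigma>.\<close>

lemma torsion_invariant:
  assumes keys: "keys D \<subseteq> K_places" and deg: "divisor_degree \<kappa> D = 0"
    and tors: "D + D \<in> principal_divisors \<kappa>"
  shows "\<exists>g. g \<noteq> 0 \<and> (\<forall>w\<in>K_places.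
    lookup D (w \<circ> \<sigma>) + w (\<sigma> g) = lookup D w + w g)"
proof -
  let ?D = "lookup D"
  interpret inf: valuation w_inf using w_inf_place by (rule places_valuation)
  obtain f0 where f0: "f0 \<noteq> 0" "\<And>w. w \<in> K_places \<Longrightarrow> 2 * ?D w = w f0"
    using tors unfolding principal_divisors_iff by (auto simp: lookup_add)
  obtain h where h: "h \<noteq> 0" "w_inf (\<iota> h) = 2 * ?D w_inf"
    "\<And>w. w \<in> fin_K_places \<Longrightarrow> w (\<iota> h) = ?D w + ?D (w \<circ> \<sigma>)"
    using norm_form[OF keys] deg by auto
  have wh: "w (\<iota> h) = ?D w + ?D (w \<circ> \<sigma>)" if "w \<in> K_places" for w
    using that h(2,3) by (cases "w = w_inf") (auto simp: fin_K_places_def)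
  \<comment> \<open>\<open>\<iota> h\<close> has the divisor \<open>D + \<sigma> D\<close> and
    \<open>f0\<close> the divisor \<open>2 D\<close>, so \<open>f\<close> has the divisor
    \<open>\<sigma> D - D\<close>.\<close>
  define f where "f = \<iota> h / f0"
  have f_nz: "f \<noteq> 0" using h(1) f0(1) by (simp add: f_def)
  have wf: "w f = ?D (w \<circ> \<sigma>) - ?D w" if "w \<in> K_places" for w
    using valuation.divide[OF places_valuation[OF that], of "\<iota> h" f0] h(1) f0(1) f0(2)[OF that] wh[OF that]
    by (simp add: f_def)
  obtain n where n: "f * \<sigma> f = \<iota> n" using norm_in_base by blast
  have n0: "n \<noteq> 0" using n f_nz by auto
  have "w (\<iota> n) = 0" if "w \<in> K_places" for w
    using valuation.mult[OF places_valuation[OF that], of f "\<sigma> f"] f_nz wf[OF that] wf[OF conj_place[OF that]]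
    by (simp flip: n)
  then obtain c where c: "n = ratfun_const c"
    using constant_of_no_finite_zeros[OF n0] by (auto simp: fin_K_places_def)
  have "w_inf f = 0" using wf[OF w_inf_place] by simp
  \<comment> \<open>The residue of \<open>f\<close> at infinity. \<sigma> fixes \<open>w_inf\<close>
    and the constants, so \<open>\<sigma> f\<close> has the same residue; the constant norm is thus
    \<open>a * a\<close>, and \<open>f / \<kappa> a\<close> has norm 1.\<close>
  then obtain a where a: "val_ge w_inf (f - \<kappa> a) 1" using w_inf_residue[of f] by (auto simp: val_ge_def)
  have a0: "a \<noteq> 0" using a \<open>w_inf f = 0\<close> f_nz by (auto simp: val_ge_def)
  have "val_ge w_inf (\<sigma> (f - \<kappa> a)) 1" using a unfolding val_ge_def conj_eq_0_iff w_inf_conj .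
  then have a': "val_ge w_inf (\<sigma> f - \<kappa> a) 1" by simp
  have "val_ge w_inf (f * (\<sigma> f - \<kappa> a) + \<kappa> a * (f - \<kappa> a)) 1"
    using a a' \<open>w_inf f = 0\<close> places_const[OF w_inf_place]
    by (intro inf.ge_add inf.ge_mult0) (auto simp: val_ge_def)
  moreover have "f * (\<sigma> f - \<kappa> a) + \<kappa> a * (f - \<kappa> a) = \<kappa> (c - a * a)"
    using n by (simp add: c \<kappa>_diff \<kappa>_mult algebra_simps) (simp add: \<kappa>_def)
  ultimately have "val_ge w_inf (\<kappa> (c - a * a)) 1" by simp
  then have "c = a * a" using places_const[OF w_inf_place] by (auto simp: val_ge_def)
  moreover have "f * \<sigma> f = \<kappa> c" by (simp add: n c \<kappa>_def)
  ultimately have fsf: "f * \<sigma> f = \<kappa> a * \<kappa> a" by (simp only: \<kappa>_mult)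
  have "f / \<kappa> a * \<sigma> (f / \<kappa> a) = (f * \<sigma> f) / (\<kappa> a * \<kappa> a)" by simp
  also have "\<dots> = 1" unfolding fsf using a0 by simp
  finally have "f / \<kappa> a * \<sigma> (f / \<kappa> a) = 1" .
  then obtain g where g: "g \<noteq> 0" "g = f / \<kappa> a * \<sigma> g" using hilbert_90 by blast
  have "?D (w \<circ> \<sigma>) + w (\<sigma> g) = ?D w + w g" if w: "w \<in> K_places" for w
  proof -
    interpret valuation w using w by (rule places_valuation)
    have "w (f / \<kappa> a * \<sigma> g) = w f - w (\<kappa> a) + w (\<sigma> g)"
      using f_nz a0 g(1) by (simp add: mult divide del: times_divide_eq_left)
    then have "w g = w f + w (\<sigma> g)" using g(2) places_const[OF w, of a] by simp
    then show ?thesis using wf[OF w] by simp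
  qed
  then show ?thesis using g(1) by blast
qed

text \<open>At a ramified place where \<open>y\<close> is a unit, \<open>y - \<sigma> y\<close>
  vanishes. So every ramified place lies in the support of one of two functions.\<close>

lemma finite_ram_places: "finite ram_places"
proof -
  obtain y where y: "\<sigma> y \<noteq> y" using separable by blast
  have "ram_places \<subseteq> {w \<in> K_places. w y \<noteq> 0} \<union> {w \<in> K_places. w (y - \<sigma> y) \<noteq> 0}"
  proof
    fix w assume w: "w \<in> ram_places"
    show "w \<in> {w \<in> K_places. w y \<noteq> 0} \<union> {w \<in> K_places. w (y - \<sigma> y) \<noteq> 0}"
    proof (cases "w y = 0")
      case True
      then have "val_ge w (y - \<sigma> y) 1" using residue_conj_diff[OF w] by (simp add: val_ge_def)
      then show ?thesis using y ram_places_K[OF w] by (auto simp: val_ge_def)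
    qed (use ram_places_K[OF w] in simp)
  qed
  then show ?thesis using finite_support by (meson finite_UnI finite_subset)
qed

lemma ram_divisor_conj:
  assumes "S \<subseteq> ram_places"
  shows "lookup (ram_divisor S) (w \<circ> \<sigma>) = lookup (ram_divisor S) w"
proof (cases "w = w_inf")
  case False
  have "finite S" using assms finite_ram_places finite_subset by blast
  moreover have "w \<circ> \<sigma> \<in> S \<longleftrightarrow> w \<in> S"
    using ram_places_conj[of w] ram_places_conj_iff[of w] assms by auto
  ultimately show ?thesis using False by (simp add: lookup_ram_divisor)
qed simp

text \<open>The divisor is invariant and doubling makes its coefficients even, so it comes from
  \<open>k(x)\<close>.\<close>

lemma ram_divisor_double:
  assumes "S \<subseteq> ram_places"
  shows "ram_divisor S + ram_divisor S \<in> principal_divisors \<kappa>"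
proof (rule invariant_principal)
  have "keys (ram_divisor S) \<subseteq> K_places"
    using assms ram_places_K by (intro keys_ram_divisor) blast
  then show "keys (ram_divisor S + ram_divisor S) \<subseteq> K_places"
    using Poly_Mapping.keys_add[of "ram_divisor S" "ram_divisor S"] by blast
qed (simp_all add: divisor_degree_add degree_ram_divisor lookup_add ram_divisor_conj[OF assms])

lemma torsion_representative:
  assumes keys: "keys D \<subseteq> K_places" and deg: "divisor_degree \<kappa> D = 0"
    and tors: "D + D \<in> principal_divisors \<kappa>"
  shows "\<exists>S\<subseteq>ram_places. D - ram_divisor S \<in> principal_divisors \<kappa>"
proof -
  obtain g where g: "g \<noteq> 0" "\<And>w. w \<in> K_places \<Longrightarrow>
    lookup D (w \<circ> \<sigma>) + w (\<sigma> g) = lookup D w + w g"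
    using torsion_invariant[OF assms] by blast
  \<comment> \<open>Collects the ramified places at which the invariant divisor
    \<open>D + pdiv g\<close> has an odd coefficient; subtracting \<open>ram_divisor S\<close>
    removes this obstruction to coming from \<open>k(x)\<close>.\<close>
  define S where "S = {w \<in> ram_places. odd (lookup D w + w g)}"
  have S: "S \<subseteq> ram_places" by (auto simp: S_def)
  then have "finite S" using finite_ram_places finite_subset by blast
  define E where "E = D + pdiv g - ram_divisor S"
  have "keys (ram_divisor S) \<subseteq> K_places"
    using S ram_places_K by (intro keys_ram_divisor) blast
  then have keysE: "keys E \<subseteq> K_places"
    using keys keys_pdiv[of g] keys_diff[of "D + pdiv g" "ram_divisor S"] Poly_Mapping.keys_add[of D "pdiv g"]
    unfolding E_def by blast
  have "E \<in> principal_divisors \<kappa>"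
  proof (rule invariant_principal[OF keysE])
    show "divisor_degree \<kappa> E = 0"
      by (simp add: E_def divisor_degree_add divisor_degree_diff deg degree_ram_divisor
          degree_principal[OF pdiv_principal[OF g(1)]])
  next
    fix w assume "w \<in> fin_K_places"
    then have w: "w \<in> K_places" by (simp add: fin_K_places_def)
    then show "lookup E (w \<circ> \<sigma>) = lookup E w"
      using g(2)[OF w] conj_place[OF w] by (simp add: E_def lookup_add lookup_minus lookup_pdiv ram_divisor_conj[OF S])
  next
    fix w assume w: "w \<in> ram_places"
    then have "w \<in> K_places" "w \<noteq> w_inf" using ram_places_K w_inf_not_ram by auto
    then show "even (lookup E w)"
      using w \<open>finite S\<close> by (simp add: E_def lookup_add lookup_minus lookup_pdiv lookup_ram_divisor) (auto simp: S_def)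
  qed
  then have "E - pdiv g \<in> principal_divisors \<kappa>"
    using pdiv_principal[OF g(1)] by (rule principal_divisors_diff)
  moreover have "E - pdiv g = D - ram_divisor S" by (simp add: E_def)
  ultimately show ?thesis using S by auto
qed

text \<open>An even value could be scaled to 0 by an element of \<open>k(x)\<close>, giving a unit
  \<open>u\<close> with \<open>\<sigma> u = - u\<close>. Since \<sigma> acts trivially on residues,
  \<open>2 * u\<close> would vanish at \<open>w\<close>, impossible when 2 is a nonzero
  constant.\<close>

lemma odd_anti_invariant:
  assumes d: "d \<noteq> 0" "\<sigma> d = - d" and char: "(2 :: 'k) \<noteq> 0" and w: "w \<in> ram_places"
  shows "odd (w d)"
proof
  assume ev: "even (w d)"
  have wK: "w \<in> K_places" using w by (rule ram_places_K)
  then interpret valuation w by (rule places_valuation)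
  obtain v' e' where v': "v' \<in> places ratfun_const" "lies_over \<iota> v' e' w" using place_below[OF wK] by blast
  \<comment> \<open>A uniformizer of the place below: its value at \<open>w\<close> is the index,
    which is positive, even and at most 2.\<close>
  have "\<exists>a. a \<noteq> 0 \<and> w (\<iota> a) = 2"
  proof -
    obtain a where a: "a \<noteq> 0" "v' a = 1" using places_uniformizer[OF v'(1)] by blast
    obtain p where p: "w p = 1" using places_uniformizer[OF wK] by blast
    have "e' \<le> 2" using ramification_le_2[OF valuation_axioms p v'(2)] .
    moreover have "w (\<iota> a) = int e'" "e' \<ge> 1" using v'(2) a(2) by (simp_all add: lies_over_def)
    moreover have "even (w (\<iota> a))" using ram_places_even[OF w] .
    ultimately have "w (\<iota> a) = 2" by presburger
    then show ?thesis using a(1) by blast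
  qed
  then obtain a where a: "a \<noteq> 0" "w (\<iota> a) = 2" by blast
  define k where "k = w d div 2"
  define u where "u = d * \<iota> (a powi (- k))"
  have "w u = w d - 2 * k" using d(1) a by (simp add: u_def mult power_int del: emb_power_int) (simp add: power_int)
  then have wu: "w u = 0" using ev by (simp add: k_def)
  have "\<sigma> u = - u" using d(2) by (simp add: u_def del: emb_power_int)
  then have "val_ge w (u + u) 1" using residue_conj_diff[OF w, of u] wu by (simp add: val_ge_def)
  moreover have "u + u = \<kappa> 2 * u" by (simp add: \<kappa>_2)
  moreover have "u \<noteq> 0" using d(1) a(1) by (simp add: u_def)
  then have "\<kappa> 2 * u \<noteq> 0" "w (\<kappa> 2 * u) = 0"
    using char wu places_const[OF wK] mult[of "\<kappa> 2" u] by simp_all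
  ultimately show False by (simp add: val_ge_def)
qed

text \<open>The trace of \<open>u\<close> is integral everywhere, hence a constant \<open>c\<close>,
  and \<open>u\<close> is a root of \<open>T^2 - c T + 1\<close>. As \<open>k\<close> is the full
  constant field, \<open>u\<close> is a constant fixed by \<sigma>, and its norm equation becomes
  \<open>u * u = 1\<close>.\<close>

lemma unit_pm_1:
  assumes const: "full_constant_field \<kappa>" and u: "u * \<sigma> u = 1" "\<And>w. w \<in> K_places \<Longrightarrow> w u = 0"
  shows "u = 1 \<or> u = - 1"
proof -
  obtain t where t: "u + \<sigma> u = \<iota> t" using trace_in_base by blast
  have "\<exists>c. t = ratfun_const c"
  proof (rule constant_of_integral)
    fix w assume w: "w \<in> K_places"
    interpret valuation w using w by (rule places_valuation)
    have "val_ge w (u + \<sigma> u) 0"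
      using u(2)[OF w] u(2)[OF conj_place[OF w]] by (intro ge_add) (simp_all add: val_ge_def)
    then show "val_ge w (\<iota> t) 0" by (simp add: t)
  qed
  then obtain c where c: "\<iota> t = \<kappa> c" by (auto simp: \<kappa>_def)
  have "poly (map_poly \<kappa> [:1, - c, 1:]) u = 1 - \<kappa> c * u + u * u"
    by (simp add: map_poly_pCons \<kappa>_uminus algebra_simps)
  also have "\<dots> = 0" using u(1) by (simp add: algebra_simps flip: c t)
  finally have "u \<in> range \<kappa>" using const unfolding full_constant_field_def
    by (metis pCons_eq_0_iff zero_neq_one)
  then have "\<sigma> u = u" by auto
  then have "u * u = 1" using u(1) by simp
  then show ?thesis by (simp add: square_eq_1_iff)
qed

text \<open>Both divisors are invariant, so \<open>\<sigma> f / f\<close> has value 0 everywhere and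
  is 1 or -1. At a ramified place the value of \<open>f\<close> is the difference of the indicators
  of \<open>S\<close> and \<open>S'\<close>, so its parity decides whether the memberships
  agree.\<close>

lemma ram_divisor_fiber:
  assumes const: "full_constant_field \<kappa>" and S: "S \<subseteq> ram_places" "S' \<subseteq> ram_places"
    and eq: "ram_divisor S - ram_divisor S' \<in> principal_divisors \<kappa>"
  shows "S = S' \<or> ((2 :: 'k) \<noteq> 0 \<and> S' = ram_places - S)"
proof -
  obtain f where f: "f \<noteq> 0" "\<And>w. w \<in> K_places \<Longrightarrow>
      lookup (ram_divisor S) w - lookup (ram_divisor S') w = w f"
    using eq unfolding principal_divisors_iff by (auto simp: lookup_minus)
  have fin: "finite S" "finite S'" using S finite_ram_places finite_subset by blast+
  have wf: "w f = of_bool (w \<in> S) - of_bool (w \<in> S')" if "w \<in> ram_places" for w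
    using f(2)[OF ram_places_K[OF that]] that w_inf_not_ram fin lookup_ram_divisor by metis
  define u where "u = \<sigma> f / f"
  have "w u = 0" if "w \<in> K_places" for w
  proof -
    have "w (\<sigma> f) = w f"
      using f(2)[OF conj_place[OF that]] f(2)[OF that] ram_divisor_conj[OF S(1)] ram_divisor_conj[OF S(2)]
      by simp
    then show ?thesis using valuation.divide[OF places_valuation[OF that], of "\<sigma> f" f] f(1) by (simp add: u_def)
  qed
  moreover have "u * \<sigma> u = 1" using f(1) by (simp add: u_def)
  ultimately have "u = 1 \<or> u = - 1" using unit_pm_1[OF const] by blast
  then show ?thesis
  proof (cases "u = 1")
    case True
    then have "\<sigma> f = f" using f(1) by (simp add: u_def)
    then have "f \<in> range \<iota>" using conj_fixed separable by blast
    \<comment> \<open>Elements of the base field have even values at ramified places, so the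
      indicators are equal.\<close>
    then have ev: "even (w f)" if "w \<in> ram_places" for w using ram_places_even[OF that] by blast
    have "w \<in> S \<longleftrightarrow> w \<in> S'" if "w \<in> ram_places" for w
      using wf[OF that] ev[OF that] by (auto simp: of_bool_def split: if_splits)
    then show ?thesis using S by blast
  next
    case False
    then have um: "u = - 1" using \<open>u = 1 \<or> u = - 1\<close> by blast
    have char: "(2 :: 'k) \<noteq> 0"
    proof
      assume "(2 :: 'k) = 0"
      then have "(1 :: 'K) = - 1" using \<kappa>_2 by (simp add: eq_neg_iff_add_eq_0)
      then show False using False um by simp
    qed
    have sf: "\<sigma> f = - f" using um f(1) by (simp add: u_def field_simps)
    \<comment> \<open>Odd values mean that exactly one of the two sets contains
      \<open>w\<close>.\<close>
    have "w \<in> S' \<longleftrightarrow> w \<notin> S" if "w \<in> ram_places" for w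
      using wf[OF that] odd_anti_invariant[OF f(1) sf char that] by (auto simp: of_bool_def split: if_splits)
    then have "S' = ram_places - S" using S by blast
    then show ?thesis using char by blast
  qed
qed

text \<open>The divisor of an anti-invariant \<open>d\<close> has odd coefficients at all finite
  ramified places, as has the difference on the left. Subtracting it leaves an invariant divisor
  with even coefficients there.\<close>

lemma ram_divisor_complement:
  assumes char: "(2 :: 'k) \<noteq> 0" and S: "S \<subseteq> ram_places"
  shows "ram_divisor S - ram_divisor (ram_places - S) \<in> principal_divisors \<kappa>"
proof -
  obtain y where "\<sigma> y \<noteq> y" using separable by blast
  then obtain d where d: "d \<noteq> 0" "\<sigma> d = - d" by (metis conj_conj conj_diff minus_diff_eq right_minus_eq)
  have fin: "finite S" "finite (ram_places - S)" using S finite_ram_places finite_subset by blast+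
  have S': "ram_places - S \<subseteq> ram_places" by blast
  define E where "E = ram_divisor S - ram_divisor (ram_places - S) - pdiv d"
  have "keys (ram_divisor S) \<subseteq> K_places" "keys (ram_divisor (ram_places - S)) \<subseteq> K_places"
    using S ram_places_K by (intro keys_ram_divisor; blast)+
  then have keysE: "keys E \<subseteq> K_places"
    using keys_pdiv[of d] keys_diff[of "ram_divisor S" "ram_divisor (ram_places - S)"]
      keys_diff[of "ram_divisor S - ram_divisor (ram_places - S)" "pdiv d"]
    unfolding E_def by blast
  have "E \<in> principal_divisors \<kappa>"
  proof (rule invariant_principal[OF keysE])
    show "divisor_degree \<kappa> E = 0"
      by (simp add: E_def divisor_degree_diff degree_ram_divisor degree_principal[OF pdiv_principal[OF d(1)]])
  next
    fix w assume "w \<in> fin_K_places"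
    then have w: "w \<in> K_places" by (simp add: fin_K_places_def)
    then show "lookup E (w \<circ> \<sigma>) = lookup E w"
      using conj_place[OF w] d(2) valuation.uminus[OF places_valuation[OF w], of d]
      by (simp add: E_def lookup_minus lookup_pdiv ram_divisor_conj[OF S] ram_divisor_conj[OF S'])
  next
    fix w assume w: "w \<in> ram_places"
    then have "w \<in> K_places" "w \<noteq> w_inf" using ram_places_K w_inf_not_ram by auto
    then show "even (lookup E w)"
      using w fin odd_anti_invariant[OF d char w]
      by (simp add: E_def lookup_minus lookup_pdiv lookup_ram_divisor)
  qed
  then have "E + pdiv d \<in> principal_divisors \<kappa>"
    using pdiv_principal[OF d(1)] by (rule principal_divisors_add)
  then show ?thesis by (simp add: E_def)
qed

end

section \<open>The inseparable case\<close>

lemma even_card_involution: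
  assumes "finite A" "\<And>x. x \<in> A \<Longrightarrow> f x \<in> A" "\<And>x. x \<in> A \<Longrightarrow> f (f x) = x" "\<And>x. x \<in> A \<Longrightarrow> f x \<noteq> x"
  shows "even (card A)"
proof -
  let ?C = "(\<lambda>x. {x, f x}) ` A"
  have U: "\<Union>?C = A" using assms(2) by auto
  have "2 * card ?C = card (\<Union>?C)"
  proof (rule card_partition)
    show "finite ?C" "finite (\<Union>?C)" using assms(1) U by simp_all
    fix c assume "c \<in> ?C"
    then obtain x where "x \<in> A" "c = {x, f x}" by blast
    then show "card c = 2" using assms(4)[of x] by (simp add: card_2_iff')
  next
    fix c d assume "c \<in> ?C" "d \<in> ?C" "c \<noteq> d"
    have "c = {z, f z}" if c: "c \<in> ?C" and z: "z \<in> c" for c z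
    proof -
      obtain x where x: "x \<in> A" "c = {x, f x}" using c by blast
      then have "z = x \<or> z = f x" using z by blast
      then show ?thesis using x(2) assms(3)[OF x(1)] by (metis insert_commute)
    qed
    then show "c \<inter> d = {}"
      using \<open>c \<in> ?C\<close> \<open>d \<in> ?C\<close> \<open>c \<noteq> d\<close> by (metis disjoint_iff)
  qed
  then show ?thesis unfolding U by (metis dvd_triv_left)
qed

text \<open>If \<open>2 = 0\<close>, adding 1 pairs off the elements; otherwise negation pairs off
  the nonzero elements and 0 is left over.\<close>

lemma even_card_field_iff: "even CARD('k::{field,finite}) \<longleftrightarrow> (2 :: 'k) = 0"
proof
  assume two: "(2 :: 'k) = 0"
  have "x + 1 + 1 = x" for x :: 'k using two by (simp add: add.assoc)
  then show "even CARD('k)" by (intro even_card_involution[where f = "\<lambda>x. x + 1"]) auto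
next
  assume even: "even CARD('k)"
  show "(2 :: 'k) = 0"
  proof (rule ccontr)
    assume two: "(2 :: 'k) \<noteq> 0"
    have "- x \<noteq> x" if "x \<noteq> 0" for x :: 'k
    proof
      assume "- x = x"
      then have "2 * x = 0" by (metis add.right_inverse mult_2)
      then show False using two that by simp
    qed
    then have "even (card (UNIV - {0 :: 'k}))"
      by (intro even_card_involution[where f = uminus]) auto
    then show False using even by (simp add: card_Diff_singleton)
  qed
qed

context quadratic_function_field
begin

context
  assumes inseparable: "\<And>z. \<sigma> z = z"
begin

text \<open>If 2 were invertible, every element would be half of its trace and lie in the base
  field.\<close>

private lemma char_2: "(2 :: 'K) = 0"
proof (rule ccontr)
  assume two: "(2 :: 'K) \<noteq> 0"
  obtain y where y: "y \<notin> range \<iota>" using generator by blast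
  obtain t where "y + y = \<iota> t" using trace_in_base[of y] inseparable by auto
  then have "y = \<iota> (t / 2)" using two by (simp add: field_simps)
  then show False using y by blast
qed

lemma inseparable_char_2: "(2 :: 'k) = 0"
  using \<kappa>_2 char_2 \<kappa>_eq_0_iff by metis

private lemma square_add: "(a + b) * (a + b) = a * a + b * (b :: 'K)"
proof -
  have "(a + b) * (a + b) = a * a + b * b + 2 * (a * b)" by (simp add: algebra_simps)
  then show ?thesis by (simp add: char_2)
qed

private lemma minus_eq: "- (a :: 'K) = a"
proof -
  have "a + a = 2 * a" by simp
  then have "a + a = 0" by (simp only: char_2 mult_zero_left)
  then show ?thesis by (metis neg_eq_iff_add_eq_0)
qed

text \<open>Squaring is injective in characteristic 2, hence surjective on a finite field.\<close>

private lemma const_square: "\<exists>d. c = d * (d :: 'k)"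
proof -
  have "inj (\<lambda>x :: 'k. x * x)"
  proof (rule injI)
    fix x y :: 'k assume "x * x = y * y"
    then have "(\<kappa> x) * (\<kappa> x) = (\<kappa> y) * (\<kappa> y)" by (simp flip: \<kappa>_mult)
    then have "\<kappa> x = \<kappa> y" using minus_eq by (metis square_eq_iff)
    then have "\<kappa> (x - y) = 0" by (simp add: \<kappa>_diff)
    then show "x = y" by simp
  qed
  then have "surj (\<lambda>x :: 'k. x * x)" by (simp add: finite_UNIV_inj_surj)
  then show ?thesis by (simp add: surj_def)
qed

text \<open>Constants are squares, so the even powers in \<open>g\<close> add up to a square and the
  odd ones to \<open>x\<close> times a square. Multiplication by \<open>x\<close> in the induction
  step exchanges the two parts.\<close>

private lemma poly_squares:
  "\<exists>r s. \<iota> (poly_fract g) = \<iota> (poly_fract r) * \<iota> (poly_fract r) + \<iota> ratfun_x * (\<iota> (poly_fract s) * \<iota> (poly_fract s))"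
proof (induction g)
  case 0
  then show ?case by (intro exI[of _ 0]) (simp add: fract_collapse)
next
  case (pCons c g)
  then obtain r s where rs: "\<iota> (poly_fract g) = \<iota> (poly_fract r) * \<iota> (poly_fract r)
    + \<iota> ratfun_x * (\<iota> (poly_fract s) * \<iota> (poly_fract s))" by blast
  obtain d where d: "c = d * d" using const_square by blast
  have "\<iota> (poly_fract (pCons c g)) = \<kappa> d * \<kappa> d + \<iota> ratfun_x * \<iota> (poly_fract g)"
    unfolding poly_fract_pCons d by (simp flip: \<kappa>_mult) (simp add: \<kappa>_def)
  also have "\<dots> = (\<kappa> d * \<kappa> d + (\<iota> ratfun_x * \<iota> (poly_fract s)) * (\<iota> ratfun_x * \<iota> (poly_fract s)))
      + \<iota> ratfun_x * (\<iota> (poly_fract r) * \<iota> (poly_fract r))"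
    unfolding rs by (simp add: algebra_simps)
  also have "\<dots> = (\<kappa> d + \<iota> ratfun_x * \<iota> (poly_fract s)) * (\<kappa> d + \<iota> ratfun_x * \<iota> (poly_fract s))
      + \<iota> ratfun_x * (\<iota> (poly_fract r) * \<iota> (poly_fract r))"
    by (simp only: square_add)
  also have "\<kappa> d + \<iota> ratfun_x * \<iota> (poly_fract s) = \<iota> (poly_fract (pCons d s))"
    unfolding poly_fract_pCons by (simp add: \<kappa>_def)
  finally show ?case by blast
qed

text \<open>Clearing the denominator of \<open>y * y\<close> gives
  \<open>u * u = r^2 + x s^2\<close>. In characteristic 2 this says
  \<open>(u + r)^2 = x s^2\<close>, so \<open>(u + r) / s\<close> is a root of \<open>x\<close>;
  here \<open>s\<close> is nonzero because \<open>y\<close> lies outside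
  \<open>k(x)\<close>.\<close>

private lemma x_square: "\<exists>z. z * z = \<iota> ratfun_x"
proof -
  obtain y where y: "y \<notin> range \<iota>" using generator by blast
  obtain a where a: "y * y = \<iota> a" using norm_in_base[of y] inseparable by auto
  obtain n m where nm: "a = Fract n m" "m \<noteq> 0" by (cases a) auto
  obtain r s where rs: "\<iota> (poly_fract (n * m)) = \<iota> (poly_fract r) * \<iota> (poly_fract r)
    + \<iota> ratfun_x * (\<iota> (poly_fract s) * \<iota> (poly_fract s))" using poly_squares by blast
  define u where "u = y * \<iota> (poly_fract m)"
  have "u * u = \<iota> (a * (poly_fract m * poly_fract m))"
    unfolding u_def emb_mult a[symmetric] by (simp add: mult_ac)
  also have "a * (poly_fract m * poly_fract m) = poly_fract (n * m)"
    using nm by (simp add: eq_fract)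
  finally have uu: "u * u = \<iota> (poly_fract (n * m))" .
  have "u - \<iota> (poly_fract r) \<noteq> 0"
  proof
    assume "u - \<iota> (poly_fract r) = 0"
    then have "y = \<iota> (poly_fract r / poly_fract m)" using nm(2) by (simp add: u_def field_simps del: divide_fract)
    then show False using y by blast
  qed
  define z where "z = u + \<iota> (poly_fract r)"
  have z0: "z \<noteq> 0" using \<open>u - \<iota> (poly_fract r) \<noteq> 0\<close> minus_eq[of "\<iota> (poly_fract r)"]
    by (metis z_def diff_conv_add_uminus)
  have zz: "z * z = \<iota> ratfun_x * (\<iota> (poly_fract s) * \<iota> (poly_fract s))"
  proof -
    have "z * z = u * u + \<iota> (poly_fract r) * \<iota> (poly_fract r)" unfolding z_def by (rule square_add)
    also have "\<dots> = \<iota> ratfun_x * (\<iota> (poly_fract s) * \<iota> (poly_fract s))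
        + (\<iota> (poly_fract r) * \<iota> (poly_fract r) + \<iota> (poly_fract r) * \<iota> (poly_fract r))"
      unfolding uu rs by (simp only: add_ac)
    also have "\<dots> = \<iota> ratfun_x * (\<iota> (poly_fract s) * \<iota> (poly_fract s))"
      using minus_eq[of "\<iota> (poly_fract r) * \<iota> (poly_fract r)"] by (metis add.right_inverse add.right_neutral)
    finally show ?thesis .
  qed
  then have "\<iota> (poly_fract s) \<noteq> 0" using z0 by (metis mult_zero_right mult_eq_0_iff)
  then have "(z / \<iota> (poly_fract s)) * (z / \<iota> (poly_fract s)) = \<iota> ratfun_x"
    using zz by (simp add: field_simps)
  then show ?thesis by blast
qed

text \<open>The field \<open>K\<close> consists of the square roots of the elements of \<open>k(x)\<close>.\<close>

lemma inseparable_sqrt: "\<exists>z. z * z = \<iota> a"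
proof (cases a)
  case (Fract n m)
  obtain x where x: "x * x = \<iota> ratfun_x" using x_square by blast
  have poly: "\<exists>z. z * z = \<iota> (poly_fract g)" for g
  proof -
    obtain r s where "\<iota> (poly_fract g) = \<iota> (poly_fract r) * \<iota> (poly_fract r)
      + \<iota> ratfun_x * (\<iota> (poly_fract s) * \<iota> (poly_fract s))" using poly_squares by blast
    also have "\<dots> = \<iota> (poly_fract r) * \<iota> (poly_fract r) + (x * \<iota> (poly_fract s)) * (x * \<iota> (poly_fract s))"
      unfolding x[symmetric] by (simp only: mult_ac)
    also have "\<dots> = (\<iota> (poly_fract r) + x * \<iota> (poly_fract s)) * (\<iota> (poly_fract r) + x * \<iota> (poly_fract s))"
      by (simp only: square_add)
    finally show ?thesis by metis
  qed
  obtain u v where "u * u = \<iota> (poly_fract n)" "v * v = \<iota> (poly_fract m)" using poly by metis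
  then have "(u / v) * (u / v) = \<iota> (poly_fract n) / \<iota> (poly_fract m)" by simp
  also have "\<dots> = \<iota> a" using Fract by (simp flip: emb_divide)
  finally show ?thesis by blast
qed

text \<open>A uniformizer of \<open>v\<close> is a square in \<open>K\<close>, so its value
  \<open>e\<close> at \<open>w\<close> is even.\<close>

lemma inseparable_ramified:
  assumes "w \<in> K_places" "v \<in> places ratfun_const" "lies_over \<iota> v e w"
  shows "e = 2"
proof -
  interpret valuation w using assms(1) by (rule places_valuation)
  obtain a where a: "a \<noteq> 0" "v a = 1" using places_uniformizer[OF assms(2)] by blast
  obtain z where z: "z * z = \<iota> a" using inseparable_sqrt by blast
  then have "z \<noteq> 0" using a by auto
  then have "2 * w z = int e" using mult[of z z] z assms(3) a(2) by (simp add: lies_over_def)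
  moreover obtain p where "w p = 1" using places_uniformizer[OF assms(1)] by blast
  then have "e \<le> 2" using ramification_le_2[OF valuation_axioms _ assms(3)] by blast
  moreover have "e \<ge> 1" using assms(3) by (simp add: lies_over_def)
  ultimately show ?thesis by presburger
qed

lemma inseparable_infinite_ramified:
  "infinite {v \<in> places ratfun_const. ramified \<iota> ratfun_const v}"
proof -
  have "finite_places \<subseteq> {v \<in> places ratfun_const. ramified \<iota> ratfun_const v}"
  proof
    fix v :: "'k poly fract \<Rightarrow> int" assume v: "v \<in> finite_places"
    then have vp: "v \<in> places ratfun_const" by (simp add: finite_places_def)
    obtain w e where w: "w \<in> fin_K_places" "lies_over \<iota> v e w" using place_above[OF v] by blast
    then have wK: "w \<in> K_places" by (simp add: fin_K_places_def)
    then have "e = 2" using inseparable_ramified vp w(2) by blast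
    then have "ramified \<iota> ratfun_const v"
      using w(2) wK unfolding ramified_def K_places_def by (intro bexI[of _ w] exI[of _ 2]) auto
    then show "v \<in> {v \<in> places ratfun_const. ramified \<iota> ratfun_const v}" using vp by blast
  qed
  then show ?thesis using infinite_finite_places finite_subset by blast
qed

text \<open>A square root of the polynomial below \<open>w\<close> has the divisor
  \<open>w - deg(w) w_inf\<close>. Products of such roots realise the finite part of
  \<open>D\<close>, and degree zero then fixes the coefficient at \<open>w_inf\<close>.\<close>

lemma inseparable_principal:
  assumes D: "keys D \<subseteq> K_places" "divisor_degree \<kappa> D = 0"
  shows "D \<in> principal_divisors \<kappa>"
proof -
  let ?D = "lookup D"
  have "\<exists>z. z \<noteq> 0 \<and> w_inf z = - int (place_degree \<kappa> w) \<and> (\<forall>w'\<in>fin_K_places. w' z = of_bool (w' = w))"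
    if w: "w \<in> fin_K_places" for w
  proof -
    have conj: "u \<circ> \<sigma> = u" for u :: "'K \<Rightarrow> int" by (simp add: fun_eq_iff inseparable)
    obtain v e where v: "v \<in> finite_places" "lies_over \<iota> v e w"
      using fin_place_below[OF w] by blast
    then have e: "e = 2" using inseparable_ramified w by (auto simp: fin_K_places_def finite_places_def)
    obtain z where z: "z * z = \<iota> (poly_fract (place_poly v))" using inseparable_sqrt by blast
    have z0: "z \<noteq> 0" using z place_poly(1)[OF v(1)] by auto
    have val: "2 * w' z = w' (\<iota> (poly_fract (place_poly v)))" if "w' \<in> K_places" for w'
      using valuation.mult[OF places_valuation[OF that] z0 z0] z by simp
    have "place_degree \<kappa> w = degree (place_poly v)"
      using ramified_place_degree[OF w v(1)] v(2) e by blast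
    then have "w_inf z = - int (place_degree \<kappa> w)"
      using val[OF w_inf_place] w_inf_place_poly[OF place_poly(1)[OF v(1)]] by simp
    moreover have "w' z = of_bool (w' = w)" if "w' \<in> fin_K_places" for w'
      using val[of w'] value_place_poly[OF w v that] that e by (auto simp: fin_K_places_def conj)
    ultimately show ?thesis using z0 by blast
  qed
  then obtain z where z: "\<And>w. w \<in> fin_K_places \<Longrightarrow> z w \<noteq> 0 \<and> w_inf (z w) = - int (place_degree \<kappa> w) \<and>
    (\<forall>w'\<in>fin_K_places. w' (z w) = of_bool (w' = w))" by metis
  define S where "S = keys D - {w_inf}"
  have S: "finite S" "S \<subseteq> fin_K_places" using D(1) by (auto simp: S_def fin_K_places_def)
  have nz: "z w \<noteq> 0" if "w \<in> S" for w using z S(2) that by blast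
  define f where "f = (\<Prod>w\<in>S. z w powi ?D w)"
  have f0: "f \<noteq> 0" using nz S(1) by (simp add: f_def)
  have val: "w f = (\<Sum>P\<in>S. ?D P * w (z P))" if "w \<in> K_places" for w
    using valuation.prod_power_int[OF places_valuation[OF that] S(1) nz] by (simp add: f_def)
  have "?D w = w f" if w: "w \<in> K_places" for w
  proof (cases "w = w_inf")
    case True
    have "0 = (\<Sum>P\<in>insert w_inf S. ?D P * int (place_degree \<kappa> P))"
      unfolding D(2)[symmetric] using S(1) by (intro divisor_degree_superset) (auto simp: S_def)
    also have "\<dots> = ?D w_inf + (\<Sum>P\<in>S. ?D P * int (place_degree \<kappa> P))"
      using S by (subst sum.insert) (auto simp: fin_K_places_def place_degree_w_inf)
    finally have "?D w_inf = (\<Sum>P\<in>S. ?D P * (- int (place_degree \<kappa> P)))"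
      by (simp add: sum_negf)
    also have "\<dots> = w_inf f"
      unfolding val[OF w_inf_place] using z S(2) by (intro sum.cong refl) auto
    finally show ?thesis using True by simp
  next
    case False
    then have wf: "w \<in> fin_K_places" using w by (simp add: fin_K_places_def)
    have "w (z P) = of_bool (w = P)" if "P \<in> S" for P using z[of P] S(2) that wf by blast
    then have "w f = (\<Sum>P\<in>S. ?D P * of_bool (w = P))"
      unfolding val[OF w] by (intro sum.cong refl) (simp only:)
    also have "\<dots> = (\<Sum>P\<in>S. if P = w then ?D P else 0)" by (intro sum.cong refl) auto
    also have "\<dots> = ?D w" using S(1) False by (auto simp: S_def in_keys_iff)
    finally show ?thesis by simp
  qed
  then show ?thesis unfolding principal_divisors_iff using D(1) f0 by auto
qed

end

end

section \<open>Counting classes\<close>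

lemma r_coset_degree_zero: "H #>\<^bsub>degree_zero_divisors \<kappa>\<^esub> D = {E. E - D \<in> H}"
proof -
  have "h \<otimes>\<^bsub>degree_zero_divisors \<kappa>\<^esub> D = h + D" for h
    by (simp add: degree_zero_divisors_def free_Abelian_group_def)
  then show ?thesis unfolding r_coset_def
    by (auto simp: algebra_simps intro: bexI[of _ "_ - D"])
qed

lemma carrier_degree_zero_divisors:
  "carrier (degree_zero_divisors \<kappa>) = {D. keys D \<subseteq> places \<kappa> \<and> divisor_degree \<kappa> D = 0}"
  by (auto simp: degree_zero_divisors_def)

lemma carrier_degree_zero_class_group:
  "carrier (degree_zero_class_group \<kappa>) =
     (\<lambda>D. {E. E - D \<in> principal_divisors \<kappa>}) ` carrier (degree_zero_divisors \<kappa>)"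
  by (auto simp: degree_zero_class_group_def FactGroup_def RCOSETS_def r_coset_degree_zero)

lemma class_eq_iff:
  "{E. E - D \<in> principal_divisors \<kappa>} = {E. E - D' \<in> principal_divisors \<kappa>} \<longleftrightarrow>
     D - D' \<in> principal_divisors \<kappa>"
proof
  assume eq: "{E. E - D \<in> principal_divisors \<kappa>} = {E. E - D' \<in> principal_divisors \<kappa>}"
  have "D \<in> {E. E - D \<in> principal_divisors \<kappa>}" using principal_divisors_0 by simp
  then show "D - D' \<in> principal_divisors \<kappa>" unfolding eq by simp
next
  assume d: "D - D' \<in> principal_divisors \<kappa>"
  have "E - D \<in> principal_divisors \<kappa> \<longleftrightarrow> E - D' \<in> principal_divisors \<kappa>" for E
    using principal_divisors_add[OF _ d, of "E - D"] principal_divisors_diff[OF _ d, of "E - D'"] by auto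
  then show "{E. E - D \<in> principal_divisors \<kappa>} = {E. E - D' \<in> principal_divisors \<kappa>}" by blast
qed

lemma has_exponent_two_iff:
  "has_exponent_two (degree_zero_class_group \<kappa>) \<longleftrightarrow>
     (\<forall>D\<in>carrier (degree_zero_divisors \<kappa>). D + D \<in> principal_divisors \<kappa>)"
proof -
  let ?H = "principal_divisors \<kappa>" and ?G = "degree_zero_class_group \<kappa>"
  let ?c = "\<lambda>D. {E. E - D \<in> ?H}"
  have mult: "?c D \<otimes>\<^bsub>?G\<^esub> ?c D' = ?c (D + D')" for D D'
  proof -
    have "?c D \<otimes>\<^bsub>?G\<^esub> ?c D' = (\<Union>E\<in>?c D. \<Union>E'\<in>?c D'. {E + E'})"
      by (simp add: degree_zero_class_group_def FactGroup_def set_mult_def degree_zero_divisors_def free_Abelian_group_def)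
    also have "\<dots> = ?c (D + D')"
    proof (intro equalityI subsetI)
      fix x assume "x \<in> (\<Union>E\<in>?c D. \<Union>E'\<in>?c D'. {E + E'})"
      then obtain E E' where x: "x = E + E'" "E - D \<in> ?H" "E' - D' \<in> ?H" by blast
      then have "(E - D) + (E' - D') \<in> ?H" using principal_divisors_add by blast
      then show "x \<in> ?c (D + D')" using x(1) by (simp add: algebra_simps)
    next
      fix x assume "x \<in> ?c (D + D')"
      then have "x = (x - D') + D'" "x - D' \<in> ?c D" "D' \<in> ?c D'"
        using principal_divisors_0 by (simp_all add: algebra_simps)
      then show "x \<in> (\<Union>E\<in>?c D. \<Union>E'\<in>?c D'. {E + E'})" by blast
    qed
    finally show ?thesis .
  qed
  have one: "\<one>\<^bsub>?G\<^esub> = ?c 0" by (simp add: degree_zero_class_group_def FactGroup_def)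
  have "?c D [^]\<^bsub>?G\<^esub> (2::nat) = ?c (D + D)" for D
  proof -
    have "?c D [^]\<^bsub>?G\<^esub> (2::nat) = \<one>\<^bsub>?G\<^esub> \<otimes>\<^bsub>?G\<^esub> ?c D \<otimes>\<^bsub>?G\<^esub> ?c D"
      by (simp add: numeral_2_eq_2 nat_pow_def)
    also have "\<dots> = ?c (0 + D + D)" unfolding one mult ..
    finally show ?thesis by simp
  qed
  then have "?c D [^]\<^bsub>?G\<^esub> (2::nat) = \<one>\<^bsub>?G\<^esub> \<longleftrightarrow> D + D \<in> ?H" for D
    unfolding one using class_eq_iff[of "D + D" \<kappa> 0] by simp
  then show ?thesis
    unfolding has_exponent_two_def carrier_degree_zero_class_group by auto
qed

text \<open>\<open>T\<close> consists of the classes killed by 2. An infinite group would have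
  \<open>order\<close> 0, which differs from the positive \<open>card T\<close>; so equality makes
  the group finite, and a subset of full size is everything.\<close>

lemma exponent_two_iff_order:
  fixes \<kappa> :: "'k::field \<Rightarrow> 'a::field"
  defines "T \<equiv> (\<lambda>D. {E. E - D \<in> principal_divisors \<kappa>}) `
    {D \<in> carrier (degree_zero_divisors \<kappa>). D + D \<in> principal_divisors \<kappa>}"
  assumes "card T > 0"
  shows "has_exponent_two (degree_zero_class_group \<kappa>) \<longleftrightarrow> order (degree_zero_class_group \<kappa>) = card T"
proof
  assume "has_exponent_two (degree_zero_class_group \<kappa>)"
  then have "T = carrier (degree_zero_class_group \<kappa>)"
    unfolding has_exponent_two_iff T_def carrier_degree_zero_class_group by blast
  then show "order (degree_zero_class_group \<kappa>) = card T" by (simp add: order_def)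
next
  assume eq: "order (degree_zero_class_group \<kappa>) = card T"
  then have "finite (carrier (degree_zero_class_group \<kappa>))"
    using assms(2) by (metis order_def card_gt_0_iff)
  moreover have "T \<subseteq> carrier (degree_zero_class_group \<kappa>)"
    unfolding T_def carrier_degree_zero_class_group by blast
  ultimately have T: "T = carrier (degree_zero_class_group \<kappa>)"
    using eq by (intro card_subset_eq) (simp_all add: order_def)
  show "has_exponent_two (degree_zero_class_group \<kappa>)"
    unfolding has_exponent_two_iff
  proof
    fix D assume D: "D \<in> carrier (degree_zero_divisors \<kappa>)"
    then have "{E. E - D \<in> principal_divisors \<kappa>} \<in> T"
      unfolding T carrier_degree_zero_class_group by blast
    then obtain D' where D': "D' + D' \<in> principal_divisors \<kappa>" "D - D' \<in> principal_divisors \<kappa>"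
      unfolding T_def using class_eq_iff by blast
    \<comment> \<open>The class of \<open>D\<close> has a representative \<open>D'\<close> whose
      double is principal; the property carries over to \<open>D\<close>.\<close>
    have "(D - D') + (D - D') + (D' + D') \<in> principal_divisors \<kappa>"
      by (rule principal_divisors_add[OF principal_divisors_add[OF D'(2) D'(2)] D'(1)])
    then show "D + D \<in> principal_divisors \<kappa>" by (simp add: algebra_simps)
  qed
qed

context separable_quadratic
begin

text \<open>A ramified place of \<open>k(x)\<close> has exactly one place above it, so both sides
  count the same places; the extra 1 is \<open>v_inf\<close>.\<close>

lemma card_ramified:
  "card {v \<in> places ratfun_const. ramified \<iota> ratfun_const v} = card ram_places + 1"
proof -
  let ?R = "{v \<in> places ratfun_const. ramified \<iota> ratfun_const v}"
  have "\<exists>v. v \<in> places ratfun_const \<and> lies_over \<iota> v 2 w" if w: "w \<in> ram_places" for w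
  proof -
    obtain v' where v': "lies_over \<iota> v' 2 w" using w by (auto simp: ram_places_def)
    obtain v e where v: "v \<in> places ratfun_const" "lies_over \<iota> v e w" "e = 1 \<or> e = 2"
      using place_below[OF ram_places_K[OF w]] by blast
    obtain a where "v a = 1" using places_uniformizer[OF v(1)] by blast
    then have "w (\<iota> a) = int e" using v(2) by (simp add: lies_over_def)
    then have "e \<noteq> 1" using ram_places_even[OF w, of a] by auto
    then show ?thesis using v by blast
  qed
  then obtain B where B: "\<And>w. w \<in> ram_places \<Longrightarrow> B w \<in> places ratfun_const \<and> lies_over \<iota> (B w) 2 w"
    by metis
  have inf: "v_inf \<in> ?R" using v_inf w_inf by (auto simp: ramified_def intro!: bexI[of _ w_inf] exI[of _ 2])
  have "inj_on B ram_places"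
    using B ramified_place_unique ram_places_K by (metis inj_onI)
  moreover have "B ` ram_places = ?R - {v_inf}"
  proof (intro equalityI subsetI)
    fix v assume "v \<in> B ` ram_places"
    then obtain w where w: "w \<in> ram_places" "v = B w" by blast
    have "v \<noteq> v_inf"
      using B[OF w(1)] w ramified_place_unique[OF w_inf_place ram_places_K[OF w(1)] w_inf(2)] w_inf_not_ram by blast
    moreover have "ramified \<iota> ratfun_const v"
      using B[OF w(1)] w(2) ram_places_K[OF w(1)] unfolding ramified_def K_places_def
      by (intro bexI[of _ w] exI[of _ 2]) auto
    ultimately show "v \<in> ?R - {v_inf}" using B w by blast
  next
    fix v assume v: "v \<in> ?R - {v_inf}"
    then obtain w e where w: "w \<in> K_places" "e > 1" "lies_over \<iota> v e w"
      unfolding ramified_def K_places_def by blast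
    obtain p where "w p = 1" using places_uniformizer[OF w(1)] by blast
    then have "e \<le> 2" using ramification_le_2[OF places_valuation[OF w(1)] _ w(3)] by blast
    then have e: "e = 2" using w(2) by simp
    have "w \<noteq> w_inf" using lies_over_unique(1)[OF _ w_inf(2) _ v_inf(1)] w(3) v by blast
    then have wr: "w \<in> ram_places" using w e by (auto simp: ram_places_def fin_K_places_def)
    then have "B w = v" using B[OF wr] lies_over_unique(1)[OF _ w(3)] v by blast
    then show "v \<in> B ` ram_places" using wr by blast
  qed
  ultimately have "card (?R - {v_inf}) = card ram_places" by (metis card_image)
  moreover have "finite (?R - {v_inf})" using finite_ram_places \<open>B ` ram_places = _\<close> by (metis finite_imageI)
  then have "finite ?R" by (subst (asm) finite_Diff2) auto
  ultimately show ?thesis using card_Suc_Diff1[OF _ inf] by simp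
qed

lemma torsion_classes:
  "(\<lambda>D. {E. E - D \<in> principal_divisors \<kappa>}) `
     {D \<in> carrier (degree_zero_divisors \<kappa>). D + D \<in> principal_divisors \<kappa>} =
   (\<lambda>S. {E. E - ram_divisor S \<in> principal_divisors \<kappa>}) ` Pow ram_places"
proof -
  let ?T = "{D \<in> carrier (degree_zero_divisors \<kappa>). D + D \<in> principal_divisors \<kappa>}"
  let ?c = "\<lambda>D. {E. E - D \<in> principal_divisors \<kappa>}"
  have "?c D \<in> (\<lambda>S. ?c (ram_divisor S)) ` Pow ram_places" if "D \<in> ?T" for D
  proof -
    have D: "keys D \<subseteq> K_places" "divisor_degree \<kappa> D = 0" "D + D \<in> principal_divisors \<kappa>"
      using that by (simp_all add: carrier_degree_zero_divisors)
    obtain S where "S \<subseteq> ram_places" "D - ram_divisor S \<in> principal_divisors \<kappa>"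
      using torsion_representative[OF D] by auto
    then have "?c D = ?c (ram_divisor S)" "S \<in> Pow ram_places" by (simp_all only: class_eq_iff Pow_iff)
    then show ?thesis by (rule image_eqI)
  qed
  moreover have "?c (ram_divisor S) \<in> ?c ` ?T" if "S \<in> Pow ram_places" for S
  proof (rule imageI)
    have "S \<subseteq> ram_places" "S \<subseteq> K_places" using that ram_places_K by auto
    then show "ram_divisor S \<in> ?T"
      using ram_divisor_double degree_ram_divisor keys_ram_divisor
      by (simp add: carrier_degree_zero_divisors)
  qed
  ultimately show ?thesis by (intro equalityI image_subsetI)
qed

text \<open>In characteristic 2 distinct sets give distinct classes. Otherwise a class comes from a
  set and its complement, and the sets avoiding one fixed place represent each pair once.\<close>

lemma card_torsion_classes:
  assumes const: "full_constant_field \<kappa>"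
  shows "card ((\<lambda>D. {E. E - D \<in> principal_divisors \<kappa>}) `
     {D \<in> carrier (degree_zero_divisors \<kappa>). D + D \<in> principal_divisors \<kappa>}) =
     2 ^ (if (2 :: 'k) = 0 then card ram_places else card ram_places - 1)"
proof -
  let ?c = "\<lambda>S. {E. E - ram_divisor S \<in> principal_divisors \<kappa>}"
  have fiber: "S = S' \<or> ((2 :: 'k) \<noteq> 0 \<and> S' = ram_places - S)"
    if "S \<subseteq> ram_places" "S' \<subseteq> ram_places" "?c S = ?c S'" for S S'
    using ram_divisor_fiber[OF const that(1,2)] that(3) class_eq_iff by blast
  show ?thesis
  proof (cases "(2 :: 'k) = 0 \<or> ram_places = {}")
    \<comment> \<open>Without finite ramified places the empty set is the only one, and the exponent
      \<open>card ram_places - 1\<close> is truncated to 0.\<close>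
    case True
    then have "inj_on ?c (Pow ram_places)" using fiber by (intro inj_onI) blast
    then show ?thesis unfolding torsion_classes using True finite_ram_places
      by (auto simp: card_image card_Pow)
  next
    case False
    then obtain w where w: "w \<in> ram_places" by blast
    have "?c ` Pow ram_places = ?c ` Pow (ram_places - {w})"
    proof (intro equalityI subsetI)
      fix C assume "C \<in> ?c ` Pow ram_places"
      then obtain S where S: "S \<subseteq> ram_places" "C = ?c S" by blast
      then have "C = ?c (ram_places - S)"
        using ram_divisor_complement[of S] False class_eq_iff by blast
      moreover have "S \<in> Pow (ram_places - {w}) \<or> ram_places - S \<in> Pow (ram_places - {w})"
        using S(1) by blast
      ultimately show "C \<in> ?c ` Pow (ram_places - {w})" using S(2) by blast
    qed blast
    moreover have "inj_on ?c (Pow (ram_places - {w}))"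
    proof (rule inj_onI)
      fix S S' assume S: "S \<in> Pow (ram_places - {w})" "S' \<in> Pow (ram_places - {w})" "?c S = ?c S'"
      then have "S = S' \<or> S' = ram_places - S" using fiber[of S S'] by blast
      then show "S = S'" using S w by blast
    qed
    ultimately show ?thesis unfolding torsion_classes using False w finite_ram_places
      by (simp add: card_image card_Pow)
  qed
qed

end

theorem theorem2:
  fixes \<iota> :: "'k::{field,finite} poly fract \<Rightarrow> 'K::field"
    and v_inf :: "'k poly fract \<Rightarrow> int"
    and \<kappa> :: "'k \<Rightarrow> 'K"
    and q h t :: nat
  assumes embedding: "field_embedding \<iota>"
    and quadratic: "extension_degree \<iota> = 2"
    and kappa: "\<kappa> = \<iota> \<circ> ratfun_const"
    and constants: "full_constant_field \<kappa>"
    and infinite_place: "v_inf \<in> places ratfun_const" "v_inf ratfun_x < 0"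
    and infinite_place_ramifies: "ramified \<iota> ratfun_const v_inf"
    and q: "q = CARD('k)"
    and h: "h = order (degree_zero_class_group \<kappa>)"
    and t: "t = card {v \<in> places ratfun_const. ramified \<iota> ratfun_const v}"
  shows "(odd q \<longrightarrow> (has_exponent_two (degree_zero_class_group \<kappa>) \<longleftrightarrow> h = 2 ^ (t - 2))) \<and>
         (even q \<longrightarrow> (has_exponent_two (degree_zero_class_group \<kappa>) \<longleftrightarrow> h = 2 ^ (t - 1)))"
proof -
  interpret embedded_field \<iota> using embedding by unfold_locales
  obtain \<sigma> where \<sigma>: "(\<forall>a b. \<sigma> (a + b) = \<sigma> a + \<sigma> b) \<and> (\<forall>a b. \<sigma> (a * b) = \<sigma> a * \<sigma> b) \<and>
    (\<forall>a. \<sigma> (\<iota> a) = \<iota> a) \<and> (\<forall>z. \<sigma> (\<sigma> z) = z) \<and> (\<forall>z. z + \<sigma> z \<in> range \<iota>) \<and> (\<forall>z. z * \<sigma> z \<in> range \<iota>)"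
    using conjugation_exists[OF quadratic] by blast
  interpret quadratic_extension \<iota> \<sigma>
    using quadratic_generator[OF quadratic] \<sigma> by unfold_locales auto
  obtain w_inf e where w: "w_inf \<in> places (\<iota> \<circ> ratfun_const)" "e > 1" "lies_over \<iota> v_inf e w_inf"
    using infinite_place_ramifies unfolding ramified_def by blast
  obtain p where "w_inf p = 1" using places_uniformizer[OF w(1)] by blast
  then have "e \<le> 2" using ramification_le_2[OF places_valuation[OF w(1)] _ w(3)] by blast
  then have "e = 2" using w(2) by simp
  then interpret F: quadratic_function_field \<iota> \<sigma> v_inf w_inf
    using infinite_place w by unfold_locales auto
  have \<kappa>: "\<kappa> = F.\<kappa>" by (simp add: kappa F.\<kappa>_def)
  show ?thesis
  proof (cases "\<exists>y. \<sigma> y \<noteq> y")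
    case True
    then interpret S: separable_quadratic \<iota> \<sigma> v_inf w_inf by unfold_locales
    let ?T = "(\<lambda>D. {E. E - D \<in> principal_divisors \<kappa>}) `
      {D \<in> carrier (degree_zero_divisors \<kappa>). D + D \<in> principal_divisors \<kappa>}"
    \<comment> \<open>\<open>t\<close> counts the infinite place too, so
      \<open>card ram_places\<close> is \<open>t - 1\<close>.\<close>
    have card: "card ?T = 2 ^ (if (2 :: 'k) = 0 then t - 1 else t - 2)"
      using S.card_torsion_classes constants S.card_ramified by (simp add: \<kappa> t)
    then have "has_exponent_two (degree_zero_class_group \<kappa>) \<longleftrightarrow> h = card ?T"
      unfolding h by (intro exponent_two_iff_order) simp
    then show ?thesis unfolding card q even_card_field_iff by auto
  next
    case False
    then have insep: "\<sigma> z = z" for z by blast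
    have "(2 :: 'k) = 0"
      using F.inseparable_char_2[OF insep] .
    then have "even q" by (simp add: q even_card_field_iff)
    \<comment> \<open>Truncated subtraction makes \<open>t - 1\<close> equal to 0, so the formula
      for even \<open>q\<close> demands \<open>h = 1\<close>.\<close>
    have "t = 0" using F.inseparable_infinite_ramified[OF insep] by (simp add: t)
    have "D - 0 \<in> principal_divisors \<kappa>" if "D \<in> carrier (degree_zero_divisors \<kappa>)" for D
      using F.inseparable_principal[OF insep, of D] that by (simp add: \<kappa> carrier_degree_zero_divisors)
    then have pr: "D \<in> principal_divisors \<kappa>" if "D \<in> carrier (degree_zero_divisors \<kappa>)" for D
      using that by simp
    have ex: "has_exponent_two (degree_zero_class_group \<kappa>)"
      unfolding has_exponent_two_iff using pr principal_divisors_add by blast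
    have "carrier (degree_zero_class_group \<kappa>) = {{E. E - 0 \<in> principal_divisors \<kappa>}}"
    proof -
      have "0 \<in> carrier (degree_zero_divisors \<kappa>)"
        by (simp add: carrier_degree_zero_divisors divisor_degree_def)
      moreover have "{E. E - D \<in> principal_divisors \<kappa>} = {E. E - 0 \<in> principal_divisors \<kappa>}"
        if "D \<in> carrier (degree_zero_divisors \<kappa>)" for D
        unfolding class_eq_iff using pr[OF that] by simp
      ultimately show ?thesis unfolding carrier_degree_zero_class_group by blast
    qed
    then have "h = 1" by (simp add: h order_def)
    then show ?thesis using \<open>even q\<close> \<open>t = 0\<close> ex by simp
  qed
qed

end
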